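(* Assume that $n\ge2$. For a given $\lambda>2n-1$, choose symbols $a\in L^\infty(\mathrm{D}^{\mathrm{I}}_{n\times n})^{\mathrm{U}(n)_L}$ and $b\in L^\infty(\mathrm{D}^{\mathrm{I}}_{n\times n})^{\mathrm{U}(n)_R}$ such that the Toeplitz operators $T^{(\lambda)}_a$ and $T^{(\lambda)}_b$ are not normal, and let $$\mathcal{S}=L^\infty(\mathrm{D}^{\mathrm{I}}_{n\times n})^{\mathrm{U}(n)\times\mathrm{U}(n)}\cup\{a,b\}.$$ Then, the Banach algebra $\mathcal{T}^{(\lambda)}(\mathcal{S})$ is commutative and non-$C^*$. In particular, the unital $C^*$-algebra generated by the Toeplitz operators $T^{(\lambda)}_\psi$ with $\psi\in\mathcal{S}$ is not commutative.
   Context: $\mathrm{D}^{\mathrm{I}}_{n\times n}=\{Z\in M_{n\times n}(\mathbb{C}): Z^*Z<I_n\}$. For $\lambda>2n-1$, $dv_\lambda(Z)=c_\lambda\det(I_n-ZZ^* )^{\lambda-2n}dv(Z)$, with $dv$ Lebesgue measure and $c_\lambda>0$ such that $v_\lambda(\mathrm{D}^{\mathrm{I}}_{n\times n})=1$. $\mathcal{A}^2_\lambda(\mathrm{D}^{\mathrm{I}}_{n\times n})$ is the weighted Bergman space of holomorphic functions in $L^2(\mathrm{D}^{\mathrm{I}}_{n\times n},v_\lambda)$, with orthogonal projection $B_\lambda$ from $L^2(\mathrm{D}^{\mathrm{I}}_{n\times n},v_\lambda)$. For $a\in L^\infty(\mathrm{D}^{\mathrm{I}}_{n\times n})$ (a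 symbol; functions equal a.e. are identified), $T^{(\lambda)}_a(f)=B_\lambda(af)$ on $\mathcal{A}^2_\lambda(\mathrm{D}^{\mathrm{I}}_{n\times n})$. For a set $\mathcal{S}$ of symbols, $\mathcal{T}^{(\lambda)}(\mathcal{S})$ is the unital Banach algebra generated by the $T^{(\lambda)}_\psi$, $\psi\in\mathcal{S}$, i.e. the smallest norm-closed subalgebra of bounded operators on $\mathcal{A}^2_\lambda(\mathrm{D}^{\mathrm{I}}_{n\times n})$ containing them and the identity; it is non-$C^*$ if it is not closed under taking adjoints. $L^\infty(\mathrm{D}^{\mathrm{I}}_{n\times n})^{\mathrm{U}(n)_L}$, $L^\infty(\mathrm{D}^{\mathrm{I}}_{n\times n})^{\mathrm{U}(n)_R}$ and $L^\infty(\mathrm{D}^{\mathrm{I}}_{n\times n})^{\mathrm{U}(n)\times\mathrm{U}(n)}$ are the spaces of symbols $a$ satisfying, respectively, $a(UZ)=a(Z)$ for every $U\in\mathrm{U}(n)$; $a(ZV)=a(Z)$ for every $V\in\mathrm{U}(n)$; and $a(A^{-1}ZB)=a(Z)$ for every $A,B\in\mathrm{U}(n)$. *)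

theory Defs
  imports "HOL-Analysis.Analysis"
begin

type_synonym 'n cmat = "complex^'n^'n"

definition ctranspose :: "'n::finite cmat \<Rightarrow> 'n cmat" where
  "ctranspose Z = (\<chi> i j. cnj (Z $ j $ i))"

definition pos_def :: "'n::finite cmat \<Rightarrow> bool" where
  "pos_def A \<longleftrightarrow> ctranspose A = A \<and>
     (\<forall>x::complex^'n. x \<noteq> 0 \<longrightarrow> 0 < Re (\<Sum>i\<in>UNIV. cnj (x $ i) * (A *v x) $ i))"

definition unitary_group :: "'n::finite cmat set" where
  "unitary_group = {U. ctranspose U ** U = mat 1 \<and> U ** ctranspose U = mat 1}"

definition cartan_domain :: "'n::finite cmat set" where
  "cartan_domain = {Z. pos_def (mat 1 - ctranspose Z ** Z)}"

(* On the domain the determinant is a positive real number, so taking Re loses nothing. *)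
definition bergman_weight :: "real \<Rightarrow> 'n::finite cmat \<Rightarrow> real" where
  "bergman_weight lam Z = Re (det (mat 1 - Z ** ctranspose Z)) powr (lam - 2 * real CARD('n))"

definition weighted_measure :: "real \<Rightarrow> real \<Rightarrow> 'n::finite cmat measure" where
  "weighted_measure lam c =
     density (lebesgue_on cartan_domain) (\<lambda>Z. ennreal (c * bergman_weight lam Z))"

definition bergman_measure :: "real \<Rightarrow> 'n::finite cmat measure" where
  "bergman_measure lam =
     weighted_measure lam
       (THE c. 0 < c \<and> emeasure (weighted_measure lam c :: 'n cmat measure) cartan_domain = 1)"

definition L2_space :: "real \<Rightarrow> ('n::finite cmat \<Rightarrow> complex) set" where
  "L2_space lam = {f \<in> borel_measurable (bergman_measure lam).
     integrable (bergman_measure lam) (\<lambda>Z. (cmod (f Z))\<^sup>2)}"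

definition L2_inner ::
  "real \<Rightarrow> ('n::finite cmat \<Rightarrow> complex) \<Rightarrow> ('n cmat \<Rightarrow> complex) \<Rightarrow> complex" where
  "L2_inner lam f g = (LINT Z|bergman_measure lam. f Z * cnj (g Z))"

definition L2_norm :: "real \<Rightarrow> ('n::finite cmat \<Rightarrow> complex) \<Rightarrow> real" where
  "L2_norm lam f = sqrt (LINT Z|bergman_measure lam. (cmod (f Z))\<^sup>2)"

(* Holomorphy in several variables: the real Frechet derivative exists and is complex linear. *)
definition holomorphic_mat :: "('n::finite cmat \<Rightarrow> complex) \<Rightarrow> 'n cmat set \<Rightarrow> bool" where
  "holomorphic_mat f D \<longleftrightarrow> (\<forall>Z\<in>D. \<exists>L. (f has_derivative L) (at Z within D) \<and>
     (\<forall>c X. L (\<chi> i j. c * X $ i $ j) = c * L X))"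

(* Functions are total on the matrix space; a function on the domain is represented by its
   extension by 0, so that equality in the Bergman space is equality of functions. *)
definition bergman_space :: "real \<Rightarrow> ('n::finite cmat \<Rightarrow> complex) set" where
  "bergman_space lam = {f \<in> L2_space lam. holomorphic_mat f cartan_domain \<and>
     (\<forall>Z. Z \<notin> cartan_domain \<longrightarrow> f Z = 0)}"

definition bergman_proj ::
  "real \<Rightarrow> ('n::finite cmat \<Rightarrow> complex) \<Rightarrow> ('n cmat \<Rightarrow> complex)" where
  "bergman_proj lam f = (THE g. g \<in> bergman_space lam \<and>
     (\<forall>h\<in>bergman_space lam. L2_inner lam (\<lambda>Z. f Z - g Z) h = 0))"

(* Symbols are represented by functions; only their class modulo null sets matters, and
   accordingly every invariance condition holds almost everywhere for each group element. *)
definition Linfty :: "('n::finite cmat \<Rightarrow> complex) set" where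
  "Linfty = {a \<in> borel_measurable (lebesgue_on cartan_domain).
     \<exists>C. AE Z in lebesgue_on cartan_domain. cmod (a Z) \<le> C}"

definition Linfty_left :: "('n::finite cmat \<Rightarrow> complex) set" where
  "Linfty_left = {a \<in> Linfty.
     \<forall>U\<in>unitary_group. AE Z in lebesgue_on cartan_domain. a (U ** Z) = a Z}"

definition Linfty_right :: "('n::finite cmat \<Rightarrow> complex) set" where
  "Linfty_right = {a \<in> Linfty.
     \<forall>V\<in>unitary_group. AE Z in lebesgue_on cartan_domain. a (Z ** V) = a Z}"

definition Linfty_biinv :: "('n::finite cmat \<Rightarrow> complex) set" where
  "Linfty_biinv = {a \<in> Linfty. \<forall>A\<in>unitary_group. \<forall>B\<in>unitary_group.
     AE Z in lebesgue_on cartan_domain. a (matrix_inv A ** Z ** B) = a Z}"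

type_synonym 'n bop = "('n cmat \<Rightarrow> complex) \<Rightarrow> ('n cmat \<Rightarrow> complex)"

(* Operators on the Bergman space are extensional in the sense of FuncSet: undefined outside
   the space, so that equality of operators is equality of functions. *)
definition bounded_ops :: "real \<Rightarrow> 'n::finite bop set" where
  "bounded_ops lam = {T \<in> bergman_space lam \<rightarrow>\<^sub>E bergman_space lam.
     (\<forall>f\<in>bergman_space lam. \<forall>g\<in>bergman_space lam.
        T (\<lambda>Z. f Z + g Z) = (\<lambda>Z. T f Z + T g Z)) \<and>
     (\<forall>c. \<forall>f\<in>bergman_space lam. T (\<lambda>Z. c * f Z) = (\<lambda>Z. c * T f Z)) \<and>
     (\<exists>K. \<forall>f\<in>bergman_space lam. L2_norm lam (T f) \<le> K * L2_norm lam f)}"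

definition op_id :: "real \<Rightarrow> 'n::finite bop" where
  "op_id lam = (\<lambda>f\<in>bergman_space lam. f)"

definition op_add :: "real \<Rightarrow> 'n::finite bop \<Rightarrow> 'n bop \<Rightarrow> 'n bop" where
  "op_add lam S T = (\<lambda>f\<in>bergman_space lam. \<lambda>Z. S f Z + T f Z)"

definition op_scale :: "real \<Rightarrow> complex \<Rightarrow> 'n::finite bop \<Rightarrow> 'n bop" where
  "op_scale lam c T = (\<lambda>f\<in>bergman_space lam. \<lambda>Z. c * T f Z)"

definition op_mult :: "real \<Rightarrow> 'n::finite bop \<Rightarrow> 'n bop \<Rightarrow> 'n bop" where
  "op_mult lam S T = compose (bergman_space lam) S T"

definition op_norm :: "real \<Rightarrow> 'n::finite bop \<Rightarrow> real" where
  "op_norm lam T = (SUP f\<in>{f \<in> bergman_space lam. L2_norm lam f \<le> 1}. L2_norm lam (T f))"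

definition op_dist :: "real \<Rightarrow> 'n::finite bop \<Rightarrow> 'n bop \<Rightarrow> real" where
  "op_dist lam S T = op_norm lam (op_add lam S (op_scale lam (-1) T))"

definition op_adj :: "real \<Rightarrow> 'n::finite bop \<Rightarrow> 'n bop" where
  "op_adj lam T = (THE S. S \<in> bounded_ops lam \<and>
     (\<forall>f\<in>bergman_space lam. \<forall>g\<in>bergman_space lam.
        L2_inner lam (T f) g = L2_inner lam f (S g)))"

definition normal_op :: "real \<Rightarrow> 'n::finite bop \<Rightarrow> bool" where
  "normal_op lam T \<longleftrightarrow> op_mult lam T (op_adj lam T) = op_mult lam (op_adj lam T) T"

definition toeplitz :: "real \<Rightarrow> ('n::finite cmat \<Rightarrow> complex) \<Rightarrow> 'n bop" where
  "toeplitz lam a = (\<lambda>f\<in>bergman_space lam. bergman_proj lam (\<lambda>Z. a Z * f Z))"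

definition unital_subalgebra :: "real \<Rightarrow> 'n::finite bop set \<Rightarrow> bool" where
  "unital_subalgebra lam A \<longleftrightarrow> A \<subseteq> bounded_ops lam \<and> op_id lam \<in> A \<and>
     (\<forall>S\<in>A. \<forall>T\<in>A. op_add lam S T \<in> A \<and> op_mult lam S T \<in> A) \<and>
     (\<forall>c. \<forall>T\<in>A. op_scale lam c T \<in> A)"

definition norm_closed :: "real \<Rightarrow> 'n::finite bop set \<Rightarrow> bool" where
  "norm_closed lam A \<longleftrightarrow>
     (\<forall>T\<in>bounded_ops lam. (\<forall>e>0. \<exists>S\<in>A. op_dist lam S T < e) \<longrightarrow> T \<in> A)"

definition adj_closed :: "real \<Rightarrow> 'n::finite bop set \<Rightarrow> bool" where
  "adj_closed lam A \<longleftrightarrow> (\<forall>T\<in>A. op_adj lam T \<in> A)"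

definition commutative_ops :: "real \<Rightarrow> 'n::finite bop set \<Rightarrow> bool" where
  "commutative_ops lam A \<longleftrightarrow> (\<forall>S\<in>A. \<forall>T\<in>A. op_mult lam S T = op_mult lam T S)"

definition toeplitz_banach_algebra ::
  "real \<Rightarrow> ('n::finite cmat \<Rightarrow> complex) set \<Rightarrow> 'n bop set" where
  "toeplitz_banach_algebra lam \<S> =
     \<Inter>{A. unital_subalgebra lam A \<and> norm_closed lam A \<and> toeplitz lam ` \<S> \<subseteq> A}"

definition toeplitz_cstar_algebra ::
  "real \<Rightarrow> ('n::finite cmat \<Rightarrow> complex) set \<Rightarrow> 'n bop set" where
  "toeplitz_cstar_algebra lam \<S> =
     \<Inter>{A. unital_subalgebra lam A \<and> norm_closed lam A \<and> adj_closed lam A \<and>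
         toeplitz lam ` \<S> \<subseteq> A}"

end

theory Submission
  imports Defs "HOL-Complex_Analysis.Conformal_Mappings"
begin

text \<open>Write \<open>T\<^sub>a\<close> for the Toeplitz operator with symbol \<open>a\<close> and \<open>U(n)\<close> for the unitary group.  Everything
rests on one commutation relation: \<open>T\<^sub>a T\<^sub>b = T\<^sub>b T\<^sub>a\<close> whenever \<open>a\<close> is invariant under left and \<open>b\<close> under
right multiplication by unitary matrices (lemma \<open>toep_commute\<close>).  A bi-invariant symbol is invariant
on both sides, so any two distinct symbols in \<open>\<S>\<close> form such a pair, and a norm-closed unital algebra
generated by commuting bounded operators is commutative (\<open>generated_algebra_commutative\<close>).  The rest
is formal: the Banach algebra contains \<open>T\<^sub>a\<close>; were it closed under adjoints, \<open>T\<^sub>a\<close> would commute with its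
adjoint, that is, be normal.  The C*-algebra contains \<open>T\<^sub>a\<close> and its adjoint, so it is not commutative.

The commutation relation is proved with integral kernels, without decomposing the Bergman space
into irreducible representations.  Fix \<open>0 < \<rho> < 1\<close>.  Evaluation of \<open>T\<^sub>a g\<close> at the scalar matrix \<open>\<rho>I\<close> has
the form \<open>g \<mapsto> \<integral> g \<kappa>\<close> with a square-integrable \<open>\<kappa>\<close> (\<open>toep_kernel\<close>).  The operator \<open>T\<^sub>a\<close> commutes with
\<open>f \<mapsto> f(U \<cdot>)\<close> for unitary \<open>U\<close> (\<open>toep_act\<close>) and, as a consequence, with the dilation \<open>f \<mapsto> f(\<rho> \<cdot>)\<close>
(\<open>toep_dil\<close>).
Hence \<open>(T\<^sub>a f)(\<rho>Y) = \<integral> f(YZ) \<kappa>(Z)\<close> holds for \<open>Y = \<rho>U\<close>.  Both sides are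
holomorphic in \<open>Y\<close>, and a holomorphic function on a convex open set around \<open>U(n)\<close> that vanishes on
\<open>U(n)\<close> is zero (\<open>unitary_uniqueness\<close>, by the Cayley transform and complexification of the Hermitian
matrices), so the formula holds for every \<open>Y\<close> in the domain (\<open>toep_integral_representation\<close>).  For a
right-invariant symbol \<open>b\<close> the same argument gives \<open>(T\<^sub>b f)(\<rho>Y) = \<integral> f(WY) \<kappa>'(W)\<close>.  Composed in either
order, the two formulas express the value at \<open>\<rho>\<^sup>2 X\<close> as a double integral of \<open>f(W X Z) \<kappa>'(W) \<kappa>(Z)\<close>, and
Fubini's theorem finishes the proof.

The analysis behind this needs the weighted measure to be finite and invariant.  Finiteness is
obtained by adding the rows of the matrix one at a time (\<open>nn_integral_wdet_finite\<close>), invariance from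
uniqueness of translation-invariant measures (\<open>distr_lborel_linear_isometry\<close>).  Point evaluations are
continuous because holomorphic functions have the mean value property on balls
(\<open>point_evaluation\<close>), and this yields the orthogonal projection by minimising the distance
(\<open>ex_minimizer\<close>).\<close>

section \<open>Norm-preserving linear maps preserve Lebesgue measure\<close>

text \<open>Computing the double integral of \<open>1\<^sub>A(x) 1\<^sub>B(x + y)\<close> against \<open>M\<close> and \<open>lborel\<close> in both orders gives
\<open>M(A) lborel(B) = M(B) lborel(A)\<close>.  One set \<open>B\<close> of finite nonzero measure on which the measures
agree therefore fixes the normalisation.\<close>

lemma lborel_unique_translation_invariant:
  fixes M :: "'a::euclidean_space measure"
  assumes sets_M [measurable_cong]: "sets M = sets borel"
    and sf: "sigma_finite_measure M"
    and trans: "\<And>t. distr M borel ((+) t) = M"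
    and B [measurable]: "B \<in> sets borel"
    and eq: "emeasure M B = emeasure lborel B"
    and pos: "emeasure lborel B \<noteq> 0" and fin: "emeasure lborel B \<noteq> \<infinity>"
  shows "M = lborel"
proof (rule measure_eqI)
  show "sets M = sets lborel" using sets_M by simp
  interpret M: sigma_finite_measure M by (rule sf)
  interpret P: pair_sigma_finite M lborel
    by (simp add: pair_sigma_finite_def sf sigma_finite_lborel)
  fix A assume "A \<in> sets M"
  then have A [measurable]: "A \<in> sets borel" using sets_M by simp
  have shift_M: "(\<integral>\<^sup>+x. g (x + y) \<partial>M) = (\<integral>\<^sup>+x. g x \<partial>M)"
    if [measurable]: "g \<in> borel_measurable borel" for g y
  proof -
    have "(\<integral>\<^sup>+x. g x \<partial>M) = (\<integral>\<^sup>+x. g x \<partial>distr M borel ((+) y))" by (simp add: trans)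
    also have "\<dots> = (\<integral>\<^sup>+x. g (y + x) \<partial>M)" by (subst nn_integral_distr) auto
    finally show ?thesis by (simp add: add.commute)
  qed
  have shift_L: "(\<integral>\<^sup>+y. g (x + c *\<^sub>R y) \<partial>lborel) = (\<integral>\<^sup>+y. g y \<partial>lborel)"
    if [measurable]: "g \<in> borel_measurable borel" and "c = 1 \<or> c = -1" for g and x :: 'a and c
    using that by (subst (2) lborel_affine[of c x]) (auto simp: nn_integral_density nn_integral_distr)
  have "emeasure M A * emeasure lborel B = (\<integral>\<^sup>+x. indicator A x * emeasure lborel B \<partial>M)"
    by (simp add: nn_integral_multc)
  also have "\<dots> = (\<integral>\<^sup>+x. (\<integral>\<^sup>+y. indicator A x * indicator B (x + y) \<partial>lborel) \<partial>M)"
    using shift_L[of "indicator B" 1] by (simp add: nn_integral_cmult)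
  also have "\<dots> = (\<integral>\<^sup>+y. (\<integral>\<^sup>+x. indicator A x * indicator B (x + y) \<partial>M) \<partial>lborel)"
    by (rule P.Fubini'[symmetric]) measurable
  also have "\<dots> = (\<integral>\<^sup>+y. (\<integral>\<^sup>+x. indicator A (x - y) * indicator B x \<partial>M) \<partial>lborel)"
    using shift_M[of "\<lambda>x. indicator A (x - y) * indicator B x" y for y] by simp
  also have "\<dots> = (\<integral>\<^sup>+x. (\<integral>\<^sup>+y. indicator A (x - y) * indicator B x \<partial>lborel) \<partial>M)"
    by (rule P.Fubini') measurable
  also have "\<dots> = (\<integral>\<^sup>+x. emeasure lborel A * indicator B x \<partial>M)"
    using shift_L[of "indicator A" "-1"] by (simp add: nn_integral_multc)
  also have "\<dots> = emeasure lborel A * emeasure lborel B"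
    by (simp add: nn_integral_cmult eq)
  finally show "emeasure M A = emeasure lborel A"
    using pos fin by (metis ennreal_mult_cancel_left infinity_ennreal_def mult.commute top.not_eq_extremum)
qed

text \<open>The image measure is again translation invariant, and the preimage of a ball about the origin is
the same ball.  Multiplication by a unitary matrix, on either side, and by a complex number of
modulus one are of this kind.\<close>

lemma distr_lborel_linear_isometry:
  fixes f :: "'a::euclidean_space \<Rightarrow> 'a"
  assumes lin: "linear f" and nrm: "\<And>x. norm (f x) = norm x"
  shows "distr lborel borel f = lborel"
proof -
  have cont: "continuous_on UNIV f"
    using lin by (simp add: linear_continuous_on linear_conv_bounded_linear)
  have [measurable]: "f \<in> borel_measurable borel"
    using cont by (rule borel_measurable_continuous_onI)
  have inj: "inj f"
    using lin nrm by (metis linear_injective_0 norm_eq_zero)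
  then have surj: "surj f" using lin linear_injective_imp_surjective by blast
  let ?M = "distr lborel borel f"
  have ball: "f -` ball 0 r = ball (0::'a) r" for r
    by (auto simp: nrm)
  have em: "emeasure ?M (ball 0 r) = emeasure lborel (ball (0::'a) r)" for r
    by (simp add: emeasure_distr ball)
  show ?thesis
  proof (rule lborel_unique_translation_invariant[where B = "ball 0 1"])
    show "sigma_finite_measure ?M"
    proof
      show "\<exists>A. countable A \<and> A \<subseteq> sets ?M \<and> \<Union> A = space ?M \<and> (\<forall>a\<in>A. emeasure ?M a \<noteq> \<infinity>)"
      proof (intro exI[where x = "range (\<lambda>n::nat. ball 0 (real n))"] conjI ballI)
        show "\<Union> (range (\<lambda>n::nat. ball (0::'a) (real n))) = space ?M"
          using reals_Archimedean2 by (auto simp: dist_norm)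
        fix a assume "a \<in> range (\<lambda>n::nat. ball (0::'a) (real n))"
        then show "emeasure ?M a \<noteq> \<infinity>"
          using emeasure_lborel_ball_finite[of "0::'a"] by (auto simp: em less_top simp del: emeasure_distr)
      qed auto
    qed
    show "distr ?M borel ((+) t) = ?M" for t
    proof -
      obtain s where s: "t = f s" using surj by (meson surjD)
      have "distr ?M borel ((+) t) = distr lborel borel (\<lambda>x. f (s + x))"
        by (subst distr_distr) (auto simp: comp_def s linear_add[OF lin])
      also have "\<dots> = distr (distr lborel borel ((+) s)) borel f"
        by (subst distr_distr) (auto simp: comp_def)
      finally show ?thesis by (simp add: lborel_distr_plus)
    qed
    show "emeasure lborel (ball (0::'a) 1) \<noteq> 0"
      using content_ball_gt_0_iff[of "0::'a" 1] by (auto simp: measure_def simp del: content_ball_gt_0_iff)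
    show "emeasure lborel (ball (0::'a) 1) \<noteq> \<infinity>"
      using emeasure_lborel_ball_finite[of "0::'a" 1] by auto
  qed (auto simp: em)
qed

lemma
  fixes f :: "'a::euclidean_space \<Rightarrow> 'a"
  assumes lin: "linear f" and nrm: "\<And>x. norm (f x) = norm x"
  shows measurable_lebesgue_linear_isometry: "f \<in> lebesgue \<rightarrow>\<^sub>M lebesgue"
    and distr_lebesgue_linear_isometry: "distr lebesgue lebesgue f = lebesgue"
proof -
  have cont: "continuous_on UNIV f"
    using lin by (simp add: linear_continuous_on linear_conv_bounded_linear)
  have [measurable]: "f \<in> borel_measurable borel"
    using cont by (rule borel_measurable_continuous_onI)
  have m: "f \<in> lebesgue \<rightarrow>\<^sub>M lborel" by (simp add: measurable_completion)
  have "distr lebesgue lborel f = distr lborel lborel f"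
    by (rule distr_completion) simp
  also have "\<dots> = distr lborel borel f" by (rule distr_cong) auto
  also have "\<dots> = lborel" by (rule distr_lborel_linear_isometry[OF lin nrm])
  finally have eq: "distr lebesgue lborel f = lborel" .
  show "f \<in> lebesgue \<rightarrow>\<^sub>M lebesgue"
    using m by (intro completion.measurable_completion2) (simp_all add: eq)
  show "distr lebesgue lebesgue f = lebesgue"
    using completion.completion_distr_eq[OF m] by (simp add: eq)
qed

section \<open>Complex matrices and the operator norm\<close>

definition cscale :: "complex \<Rightarrow> 'n::finite cmat \<Rightarrow> 'n cmat" where
  "cscale c X = (\<chi> i j. c * X $ i $ j)"

definition hdot :: "complex^'n::finite \<Rightarrow> complex^'n \<Rightarrow> complex" where
  "hdot x y = (\<Sum>i\<in>UNIV. cnj (x $ i) * y $ i)"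

definition opn :: "'n::finite cmat \<Rightarrow> real" where
  "opn A = onorm ((*v) A)"

lemma norm_cvec_square: "(norm (x::complex^'n::finite))\<^sup>2 = (\<Sum>i\<in>UNIV. (cmod (x $ i))\<^sup>2)"
  by (simp add: norm_vec_def L2_set_def sum_nonneg)

lemma norm_cmat_square:
  "(norm (A::'n::finite cmat))\<^sup>2 = (\<Sum>i\<in>UNIV. \<Sum>j\<in>UNIV. (cmod (A $ i $ j))\<^sup>2)"
  by (simp add: norm_vec_def L2_set_def sum_nonneg)

lemma hdot_self: "hdot x x = of_real ((norm x)\<^sup>2)"
  unfolding hdot_def norm_cvec_square of_real_sum
  by (intro sum.cong refl) (metis complex_norm_square mult.commute)

lemma hdot_diff_right: "hdot x (y - z) = hdot x y - hdot x z"
  by (simp add: hdot_def algebra_simps sum_subtractf)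

lemma hdot_ctranspose: "hdot x (ctranspose A *v y) = hdot (A *v x) y"
proof -
  have "hdot x (ctranspose A *v y) = (\<Sum>i\<in>UNIV. \<Sum>j\<in>UNIV. cnj (x $ i) * (cnj (A $ j $ i) * y $ j))"
    by (simp add: hdot_def ctranspose_def matrix_vector_mult_def sum_distrib_left)
  also have "\<dots> = (\<Sum>j\<in>UNIV. \<Sum>i\<in>UNIV. cnj (x $ i) * (cnj (A $ j $ i) * y $ j))"
    by (rule sum.swap)
  also have "\<dots> = hdot (A *v x) y"
    by (simp add: hdot_def matrix_vector_mult_def sum_distrib_right sum_distrib_left algebra_simps)
  finally show ?thesis .
qed

lemma cmod_sum_mult_le: "cmod (\<Sum>i\<in>UNIV. a $ i * b $ i) \<le> norm (a::complex^'n::finite) * norm b"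
proof -
  have "cmod (\<Sum>i\<in>UNIV. a $ i * b $ i) \<le> (\<Sum>i\<in>UNIV. \<bar>cmod (a $ i)\<bar> * \<bar>cmod (b $ i)\<bar>)"
    by (rule order_trans[OF norm_sum]) (simp add: norm_mult)
  also have "\<dots> \<le> norm a * norm b"
    unfolding norm_vec_def by (rule L2_set_mult_ineq)
  finally show ?thesis .
qed

lemma cmod_hdot_le: "cmod (hdot x y) \<le> norm x * norm y"
proof -
  have "norm (\<chi> i. cnj (x $ i)) = norm x" by (simp add: norm_vec_def)
  then show ?thesis using cmod_sum_mult_le[of "\<chi> i. cnj (x $ i)" y] by (simp add: hdot_def)
qed

lemma ctranspose_ctranspose [simp]: "ctranspose (ctranspose A) = A"
  by (simp add: ctranspose_def vec_eq_iff)

lemma ctranspose_mult: "ctranspose (A ** B) = ctranspose B ** ctranspose A"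
  by (simp add: ctranspose_def matrix_matrix_mult_def vec_eq_iff mult.commute)

lemma ctranspose_mat1 [simp]: "ctranspose (mat 1) = mat 1"
  by (auto simp: ctranspose_def mat_def vec_eq_iff)

lemma ctranspose_diff: "ctranspose (A - B) = ctranspose A - ctranspose B"
  by (simp add: ctranspose_def vec_eq_iff)

lemma ctranspose_add: "ctranspose (A + B) = ctranspose A + ctranspose B"
  by (simp add: ctranspose_def vec_eq_iff)

lemma ctranspose_cscale: "ctranspose (cscale c A) = cscale (cnj c) (ctranspose A)"
  by (simp add: ctranspose_def cscale_def vec_eq_iff)

lemma norm_ctranspose [simp]: "norm (ctranspose A) = norm A"
proof -
  have "(norm (ctranspose A))\<^sup>2 = (norm A)\<^sup>2"
    unfolding norm_cmat_square ctranspose_def by simp (rule sum.swap)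
  then show ?thesis by simp
qed

lemma cscale_nth [simp]: "cscale c X $ i $ j = c * X $ i $ j"
  by (simp add: cscale_def)

lemma cscale_mult_left: "cscale c X ** Y = cscale c (X ** Y)"
  by (simp add: vec_eq_iff matrix_matrix_mult_def sum_distrib_left mult.assoc)

lemma cscale_mult_right: "X ** cscale c Y = cscale c (X ** Y)"
  by (simp add: vec_eq_iff matrix_matrix_mult_def sum_distrib_left algebra_simps)

lemma cscale_cscale [simp]: "cscale a (cscale b X) = cscale (a * b) X"
  by (simp add: vec_eq_iff)

lemma cscale_1 [simp]: "cscale 1 X = X" and cscale_0 [simp]: "cscale 0 X = 0"
  by (simp_all add: vec_eq_iff)

lemma cscale_of_real: "cscale (of_real r) X = r *\<^sub>R X"
  by (simp add: vec_eq_iff scaleR_conv_of_real[where 'a = complex])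

lemma norm_cscale: "norm (cscale c X) = cmod c * norm X"
proof -
  have "(norm (cscale c X))\<^sup>2 = (cmod c * norm X)\<^sup>2"
    by (simp add: norm_cmat_square power_mult_distrib norm_mult sum_distrib_left)
  then show ?thesis by (simp add: power2_eq_iff_nonneg)
qed

lemma linear_cscale: "linear (cscale c)"
  by (rule linearI) (simp_all add: vec_eq_iff algebra_simps scaleR_conv_of_real)

lemma cscale_vec: "cscale c X *v x = X *v (\<chi> i. c * x $ i)"
  by (simp add: vec_eq_iff matrix_vector_mult_def algebra_simps)

lemma norm_cvec_scale: "norm (\<chi> i. c * x $ i) = cmod c * norm (x::complex^'n::finite)"
proof -
  have "(norm (\<chi> i. c * x $ i))\<^sup>2 = (cmod c * norm x)\<^sup>2"
    by (simp add: norm_cvec_square power_mult_distrib norm_mult sum_distrib_left)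
  then show ?thesis by (simp add: power2_eq_iff_nonneg)
qed

lemma opn_ge: "norm (A *v x) \<le> opn A * norm x"
  unfolding opn_def by (rule onorm) simp

lemma opn_le: "(\<And>x. norm (A *v x) \<le> b * norm x) \<Longrightarrow> opn A \<le> b"
  unfolding opn_def by (rule onorm_le)

lemma opn_nonneg: "0 \<le> opn A"
  unfolding opn_def by (rule onorm_pos_le) simp

lemma opn_mult_le: "opn (A ** B) \<le> opn A * opn B"
proof (rule opn_le)
  fix x
  have "norm ((A ** B) *v x) \<le> opn A * norm (B *v x)"
    using opn_ge[of A "B *v x"] by (simp add: matrix_vector_mul_assoc)
  also have "\<dots> \<le> opn A * (opn B * norm x)"
    by (intro mult_left_mono opn_ge opn_nonneg)
  finally show "norm ((A ** B) *v x) \<le> opn A * opn B * norm x" by (simp add: mult.assoc)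
qed

lemma opn_add_le: "opn (A + B) \<le> opn A + opn B"
proof (rule opn_le)
  fix x
  have "norm ((A + B) *v x) \<le> norm (A *v x) + norm (B *v x)"
    by (simp add: matrix_vector_mult_add_rdistrib norm_triangle_ineq)
  then show "norm ((A + B) *v x) \<le> (opn A + opn B) * norm x"
    using opn_ge[of A x] opn_ge[of B x] by (simp add: algebra_simps)
qed

lemma opn_cscale_le: "opn (cscale c A) \<le> cmod c * opn A"
proof (rule opn_le)
  show "norm (cscale c A *v x) \<le> cmod c * opn A * norm x" for x
    using opn_ge[of A "\<chi> i. c * x $ i"] by (simp add: cscale_vec norm_cvec_scale algebra_simps)
qed

lemma opn_scaleR_le: "opn (r *\<^sub>R A) \<le> \<bar>r\<bar> * opn A"
  using opn_cscale_le[of "of_real r" A] by (simp add: cscale_of_real)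

lemma opn_le_norm: "opn A \<le> norm A"
proof (rule opn_le)
  fix x :: "complex^'a"
  have "(norm (A *v x))\<^sup>2 = (\<Sum>i\<in>UNIV. (cmod (\<Sum>j\<in>UNIV. A $ i $ j * x $ j))\<^sup>2)"
    by (simp add: norm_cvec_square matrix_vector_mult_def)
  also have "\<dots> \<le> (\<Sum>i\<in>UNIV. (norm (A $ i) * norm x)\<^sup>2)"
    by (intro sum_mono power_mono cmod_sum_mult_le) auto
  also have "\<dots> = (norm A * norm x)\<^sup>2"
    by (simp add: power_mult_distrib sum_distrib_right norm_vec_def[of A] L2_set_def sum_nonneg)
  finally show "norm (A *v x) \<le> norm A * norm x"
    by (rule power2_le_imp_le) simp
qed

lemma opn_ctranspose_le: "opn (ctranspose A) \<le> opn A"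
proof (rule opn_le)
  fix x
  let ?y = "ctranspose A *v x"
  have "(norm ?y)\<^sup>2 = cmod (hdot ?y ?y)" by (simp add: hdot_self norm_power)
  also have "hdot ?y ?y = hdot (A *v ?y) x" by (rule hdot_ctranspose)
  also have "cmod \<dots> \<le> norm (A *v ?y) * norm x" by (rule cmod_hdot_le)
  also have "\<dots> \<le> opn A * norm ?y * norm x" by (intro mult_right_mono opn_ge) auto
  finally have *: "norm ?y * norm ?y \<le> (opn A * norm x) * norm ?y"
    by (simp add: power2_eq_square mult_ac)
  show "norm ?y \<le> opn A * norm x"
  proof (cases "norm ?y = 0")
    case True then show ?thesis using opn_nonneg[of A] by (simp only: True) simp
  next
    case False
    then have "0 < norm ?y" by simp
    with * show ?thesis by (simp only: mult_le_cancel_right_pos)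
  qed
qed

text \<open>Read off the columns in this way, the norm is seen to be preserved by unitary matrices acting from the left.\<close>

lemma norm_columns: "(norm (A::'n::finite cmat))\<^sup>2 = (\<Sum>j\<in>UNIV. (norm (A *v axis j 1))\<^sup>2)"
proof -
  have "(norm (ctranspose A))\<^sup>2 = (\<Sum>j\<in>UNIV. (norm (A *v axis j 1))\<^sup>2)"
    unfolding norm_cmat_square norm_cvec_square
    by (intro sum.cong refl) (simp add: ctranspose_def matrix_vector_mult_def axis_def if_distrib cong: if_cong)
  then show ?thesis by simp
qed

lemma norm_cmat_le_opn: "norm A \<le> real CARD('n) * opn (A::'n::finite cmat)"
proof -
  have "(norm A)\<^sup>2 = (\<Sum>i\<in>UNIV. (norm (A *v axis i 1))\<^sup>2)" by (rule norm_columns)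
  also have "\<dots> \<le> (\<Sum>i\<in>(UNIV::'n set). (opn A)\<^sup>2)"
  proof (intro sum_mono power_mono)
    show "norm (A *v axis i 1) \<le> opn A" for i
      using opn_ge[of A "axis i 1"] by (simp add: norm_axis_1)
  qed auto
  also have "\<dots> \<le> (real CARD('n) * opn A)\<^sup>2"
    by (simp add: power_mult_distrib mult_right_mono self_le_power Suc_leI)
  finally show ?thesis
    using opn_nonneg[of A] by (simp add: power2_le_iff_abs_le)
qed

lemma continuous_on_opn: "continuous_on S (opn :: 'a::finite cmat \<Rightarrow> real)"
proof -
  have le: "opn A - opn B \<le> norm (A - B)" for A B :: "'a cmat"
    using opn_add_le[of "A - B" B] opn_le_norm[of "A - B"] by simp
  have "1-lipschitz_on S (opn :: 'a cmat \<Rightarrow> real)"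
  proof (rule lipschitz_onI)
    show "dist (opn x) (opn y) \<le> 1 * dist x y" for x y :: "'a cmat"
      using le[of x y] le[of y x] by (auto simp: dist_norm abs_le_iff norm_minus_commute)
  qed simp
  then show ?thesis by (rule lipschitz_on_continuous_on)
qed

section \<open>The domain is the open unit ball of the operator norm\<close>

lemma cartan_domain_iff_norm: "Z \<in> cartan_domain \<longleftrightarrow> (\<forall>x. x \<noteq> 0 \<longrightarrow> norm (Z *v x) < norm x)"
proof -
  have "Re (\<Sum>i\<in>UNIV. cnj (x $ i) * ((mat 1 - ctranspose Z ** Z) *v x) $ i) = (norm x)\<^sup>2 - (norm (Z *v x))\<^sup>2" for x
    unfolding hdot_def[symmetric] matrix_vector_mult_diff_rdistrib hdot_diff_right
      matrix_vector_mul_assoc[symmetric] hdot_ctranspose by (simp add: hdot_self)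
  moreover have "ctranspose (mat 1 - ctranspose Z ** Z) = mat 1 - ctranspose Z ** Z"
    by (simp add: ctranspose_diff ctranspose_mult)
  moreover have "0 < (norm x)\<^sup>2 - (norm (Z *v x))\<^sup>2 \<longleftrightarrow> norm (Z *v x) < norm x" for x
    by (smt (verit) norm_ge_zero power2_le_imp_le power2_less_imp_less)
  ultimately show ?thesis
    unfolding cartan_domain_def pos_def_def by simp
qed

text \<open>A map that strictly shortens every nonzero vector has operator norm below 1 because the unit
sphere is compact.\<close>

lemma cartan_domain_iff: "Z \<in> cartan_domain \<longleftrightarrow> opn Z < 1"
proof
  assume *: "opn Z < 1"
  have "norm (Z *v x) < norm x" if "x \<noteq> 0" for x
  proof -
    have "opn Z * norm x < 1 * norm x" using * that by (intro mult_strict_right_mono) auto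
    then show ?thesis using opn_ge[of Z x] by linarith
  qed
  then show "Z \<in> cartan_domain" by (simp add: cartan_domain_iff_norm)
next
  assume Z: "Z \<in> cartan_domain"
  let ?S = "sphere (0::complex^'a) 1"
  have "axis undefined 1 \<in> ?S" by (simp add: norm_axis_1)
  then have "?S \<noteq> {}" by blast
  then obtain x0 where x0: "x0 \<in> ?S" and max: "\<And>x. x \<in> ?S \<Longrightarrow> norm (Z *v x) \<le> norm (Z *v x0)"
    using continuous_attains_sup[of ?S "\<lambda>x. norm (Z *v x)"]
    by (metis compact_sphere continuous_on_norm linear_continuous_on matrix_vector_mul_bounded_linear)
  have "norm (Z *v x) \<le> norm (Z *v x0) * norm x" for x
  proof (cases "x = 0")
    case False
    have "norm (Z *v ((1 / norm x) *\<^sub>R x)) \<le> norm (Z *v x0)"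
      using False by (intro max) simp
    also have "Z *v ((1 / norm x) *\<^sub>R x) = (1 / norm x) *\<^sub>R (Z *v x)"
      by (rule linear_scale) simp
    finally show ?thesis using False by (simp add: divide_simps)
  qed simp
  then have "opn Z \<le> norm (Z *v x0)" by (rule opn_le)
  also have "\<dots> < norm x0" 
  proof -
    have "x0 \<noteq> 0" using x0 by auto
    then show ?thesis using Z unfolding cartan_domain_iff_norm by blast
  qed
  finally show "opn Z < 1" using x0 by simp
qed

lemma open_cartan_domain: "open (cartan_domain :: 'n::finite cmat set)"
proof -
  have "cartan_domain = {Z::'n cmat. opn Z < 1}" by (auto simp: cartan_domain_iff)
  moreover have "open {Z::'n cmat. opn Z < 1}"
    by (intro open_Collect_less continuous_on_opn continuous_on_const)
  ultimately show ?thesis by (simp only:)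
qed

lemma convex_cartan_domain: "convex (cartan_domain :: 'n::finite cmat set)"
proof (rule convexI)
  fix X Y :: "'n cmat" and u v :: real
  assume XY: "X \<in> cartan_domain" "Y \<in> cartan_domain" and uv: "0 \<le> u" "0 \<le> v" "u + v = 1"
  have "opn (u *\<^sub>R X + v *\<^sub>R Y) \<le> u * opn X + v * opn Y"
    using opn_add_le[of "u *\<^sub>R X" "v *\<^sub>R Y"] opn_scaleR_le[of u X] opn_scaleR_le[of v Y] uv by simp
  also have "\<dots> < 1" using XY uv by (simp add: cartan_domain_iff convex_bound_lt)
  finally show "u *\<^sub>R X + v *\<^sub>R Y \<in> cartan_domain" by (simp add: cartan_domain_iff)
qed

lemma zero_in_cartan_domain [simp]: "0 \<in> cartan_domain"
  by (simp add: cartan_domain_iff_norm)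

lemma compact_opn_le: "compact {Z::'n::finite cmat. opn Z \<le> q}"
proof -
  have "closed {Z::'n cmat. opn Z \<le> q}"
    by (intro closed_Collect_le continuous_on_opn continuous_on_const)
  moreover have "bounded {Z::'n cmat. opn Z \<le> q}"
  proof (rule boundedI)
    fix Z :: "'n cmat" assume "Z \<in> {Z. opn Z \<le> q}"
    then show "norm Z \<le> real CARD('n) * q"
      by (intro order_trans[OF norm_cmat_le_opn] mult_left_mono) auto
  qed
  ultimately show ?thesis by (simp add: compact_eq_bounded_closed)
qed

lemma bounded_cartan_domain: "bounded (cartan_domain :: 'n::finite cmat set)"
  by (rule bounded_subset[OF compact_imp_bounded[OF compact_opn_le[of 1]]]) (auto simp: cartan_domain_iff)

lemma cartan_domain_mult_left: "opn X \<le> 1 \<Longrightarrow> Z \<in> cartan_domain \<Longrightarrow> X ** Z \<in> cartan_domain"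
  using opn_mult_le[of X Z] mult_right_mono[of "opn X" 1 "opn Z"] opn_nonneg[of Z]
  by (simp add: cartan_domain_iff)

lemma cartan_domain_mult_right: "opn X \<le> 1 \<Longrightarrow> Z \<in> cartan_domain \<Longrightarrow> Z ** X \<in> cartan_domain"
  using opn_mult_le[of Z X] mult_left_mono[of "opn X" 1 "opn Z"] opn_nonneg[of Z]
  by (simp add: cartan_domain_iff)

lemma cartan_domain_cscale: "cmod c \<le> 1 \<Longrightarrow> Z \<in> cartan_domain \<Longrightarrow> cscale c Z \<in> cartan_domain"
  using opn_cscale_le[of c Z] mult_right_mono[of "cmod c" 1 "opn Z"] opn_nonneg[of Z]
  by (simp add: cartan_domain_iff)

lemma cartan_domain_ctranspose: "Z \<in> cartan_domain \<Longrightarrow> ctranspose Z \<in> cartan_domain"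
  using opn_ctranspose_le[of Z] by (simp add: cartan_domain_iff)

lemma unitary_norm_vec:
  assumes "U \<in> unitary_group" shows "norm (U *v x) = norm x"
proof -
  have "hdot (U *v x) (U *v x) = hdot x (ctranspose U *v (U *v x))" by (simp add: hdot_ctranspose)
  also have "\<dots> = hdot x x" using assms by (simp add: matrix_vector_mul_assoc unitary_group_def)
  finally have "(norm (U *v x))\<^sup>2 = (norm x)\<^sup>2" unfolding hdot_self of_real_eq_iff .
  then show ?thesis by simp
qed

lemma unitary_opn_le: "U \<in> unitary_group \<Longrightarrow> opn U \<le> 1"
  by (rule opn_le) (simp add: unitary_norm_vec)

lemma unitary_ctranspose: "U \<in> unitary_group \<Longrightarrow> ctranspose U \<in> unitary_group"
  by (simp add: unitary_group_def)

lemma norm_unitary_mult: "U \<in> unitary_group \<Longrightarrow> norm (U ** Z) = norm (Z::'n::finite cmat)"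
proof -
  assume U: "U \<in> unitary_group"
  have "(norm (U ** Z))\<^sup>2 = (norm Z)\<^sup>2"
    unfolding norm_columns
    by (simp add: unitary_norm_vec[OF U] flip: matrix_vector_mul_assoc)
  then show ?thesis by simp
qed

lemma norm_mult_unitary: "U \<in> unitary_group \<Longrightarrow> norm (Z ** U) = norm (Z::'n::finite cmat)"
  using norm_unitary_mult[OF unitary_ctranspose, of U "ctranspose Z"]
  by (metis ctranspose_mult norm_ctranspose)

section \<open>Integrability of the weight\<close>

definition wdet :: "'n::finite cmat \<Rightarrow> real" where
  "wdet Z = Re (det (mat 1 - Z ** ctranspose Z))"

definition rowscale :: "'n::finite \<Rightarrow> real \<Rightarrow> 'n cmat \<Rightarrow> 'n cmat" where
  "rowscale i r Z = (\<chi> k l. (if k = i then of_real r else 1) * Z $ k $ l)"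

definition keep_rows :: "'n::finite set \<Rightarrow> 'n cmat \<Rightarrow> 'n cmat" where
  "keep_rows S Z = (\<chi> k l. (if k \<in> S then 1 else 0) * Z $ k $ l)"

lemma bergman_weight_eq: "bergman_weight lam (Z::'n::finite cmat) = wdet Z powr (lam - 2 * real CARD('n))"
  by (simp add: bergman_weight_def wdet_def)

lemma det_ctranspose: "det (ctranspose A) = cnj (det A)"
proof -
  have "det (ctranspose A) = det (transpose (ctranspose A))" by (rule det_transpose[symmetric])
  also have "\<dots> = cnj (det A)"
    by (simp add: det_def transpose_def ctranspose_def)
  finally show ?thesis .
qed

lemma continuous_on_det:
  fixes f :: "'a::topological_space \<Rightarrow> 'n::finite cmat"
  assumes "\<And>i j. continuous_on S (\<lambda>x. f x $ i $ j)"
  shows "continuous_on S (\<lambda>x. det (f x))"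
  unfolding det_def by (intro continuous_intros assms)

lemma continuous_on_wdet: "continuous_on S (wdet :: 'n::finite cmat \<Rightarrow> real)"
proof -
  have "continuous_on S (\<lambda>Z::'n cmat. det (mat 1 - Z ** ctranspose Z))"
    by (intro continuous_on_det) (auto simp: matrix_matrix_mult_def ctranspose_def intro!: continuous_intros)
  then show ?thesis unfolding wdet_def[abs_def] by (intro continuous_intros)
qed

lemma wdet_0 [simp]: "wdet 0 = 1"
  by (simp add: wdet_def)

text \<open>The determinant is real, since its matrix is Hermitian, and does not vanish on the domain, since
\<open>I - Z Z\<^sup>*\<close> is injective for a strict contraction \<open>Z\<close>.  Along the segment from 0 to \<open>Z\<close> it starts
at 1 and cannot change sign.\<close>

lemma wdet_pos:
  assumes Z: "Z \<in> cartan_domain" shows "0 < wdet Z"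
proof -
  have ne: "wdet Z \<noteq> 0" if Z: "Z \<in> cartan_domain" for Z :: "'a cmat"
  proof
    assume 0: "wdet Z = 0"
    let ?A = "mat 1 - Z ** ctranspose Z"
    have "ctranspose ?A = ?A" by (simp add: ctranspose_diff ctranspose_mult)
    then have "cnj (det ?A) = det ?A" by (metis det_ctranspose)
    then have "det ?A = of_real (Re (det ?A))" by (metis Reals_cnj_iff of_real_Re)
    with 0 have "det ?A = 0" by (simp add: wdet_def)
    then have "\<not> invertible ?A" by (simp add: invertible_det_nz)
    then obtain x where x: "x \<noteq> 0" "?A *v x = 0"
      using matrix_left_invertible_ker[of ?A] invertible_left_inverse[of ?A] by auto
    then have eq: "x = Z *v (ctranspose Z *v x)"
      by (simp add: matrix_vector_mult_diff_rdistrib matrix_vector_mul_assoc)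
    with x(1) have "ctranspose Z *v x \<noteq> 0" by force
    with Z have "norm (Z *v (ctranspose Z *v x)) < norm (ctranspose Z *v x)"
      by (simp only: cartan_domain_iff_norm) blast
    also have "\<dots> < norm x"
      using cartan_domain_ctranspose[OF Z] x(1) unfolding cartan_domain_iff_norm by blast
    finally show False using eq by simp
  qed
  have cont: "continuous_on {0..1} (\<lambda>t. wdet (t *\<^sub>R Z))"
    by (intro continuous_on_compose2[OF continuous_on_wdet[of UNIV]] continuous_intros) auto
  have inD: "t *\<^sub>R Z \<in> cartan_domain" if "t \<in> {0..1}" for t
    using cartan_domain_cscale[of "of_real t" Z] Z that by (simp add: cscale_of_real)
  show ?thesis
  proof (rule ccontr)
    assume "\<not> ?thesis"
    then have "\<exists>t\<ge>0. t \<le> 1 \<and> wdet (t *\<^sub>R Z) = 0"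
      using IVT2'[OF _ _ _ cont, of 0] by simp
    with ne inD show False by auto
  qed
qed

text \<open>Scaling row \<open>i\<close> of \<open>Z\<close> by \<open>r\<close> scales row \<open>i\<close> and column \<open>i\<close> of \<open>Z Z\<^sup>*\<close> by \<open>r\<close>.  In the Leibniz formula
a permutation that fixes \<open>i\<close> contributes a single factor affine in \<open>r\<^sup>2\<close>, and any other permutation
meets the row and the column in one entry each, hence contributes \<open>r\<^sup>2\<close> times a constant.  The
determinant is thus affine in \<open>r\<^sup>2\<close> and is interpolated from \<open>r = 0\<close> and \<open>r = 1\<close>.\<close>

lemma wdet_rowscale: "wdet (rowscale i r Z) = (1 - r\<^sup>2) * wdet (rowscale i 0 Z) + r\<^sup>2 * wdet Z"
proof -
  define G where "G = Z ** ctranspose Z"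
  define e where "e r k = (if k = i then complex_of_real r else 1)" for r k
  define M where "M r k l = (if k = l then 1 else 0) - e r k * e r l * G $ k $ l" for r k l
  have ent: "(mat 1 - rowscale i r Z ** ctranspose (rowscale i r Z)) $ k $ l = M r k l" for r k l
    by (auto simp: M_def e_def G_def rowscale_def mat_def matrix_matrix_mult_def ctranspose_def
        sum_distrib_left algebra_simps)
  have det_eq: "det (mat 1 - rowscale i r Z ** ctranspose (rowscale i r Z)) =
      (\<Sum>p\<in>{p. p permutes UNIV}. of_int (sign p) * (\<Prod>k\<in>UNIV. M r k (p k)))" for r
    unfolding det_def ent ..
  have termwise: "(\<Prod>k\<in>UNIV. M r k (p k)) =
      (1 - (of_real r)\<^sup>2) * (\<Prod>k\<in>UNIV. M 0 k (p k)) + (of_real r)\<^sup>2 * (\<Prod>k\<in>UNIV. M 1 k (p k))"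
    if p: "p permutes UNIV" for p
  proof (cases "p i = i")
    case True
    then have pk: "p k \<noteq> i" if "k \<noteq> i" for k using p that by (metis permutes_inj injD)
    have split: "(\<Prod>k\<in>UNIV. M r k (p k)) = (1 - (of_real r)\<^sup>2 * G $ i $ i) * (\<Prod>k\<in>UNIV-{i}. M 1 k (p k))" for r
    proof -
      have "(\<Prod>k\<in>UNIV-{i}. M r k (p k)) = (\<Prod>k\<in>UNIV-{i}. M 1 k (p k))"
        by (intro prod.cong refl) (auto simp: M_def e_def pk)
      then show ?thesis
        using prod.remove[of UNIV i "\<lambda>k. M r k (p k)"] by (simp add: True M_def e_def power2_eq_square)
    qed
    show ?thesis unfolding split[of r] split[of 0] split[of 1] by (simp add: algebra_simps)
  next
    case False
    define j where "j = inv p i"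
    have pj: "p j = i" unfolding j_def using p by (metis permutes_inverses(1))
    have ji: "j \<noteq> i" using False pj by auto
    have pk: "p k \<noteq> i" if "k \<noteq> j" for k using p that pj by (metis permutes_inj injD)
    have split: "(\<Prod>k\<in>UNIV. M r k (p k)) =
        (of_real r)\<^sup>2 * (G $ i $ (p i) * G $ j $ i * (\<Prod>k\<in>UNIV-{i}-{j}. M 1 k (p k)))" for r
    proof -
      have "(\<Prod>k\<in>UNIV-{i}-{j}. M r k (p k)) = (\<Prod>k\<in>UNIV-{i}-{j}. M 1 k (p k))"
        by (intro prod.cong refl) (auto simp: M_def e_def pk)
      moreover have "(\<Prod>k\<in>UNIV. M r k (p k)) = M r i (p i) * (M r j i * (\<Prod>k\<in>UNIV-{i}-{j}. M r k (p k)))"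
        using prod.remove[of UNIV i "\<lambda>k. M r k (p k)"] prod.remove[of "UNIV-{i}" j "\<lambda>k. M r k (p k)"] ji
        by (simp add: pj)
      moreover have "M r i (p i) = - of_real r * G $ i $ p i" "M r j i = - of_real r * G $ j $ i"
        using False ji by (auto simp: M_def e_def)
      ultimately show ?thesis by (simp add: power2_eq_square)
    qed
    show ?thesis unfolding split[of r] split[of 0] split[of 1] by simp
  qed
  have 1: "rowscale i 1 Z = Z" by (simp add: rowscale_def vec_eq_iff)
  have "det (mat 1 - rowscale i r Z ** ctranspose (rowscale i r Z)) =
      (1 - (of_real r)\<^sup>2) * det (mat 1 - rowscale i 0 Z ** ctranspose (rowscale i 0 Z)) +
      (of_real r)\<^sup>2 * det (mat 1 - rowscale i 1 Z ** ctranspose (rowscale i 1 Z))"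
    unfolding det_eq sum_distrib_left sum.distrib[symmetric]
  proof (intro sum.cong refl)
    fix p assume "p \<in> {p. p permutes (UNIV::'a set)}"
    then have "p permutes UNIV" by simp
    from termwise[OF this]
    show "of_int (sign p) * (\<Prod>k\<in>UNIV. M r k (p k)) =
        (1 - (of_real r)\<^sup>2) * (of_int (sign p) * (\<Prod>k\<in>UNIV. M 0 k (p k))) +
        (of_real r)\<^sup>2 * (of_int (sign p) * (\<Prod>k\<in>UNIV. M 1 k (p k)))"
      by (simp only: distrib_left mult.left_commute)
  qed
  then have "wdet (rowscale i r Z) = Re (of_real (1 - r\<^sup>2) * det (mat 1 - rowscale i 0 Z ** ctranspose (rowscale i 0 Z)) +
      of_real (r\<^sup>2) * det (mat 1 - Z ** ctranspose Z))"
    unfolding wdet_def 1 by (simp only: of_real_power of_real_diff of_real_1)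
  then show ?thesis
    unfolding wdet_def by (simp only: plus_complex.simps Re_complex_of_real times_complex.simps Im_complex_of_real mult_zero_left diff_zero)
qed

lemma opn_diag_le:
  assumes "\<And>k. cmod (d k) \<le> 1"
  shows "opn (\<chi> k l. d k * Z $ k $ l) \<le> opn (Z :: 'n::finite cmat)"
proof (rule opn_le)
  fix x :: "complex^'n"
  have "(norm ((\<chi> k l. d k * Z $ k $ l) *v x))\<^sup>2 = (\<Sum>k\<in>UNIV. (cmod (d k) * cmod ((Z *v x) $ k))\<^sup>2)"
    by (simp add: norm_cvec_square matrix_vector_mult_def norm_mult[symmetric] sum_distrib_left mult.assoc)
  also have "\<dots> \<le> (\<Sum>k\<in>UNIV. (cmod ((Z *v x) $ k))\<^sup>2)"
    using assms by (intro sum_mono power_mono mult_left_le_one_le) auto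
  also have "\<dots> = (norm (Z *v x))\<^sup>2" by (simp add: norm_cvec_square)
  finally have "norm ((\<chi> k l. d k * Z $ k $ l) *v x) \<le> norm (Z *v x)"
    by (rule power2_le_imp_le) simp
  also have "\<dots> \<le> opn Z * norm x" by (rule opn_ge)
  finally show "norm ((\<chi> k l. d k * Z $ k $ l) *v x) \<le> opn Z * norm x" .
qed

lemma rowscale_in_domain: "\<bar>r\<bar> \<le> 1 \<Longrightarrow> Z \<in> cartan_domain \<Longrightarrow> rowscale i r Z \<in> cartan_domain"
  unfolding cartan_domain_iff rowscale_def
  by (rule le_less_trans[OF opn_diag_le]) auto

lemma keep_rows_in_domain: "Z \<in> cartan_domain \<Longrightarrow> keep_rows S Z \<in> cartan_domain"
  unfolding cartan_domain_iff keep_rows_def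
  by (rule le_less_trans[OF opn_diag_le]) auto

text \<open>If row \<open>i\<close> can be enlarged by the factor \<open>1/r\<close> within the domain, the function affine in the square
of the scaling factor is positive at \<open>1/r\<close>; this bounds its value at 1 from below.\<close>

lemma wdet_ge_shell:
  assumes Z: "Z \<in> cartan_domain" and r: "0 < r" and rZ: "rowscale i (1/r) Z \<in> cartan_domain" and i: "i \<notin> S"
  shows "wdet (keep_rows S Z) * (1 - r\<^sup>2) \<le> wdet (keep_rows (insert i S) Z)"
proof -
  let ?Y = "keep_rows (insert i S) Z"
  have eq: "rowscale i 0 ?Y = keep_rows S Z" "rowscale i (1/r) ?Y = keep_rows (insert i S) (rowscale i (1/r) Z)"
    using i by (auto simp: rowscale_def keep_rows_def vec_eq_iff)
  have "0 < wdet (rowscale i (1/r) ?Y)"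
    unfolding eq using rZ by (intro wdet_pos keep_rows_in_domain)
  also have "\<dots> = (1 - (1/r)\<^sup>2) * wdet (keep_rows S Z) + (1/r)\<^sup>2 * wdet ?Y"
    by (subst wdet_rowscale) (simp add: eq)
  finally have "0 < r\<^sup>2 * ((1 - (1/r)\<^sup>2) * wdet (keep_rows S Z) + (1/r)\<^sup>2 * wdet ?Y)"
    using r by simp
  also have "\<dots> = (r\<^sup>2 - 1) * wdet (keep_rows S Z) + wdet ?Y"
    using r by (simp add: field_simps)
  finally show ?thesis by (simp add: algebra_simps)
qed

text \<open>The exponent \<open>d\<close> is the number of elements of the standard basis that are supported in row \<open>i\<close>.\<close>

lemma rowscale_jacobian:
  obtains d :: nat where
    "\<And>r (g :: 'n::finite cmat \<Rightarrow> ennreal). 0 < r \<Longrightarrow> g \<in> borel_measurable borel \<Longrightarrow>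
      (\<integral>\<^sup>+Z. g Z \<partial>lborel) = ennreal (r ^ d) * (\<integral>\<^sup>+Z. g (rowscale i r Z) \<partial>lborel)"
proof
  let ?B = "{b \<in> Basis :: 'n cmat set. b $ i \<noteq> 0}"
  fix r :: real and g :: "'n cmat \<Rightarrow> ennreal"
  assume r: "0 < r" and [measurable]: "g \<in> borel_measurable borel"
  define c where "c b = (if b $ i \<noteq> 0 then r else 1)" for b :: "'n cmat"
  have T: "rowscale i r Z = 0 + (\<Sum>b\<in>Basis. (c b * (Z \<bullet> b)) *\<^sub>R b)" for Z
  proof (rule euclidean_eqI)
    fix b :: "'n cmat" assume b: "b \<in> Basis"
    then obtain k l u where bb: "b = axis k (axis l u)" "u \<in> Basis"
      by (auto simp: Basis_vec_def)
    have u0: "u \<noteq> 0" by (rule nonzero_Basis[OF bb(2)])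
    have "b $ i \<noteq> 0 \<longleftrightarrow> k = i"
    proof -
      have "b $ i = (if i = k then axis l u else 0)" unfolding bb(1) by (simp add: axis_def[of k])
      moreover have "axis l u \<noteq> 0" using u0 by (simp add: axis_eq_0_iff)
      ultimately show ?thesis by auto
    qed
    then have cb: "c b = (if k = i then r else 1)" by (simp add: c_def)
    have "rowscale i r Z \<bullet> b = c b * (Z \<bullet> b)"
    proof -
      have "rowscale i r Z $ k $ l = (if k = i then r else 1) *\<^sub>R (Z $ k $ l)"
        by (simp add: rowscale_def scaleR_conv_of_real)
      then show ?thesis unfolding cb unfolding bb(1) inner_axis by simp
    qed
    also have "\<dots> = (0 + (\<Sum>b\<in>Basis. (c b * (Z \<bullet> b)) *\<^sub>R b)) \<bullet> b"
      using b by (simp add: inner_sum_left_Basis)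
    finally show "rowscale i r Z \<bullet> b = (0 + (\<Sum>b\<in>Basis. (c b * (Z \<bullet> b)) *\<^sub>R b)) \<bullet> b" .
  qed
  have [measurable]: "rowscale i r \<in> borel_measurable borel"
    unfolding T[abs_def] by measurable
  have "(\<Prod>b\<in>Basis. \<bar>c b\<bar>) = (\<Prod>b\<in>(Basis :: 'n cmat set). if b $ i \<noteq> 0 then r else 1)"
    using r by (intro prod.cong refl) (auto simp: c_def)
  also have "\<dots> = r ^ card ?B"
    by (subst prod.inter_filter[symmetric]) auto
  finally have jac: "(\<Prod>b\<in>Basis. \<bar>c b\<bar>) = r ^ card ?B" .
  have L: "lborel = density (distr lborel borel (rowscale i r)) (\<lambda>_. (\<Prod>b\<in>Basis. \<bar>c b\<bar>))"
    unfolding T[abs_def] by (rule lborel_affine_euclidean) (use r in \<open>auto simp: c_def\<close>)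
  show "(\<integral>\<^sup>+Z. g Z \<partial>lborel) = ennreal (r ^ card ?B) * (\<integral>\<^sup>+Z. g (rowscale i r Z) \<partial>lborel)"
  proof -
    have "(\<integral>\<^sup>+Z. g Z \<partial>lborel) =
        (\<integral>\<^sup>+Z. g Z \<partial>density (distr lborel borel (rowscale i r)) (\<lambda>_. ennreal (r ^ card ?B)))"
      using L unfolding jac by (rule arg_cong)
    also have "\<dots> = (\<integral>\<^sup>+Z. ennreal (r ^ card ?B) * g Z \<partial>distr lborel borel (rowscale i r))"
      by (rule nn_integral_density) auto
    also have "\<dots> = (\<integral>\<^sup>+Z. ennreal (r ^ card ?B) * g (rowscale i r Z) \<partial>lborel)"
      by (rule nn_integral_distr) auto
    also have "\<dots> = ennreal (r ^ card ?B) * (\<integral>\<^sup>+Z. g (rowscale i r Z) \<partial>lborel)"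
      by (rule nn_integral_cmult) measurable
    finally show ?thesis .
  qed
qed

lemma wdet_borel [measurable]: "(wdet :: 'n::finite cmat \<Rightarrow> real) \<in> borel_measurable borel"
  by (intro borel_measurable_continuous_onI continuous_on_wdet)

lemma keep_rows_borel [measurable]: "(keep_rows S :: 'n::finite cmat \<Rightarrow> _) \<in> borel_measurable borel"
  unfolding keep_rows_def[abs_def]
  by (intro borel_measurable_continuous_onI continuous_on_vec_lambda) (auto intro!: continuous_intros)

lemma rowscale_borel [measurable]: "(rowscale i r :: 'n::finite cmat \<Rightarrow> _) \<in> borel_measurable borel"
  unfolding rowscale_def[abs_def]
  by (intro borel_measurable_continuous_onI continuous_on_vec_lambda) (auto intro!: continuous_intros)

lemma cartan_domain_borel [measurable]: "(cartan_domain :: 'n::finite cmat set) \<in> sets borel"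
  by (rule borel_open[OF open_cartan_domain])

lemma wdet_bounded: "\<exists>B>0. \<forall>Z\<in>(cartan_domain :: 'n::finite cmat set). wdet Z \<le> B"
proof -
  have "compact (wdet ` {Z::'n cmat. opn Z \<le> 1})"
    by (intro compact_continuous_image continuous_on_wdet compact_opn_le)
  then have "bounded (wdet ` {Z::'n cmat. opn Z \<le> 1})" by (rule compact_imp_bounded)
  then obtain B where "\<forall>y\<in>wdet ` {Z::'n cmat. opn Z \<le> 1}. norm y \<le> B"
    unfolding bounded_iff by blast
  then have B: "\<And>Z::'n cmat. opn Z \<le> 1 \<Longrightarrow> \<bar>wdet Z\<bar> \<le> B" by simp
  have "wdet Z \<le> max B 1" if "Z \<in> cartan_domain" for Z :: "'n cmat"
    using B[of Z] that by (auto simp: cartan_domain_iff)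
  then show ?thesis by (intro exI[of _ "max B 1"]) auto
qed

lemma emeasure_cartan_domain_finite: "emeasure lborel (cartan_domain :: 'n::finite cmat set) < \<infinity>"
  using emeasure_bounded_finite[OF bounded_cartan_domain] by simp

lemma power_bernoulli: "0 \<le> x \<Longrightarrow> x \<le> 1 \<Longrightarrow> 1 - (1 - x) ^ d \<le> real d * (x::real)"
  using Bernoulli_inequality[of "- x" d] by simp

definition shell :: "nat \<Rightarrow> real" where "shell k = 1 - 1 / 2 ^ (k + 1)"

lemma shell_bounds: "1/2 \<le> shell k" "shell k < 1"
  by (simp_all add: shell_def divide_simps power_increasing[of 1 _ "2::real"])

lemma ex_shell:
  assumes "Z \<in> cartan_domain"
  shows "\<exists>k. rowscale i (1 / shell k) Z \<in> cartan_domain"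
proof -
  have "(\<lambda>k. (1/2::real) ^ Suc k) \<longlonglongrightarrow> 0"
    by (intro LIMSEQ_Suc LIMSEQ_power_zero) simp
  then have "(\<lambda>k. 1 - (1/2) ^ Suc k) \<longlonglongrightarrow> 1 - (0::real)" by (intro tendsto_diff tendsto_const)
  moreover have "shell = (\<lambda>k. 1 - (1/2) ^ Suc k)" by (simp add: shell_def fun_eq_iff power_one_over)
  ultimately have "shell \<longlonglongrightarrow> 1" by simp
  then have "(\<lambda>k. 1 / shell k) \<longlonglongrightarrow> 1 / 1" by (intro tendsto_divide tendsto_const) simp_all
  then have lim: "(\<lambda>k. 1 / shell k) \<longlonglongrightarrow> 1" by simp
  have "(\<lambda>k. rowscale i (1 / shell k) Z) \<longlonglongrightarrow> rowscale i 1 Z"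
    unfolding rowscale_def
  proof (intro tendsto_vec_lambda tendsto_mult tendsto_const)
    show "(\<lambda>k. if j = i then complex_of_real (1 / shell k) else 1) \<longlonglongrightarrow>
      (if j = i then complex_of_real 1 else 1)" for j
      using tendsto_of_real[OF lim, where 'a = complex] by (cases "j = i") auto
  qed
  moreover have "rowscale i 1 Z = Z" by (simp add: rowscale_def vec_eq_iff)
  ultimately have "(\<lambda>k. rowscale i (1 / shell k) Z) \<longlonglongrightarrow> Z" by simp
  then have "\<forall>\<^sub>F k in sequentially. rowscale i (1 / shell k) Z \<in> cartan_domain"
    by (rule topological_tendstoD[OF _ open_cartan_domain assms])
  then show ?thesis unfolding eventually_sequentially by blast
qed

text \<open>Let \<open>m\<close> be the first index for which row \<open>i\<close> can be enlarged by \<open>1 / shell m\<close>.  Then the determinant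
with row \<open>i\<close> is at least \<open>1 / 2^(m+1)\<close> times the determinant without it, and a negative power turns
this into an upper bound.  The first summand covers \<open>m = 0\<close>, the term of index \<open>m - 1\<close> of the series the rest.\<close>

lemma wdet_powr_le_shells:
  fixes Z :: "'n::finite cmat"
  assumes Z: "Z \<in> cartan_domain" and i: "i \<notin> S" and s: "s < 0"
  shows "ennreal (wdet (keep_rows (insert i S) Z) powr s) \<le>
    ennreal (2 powr (-s)) * ennreal (wdet (keep_rows S Z) powr s) +
    (\<Sum>k. ennreal (2 powr (-s * (real k + 2))) *
      (ennreal (wdet (keep_rows S Z) powr s) * indicator {Z. rowscale i (1 / shell k) Z \<notin> cartan_domain} Z))"
proof -
  let ?in = "\<lambda>k. rowscale i (1 / shell k) Z \<in> cartan_domain"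
  let ?a = "wdet (keep_rows S Z)" and ?b = "wdet (keep_rows (insert i S) Z)"
  have a: "0 < ?a" using Z by (intro wdet_pos keep_rows_in_domain)
  define m where "m = (LEAST k. ?in k)"
  have m: "?in m" unfolding m_def using ex_shell[OF Z] by (rule LeastI_ex)
  have less: "\<not> ?in k" if "k < m" for k using that not_less_Least unfolding m_def by blast
  have "1 / 2 ^ (m + 1) \<le> 1 - (shell m)\<^sup>2"
  proof -
    have "1 - (shell m)\<^sup>2 = (1 - shell m) * (1 + shell m)" by (simp add: power2_eq_square algebra_simps)
    also have "\<dots> \<ge> (1 - shell m) * 1" using shell_bounds[of m] by (intro mult_left_mono) auto
    finally show ?thesis by (simp add: shell_def)
  qed
  then have "?a * (1 / 2 ^ (m + 1)) \<le> ?a * (1 - (shell m)\<^sup>2)"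
    using a by (intro mult_left_mono) auto
  also have "\<dots> \<le> ?b" using shell_bounds[of m] m i Z by (intro wdet_ge_shell) auto
  finally have "?b powr s \<le> (?a * (1 / 2 ^ (m + 1))) powr s"
    using a s by (intro powr_mono2') auto
  also have "\<dots> = ?a powr s * (1 / 2 ^ (m + 1)) powr s"
    by (rule powr_mult)
  also have "1 / 2 ^ (m + 1) = (2::real) powr (- (real m + 1))"
  proof -
    have "(2::real) powr (- real (m + 1)) = 1 / 2 ^ (m + 1)"
      by (simp only: powr_minus_divide powr_realpow zero_less_numeral)
    moreover have "- (real m + 1) = - real (m + 1)" by simp
    ultimately show ?thesis by (simp only:)
  qed
  also have "\<dots> powr s = 2 powr (-s * (real m + 1))"
  proof -
    have "- (real m + 1) * s = -s * (real m + 1)" by (simp add: algebra_simps)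
    then show ?thesis unfolding powr_powr by (simp only:)
  qed
  finally have "?b powr s \<le> ?a powr s * 2 powr (-s * (real m + 1))" .
  then have le: "?b powr s \<le> 2 powr (-s * (real m + 1)) * ?a powr s" by (subst mult.commute)
  show ?thesis
  proof (cases m)
    case 0
    have "ennreal (?b powr s) \<le> ennreal (2 powr (-s) * ?a powr s)"
    proof (rule ennreal_leI)
      have "-s * (real m + 1) = -s" using 0 by simp
      then show "?b powr s \<le> 2 powr (-s) * ?a powr s" using le by (simp only:)
    qed
    also have "\<dots> = ennreal (2 powr (-s)) * ennreal (?a powr s)" by (rule ennreal_mult) auto
    finally show ?thesis by (rule add_increasing2[OF zero_le])
  next
    case (Suc k)
    let ?f = "\<lambda>k. ennreal (2 powr (-s * (real k + 2))) *
      (ennreal (wdet (keep_rows S Z) powr s) * indicator {Z. rowscale i (1 / shell k) Z \<notin> cartan_domain} Z)"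
    have "ennreal (?b powr s) \<le> ennreal (2 powr (-s * (real m + 1)) * ?a powr s)" using le by (rule ennreal_leI)
    also have "\<dots> = ?f k"
    proof -
      have eq: "real m + 1 = real k + 2" by (simp add: Suc)
      have out: "\<not> ?in k" by (rule less) (simp add: Suc)
      show ?thesis unfolding eq using out by (simp add: ennreal_mult)
    qed
    also have "?f k = sum ?f {k}" by simp
    also have "sum ?f {k} \<le> suminf ?f" by (rule sum_le_suminf) auto
    finally show ?thesis by (rule add_increasing[OF zero_le])
  qed
qed

text \<open>The determinant for the rows in \<open>S\<close> does not depend on row \<open>i\<close>, so scaling that row shows that the part of the
domain left out by the factor \<open>1 / shell k\<close> carries the mass \<open>J (1 - (shell k)^d)\<close>, which is at
most \<open>J d / 2^(k+1)\<close>.  Multiplied by the coefficients \<open>2 powr (-s (k + 2))\<close> of the dyadic bound, this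
is a geometric series, convergent because \<open>s > -1\<close>.\<close>

lemma nn_integral_wdet_rows_step:
  fixes i :: "'n::finite"
  assumes s: "-1 < s" "s < 0" and i: "i \<notin> S"
    and fin: "(\<integral>\<^sup>+Z. ennreal (wdet (keep_rows S Z) powr s) * indicator cartan_domain Z \<partial>lborel) < \<infinity>"
  shows "(\<integral>\<^sup>+Z. ennreal (wdet (keep_rows (insert i S) Z) powr s) * indicator cartan_domain Z \<partial>lborel) < \<infinity>"
proof -
  let ?D = "cartan_domain :: 'n cmat set"
  let ?g = "\<lambda>Z::'n cmat. ennreal (wdet (keep_rows S Z) powr s) * indicator cartan_domain Z"
  let ?out = "\<lambda>k. {Z::'n cmat. rowscale i (1 / shell k) Z \<notin> cartan_domain}"
  let ?J = "\<integral>\<^sup>+Z. ?g Z \<partial>lborel"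
  obtain d where d: "\<And>r (g :: 'n cmat \<Rightarrow> ennreal). 0 < r \<Longrightarrow> g \<in> borel_measurable borel \<Longrightarrow>
      (\<integral>\<^sup>+Z. g Z \<partial>lborel) = ennreal (r ^ d) * (\<integral>\<^sup>+Z. g (rowscale i r Z) \<partial>lborel)"
    using rowscale_jacobian[of i] by blast
  have [measurable]: "?out k \<in> sets borel" for k by measurable
  define J where "J = enn2real ?J"
  have J: "?J = ennreal J" "0 \<le> J" using fin by (auto simp: J_def)
  have shell_mass: "(\<integral>\<^sup>+Z. ?g Z * indicator (?out k) Z \<partial>lborel) \<le> ennreal (J * (real d / 2 ^ (k + 1)))" for k
  proof -
    let ?r = "shell k"
    have r: "0 < ?r" "?r < 1" using shell_bounds[of k] by auto
    have eq: "keep_rows S (rowscale i (1 / ?r) Z) = keep_rows S Z" for Z :: "'n cmat"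
      using i by (auto simp: keep_rows_def rowscale_def vec_eq_iff)
    have "?J = ennreal ((1 / ?r) ^ d) * (\<integral>\<^sup>+Z. ?g (rowscale i (1 / ?r) Z) \<partial>lborel)"
      using r by (intro d) auto
    also have "(\<integral>\<^sup>+Z. ?g (rowscale i (1 / ?r) Z) \<partial>lborel) = (\<integral>\<^sup>+Z. ?g Z * indicator (- ?out k) Z \<partial>lborel)"
    proof (intro nn_integral_cong)
      fix Z :: "'n cmat"
      have "rowscale i (1 / ?r) Z \<in> ?D \<Longrightarrow> Z \<in> ?D"
      proof -
        assume "rowscale i (1 / ?r) Z \<in> ?D"
        then have "rowscale i ?r (rowscale i (1 / ?r) Z) \<in> ?D" using r by (intro rowscale_in_domain[of ?r]) auto
        moreover have "rowscale i ?r (rowscale i (1 / ?r) Z) = Z"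
          using r by (auto simp: rowscale_def vec_eq_iff)
        ultimately show "Z \<in> ?D" by simp
      qed
      then show "?g (rowscale i (1 / ?r) Z) = ?g Z * indicator (- ?out k) Z"
        by (auto simp: eq indicator_def)
    qed
    finally have "ennreal (?r ^ d) * ?J = ennreal (?r ^ d * (1 / ?r) ^ d) * (\<integral>\<^sup>+Z. ?g Z * indicator (- ?out k) Z \<partial>lborel)"
      using r by (simp add: ennreal_mult' mult.assoc)
    also have "?r ^ d * (1 / ?r) ^ d = 1" using r by (simp add: power_one_over)
    finally have inside: "(\<integral>\<^sup>+Z. ?g Z * indicator (- ?out k) Z \<partial>lborel) = ennreal (?r ^ d * J)"
      using r J by (simp add: ennreal_mult')
    have "?J = (\<integral>\<^sup>+Z. ?g Z * indicator (?out k) Z + ?g Z * indicator (- ?out k) Z \<partial>lborel)"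
      by (intro nn_integral_cong) (auto simp: indicator_def)
    also have "\<dots> = (\<integral>\<^sup>+Z. ?g Z * indicator (?out k) Z \<partial>lborel) + (\<integral>\<^sup>+Z. ?g Z * indicator (- ?out k) Z \<partial>lborel)"
      by (rule nn_integral_add) auto
    finally have "(\<integral>\<^sup>+Z. ?g Z * indicator (?out k) Z \<partial>lborel) = ennreal J - ennreal (?r ^ d * J)"
      using inside J by (simp add: ennreal_add_diff_cancel_right)
    also have "\<dots> = ennreal (J * (1 - ?r ^ d))"
      using r J by (simp add: ennreal_minus algebra_simps)
    also have "\<dots> \<le> ennreal (J * (real d / 2 ^ (k + 1)))"
    proof (intro ennreal_leI mult_left_mono)
      have "(1::real) \<le> 2 ^ (k + 1)" by (rule one_le_power) simp
      then have "1 / 2 ^ (k + 1) \<le> (1::real)" by simp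
      from power_bernoulli[OF _ this, of d] show "1 - shell k ^ d \<le> real d / 2 ^ (k + 1)"
        unfolding shell_def by simp
    qed (use J in simp)
    finally show ?thesis .
  qed
  let ?c = "\<lambda>k::nat. 2 powr (-s * (real k + 2))"
  have "(\<integral>\<^sup>+Z. ennreal (wdet (keep_rows (insert i S) Z) powr s) * indicator ?D Z \<partial>lborel) \<le>
      (\<integral>\<^sup>+Z. ennreal (2 powr (-s)) * ?g Z + (\<Sum>k. ennreal (?c k) * (?g Z * indicator (?out k) Z)) \<partial>lborel)"
  proof (intro nn_integral_mono)
    fix Z :: "'n cmat"
    show "ennreal (wdet (keep_rows (insert i S) Z) powr s) * indicator ?D Z \<le>
      ennreal (2 powr (-s)) * ?g Z + (\<Sum>k. ennreal (?c k) * (?g Z * indicator (?out k) Z))"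
    proof (cases "Z \<in> ?D")
      case True
      then show ?thesis using wdet_powr_le_shells[OF True i s(2)] by simp
    qed simp
  qed
  also have "\<dots> = (\<integral>\<^sup>+Z. ennreal (2 powr (-s)) * ?g Z \<partial>lborel) +
      (\<integral>\<^sup>+Z. (\<Sum>k. ennreal (?c k) * (?g Z * indicator (?out k) Z)) \<partial>lborel)"
    by (rule nn_integral_add) auto
  also have "\<dots> = ennreal (2 powr (-s)) * ?J + (\<Sum>k. ennreal (?c k) * (\<integral>\<^sup>+Z. ?g Z * indicator (?out k) Z \<partial>lborel))"
    by (subst nn_integral_suminf) (auto simp: nn_integral_cmult)
  also have "\<dots> \<le> ennreal (2 powr (-s)) * ?J + (\<Sum>k. ennreal (?c k * (J * (real d / 2 ^ (k + 1)))))"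
  proof (intro add_mono suminf_le order_refl)
    fix k
    have "ennreal (?c k) * (\<integral>\<^sup>+Z. ?g Z * indicator (?out k) Z \<partial>lborel) \<le> ennreal (?c k) * ennreal (J * (real d / 2 ^ (k + 1)))"
      by (intro mult_left_mono shell_mass) simp
    also have "\<dots> = ennreal (?c k * (J * (real d / 2 ^ (k + 1))))"
      by (rule ennreal_mult[symmetric]) (use J in simp_all)
    finally show "ennreal (?c k) * (\<integral>\<^sup>+Z. ?g Z * indicator (?out k) Z \<partial>lborel) \<le> \<dots>" .
  qed auto
  also have "\<dots> < \<infinity>"
  proof -
    have eq: "?c k * (J * (real d / 2 ^ (k + 1))) = (2 powr (-2 * s) * J * real d / 2) * (2 powr (-s - 1)) ^ k" for k
    proof -
      have "(2 powr (-s)) ^ k = 2 powr (-s * real k)"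
        by (subst powr_realpow[symmetric]) (simp_all add: powr_powr)
      then have "?c k = 2 powr (-2 * s) * (2 powr (-s)) ^ k"
        by (simp add: powr_add[symmetric] algebra_simps)
      moreover have "(2 powr (-s - 1)) = 2 powr (-s) / (2::real)"
        by (simp add: powr_diff)
      ultimately have "?c k = 2 powr (-2 * s) * (2 powr (-s)) ^ k"
        and "(2 powr (-s - 1)) ^ k = (2 powr (-s)) ^ k / (2::real) ^ k"
        by (simp_all only: power_divide)
      then show ?thesis by simp
    qed
    have "(2::real) powr (-s - 1) < 2 powr 0" by (rule powr_less_mono) (use s in auto)
    then have "(2::real) powr (-s - 1) < 1" by simp
    then have "summable (\<lambda>k. ?c k * (J * (real d / 2 ^ (k + 1))))"
      unfolding eq by (intro summable_mult summable_geometric) simp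
    then have "(\<Sum>k. ennreal (?c k * (J * (real d / 2 ^ (k + 1))))) = ennreal (\<Sum>k. ?c k * (J * (real d / 2 ^ (k + 1))))"
      using J by (intro suminf_ennreal2) auto
    then show ?thesis using J by (simp add: ennreal_mult_less_top)
  qed
  finally show ?thesis .
qed

text \<open>The induction over sets of rows starts from the empty set, where the determinant is 1.\<close>

lemma nn_integral_wdet_finite:
  assumes s: "-1 < s"
  shows "(\<integral>\<^sup>+Z. ennreal (wdet (Z::'n::finite cmat) powr s) * indicator cartan_domain Z \<partial>lborel) < \<infinity>"
proof (cases "s < 0")
  case True
  have "finite S \<Longrightarrow> (\<integral>\<^sup>+Z. ennreal (wdet (keep_rows S Z) powr s) * indicator cartan_domain Z \<partial>lborel) < \<infinity>" for S :: "'n set"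
  proof (induction S rule: finite_induct)
    case empty
    have "keep_rows {} Z = 0" for Z :: "'n cmat" by (simp add: keep_rows_def vec_eq_iff)
    then show ?case using emeasure_cartan_domain_finite by simp
  next
    case (insert i S)
    then show ?case using nn_integral_wdet_rows_step s True by blast
  qed
  from this[of UNIV] show ?thesis by (simp add: keep_rows_def)
next
  case False
  obtain B where B: "0 < B" "\<And>Z. Z \<in> (cartan_domain :: 'n cmat set) \<Longrightarrow> wdet Z \<le> B" using wdet_bounded by blast
  have "(\<integral>\<^sup>+Z. ennreal (wdet (Z::'n cmat) powr s) * indicator cartan_domain Z \<partial>lborel) \<le>
      (\<integral>\<^sup>+Z. ennreal (B powr s) * indicator (cartan_domain :: 'n cmat set) Z \<partial>lborel)"
    using False B wdet_pos[THEN less_imp_le]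
    by (intro nn_integral_mono) (auto simp: indicator_def intro!: ennreal_leI powr_mono2)
  also have "\<dots> = ennreal (B powr s) * emeasure lborel (cartan_domain :: 'n cmat set)"
    by (simp add: nn_integral_cmult_indicator)
  also have "\<dots> < \<infinity>" using emeasure_cartan_domain_finite[where 'n = 'n] by (simp add: ennreal_mult_less_top)
  finally show ?thesis .
qed

section \<open>The weighted measure and its symmetries\<close>

text \<open>Left and right multiplication are treated together, so that every statement about left-invariant
symbols (\<open>l = True\<close>) also serves for right-invariant ones (\<open>l = False\<close>).\<close>

definition act :: "bool \<Rightarrow> 'n::finite cmat \<Rightarrow> 'n cmat \<Rightarrow> 'n cmat" where
  "act l X Z = (if l then X ** Z else Z ** X)"

lemma matrix_mult_add_diff:
  fixes A B C :: "'n::finite cmat"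
  shows "(A + B) ** C = A ** C + B ** C" "C ** (A + B) = C ** A + C ** B"
    "(A - B) ** C = A ** C - B ** C" "C ** (A - B) = C ** A - C ** B"
  by (simp_all add: vec_eq_iff matrix_matrix_mult_def algebra_simps sum.distrib sum_subtractf)

lemma act_add: "act l X (Y + Z) = act l X Y + act l X Z"
  by (simp add: act_def matrix_mult_add_diff)

lemma act_cscale: "act l X (cscale c Z) = cscale c (act l X Z)"
  by (simp add: act_def cscale_mult_left cscale_mult_right)

lemma act_cscale_left: "act l (cscale c X) Z = cscale c (act l X Z)"
  by (simp add: act_def cscale_mult_left cscale_mult_right)

lemma act_mat1 [simp]: "act l (mat 1) Z = Z" "act l X (mat 1) = X"
  by (simp_all add: act_def)

lemma linear_act: "linear (act l X)"
  by (rule linearI) (simp_all add: act_add act_cscale flip: cscale_of_real)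

lemma act_ctranspose_unitary:
  assumes "U \<in> unitary_group"
  shows "act l (ctranspose U) (act l U Z) = Z" "act l U (act l (ctranspose U) Z) = Z"
  using assms
  by (simp_all add: act_def unitary_group_def matrix_mul_assoc)
     (simp_all add: unitary_group_def flip: matrix_mul_assoc)

lemma norm_act_unitary: "U \<in> unitary_group \<Longrightarrow> norm (act l U Z) = norm (Z :: 'n::finite cmat)"
  by (simp add: act_def norm_unitary_mult norm_mult_unitary)

lemma act_in_domain: "opn X \<le> 1 \<Longrightarrow> Z \<in> cartan_domain \<Longrightarrow> act l X Z \<in> cartan_domain"
  by (simp add: act_def cartan_domain_mult_left cartan_domain_mult_right)

lemma act_in_domain_iff: "U \<in> unitary_group \<Longrightarrow> act l U Z \<in> cartan_domain \<longleftrightarrow> Z \<in> cartan_domain"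
  using act_in_domain[OF unitary_opn_le[of U], of Z l]
    act_in_domain[OF unitary_opn_le[OF unitary_ctranspose[of U]], of "act l U Z" l]
  by (auto simp: act_ctranspose_unitary)

lemma wdet_act:
  assumes U: "U \<in> unitary_group" shows "wdet (act l U Z) = wdet (Z :: 'n::finite cmat)"
proof (cases l)
  case True
  have UU: "U ** ctranspose U = mat 1" using U by (simp add: unitary_group_def)
  have "mat 1 - (U ** Z) ** ctranspose (U ** Z) = U ** (mat 1 - Z ** ctranspose Z) ** ctranspose U"
  proof -
    have "U ** (mat 1 - Z ** ctranspose Z) ** ctranspose U = U ** mat 1 ** ctranspose U - U ** (Z ** ctranspose Z) ** ctranspose U"
      by (simp only: matrix_mult_add_diff)
    then show ?thesis by (simp add: UU ctranspose_mult matrix_mul_assoc)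
  qed
  then have "det (mat 1 - (U ** Z) ** ctranspose (U ** Z)) = det (U ** ctranspose U) * det (mat 1 - Z ** ctranspose Z)"
    by (simp only: det_mul) (simp only: mult_ac)
  then show ?thesis using True by (simp add: wdet_def act_def UU)
next
  case False
  have "(Z ** U) ** ctranspose (Z ** U) = Z ** (U ** ctranspose U) ** ctranspose Z"
    by (simp only: ctranspose_mult matrix_mul_assoc)
  then show ?thesis using False U by (simp add: wdet_def act_def unitary_group_def)
qed

text \<open>Multiplications by unitary matrices, and with them rotations by scalars of modulus one, are of this
kind.  These maps preserve the weighted measure.\<close>

definition is_symmetry :: "('n::finite cmat \<Rightarrow> 'n cmat) \<Rightarrow> bool" where
  "is_symmetry \<phi> \<longleftrightarrow> linear \<phi> \<and> (\<forall>Z. norm (\<phi> Z) = norm Z) \<and> (\<forall>Z. \<phi> Z \<in> cartan_domain \<longleftrightarrow> Z \<in> cartan_domain)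
     \<and> (\<forall>Z. wdet (\<phi> Z) = wdet Z)"

lemma is_symmetry_act: "U \<in> unitary_group \<Longrightarrow> is_symmetry (act l U)"
  by (simp add: is_symmetry_def linear_act norm_act_unitary act_in_domain_iff wdet_act)

text \<open>The type token fixes the size of the matrices, on which the lower bound for the parameter depends.\<close>

locale bergman_setting =
  fixes lam :: real and tn :: "'n::finite itself"
  assumes lam: "lam > 2 * real CARD('n) - 1"
begin

abbreviation D :: "'n cmat set" where "D \<equiv> cartan_domain"
abbreviation \<mu> :: "'n cmat measure" where "\<mu> \<equiv> bergman_measure lam"
abbreviation W :: "'n cmat \<Rightarrow> real" where "W \<equiv> bergman_weight lam"

lemma W_borel [measurable]: "W \<in> borel_measurable borel"
  unfolding bergman_weight_eq[abs_def] by measurable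

lemma W_pos: "Z \<in> D \<Longrightarrow> 0 < W Z"
  using wdet_pos[of Z] by (simp add: bergman_weight_eq)

lemma W_nonneg: "0 \<le> W Z"
  by (simp add: bergman_weight_eq)

lemma D_lebesgue [measurable]: "D \<in> sets lebesgue"
  using cartan_domain_borel by simp

lemma sets_weighted: "sets (weighted_measure lam c) = sets (lebesgue_on D)"
  by (simp add: weighted_measure_def)

lemma emeasure_weighted:
  assumes A: "A \<in> sets (lebesgue_on D)" and c: "0 \<le> c"
  shows "emeasure (weighted_measure lam c) A = (\<integral>\<^sup>+Z. ennreal (c * W Z) * indicator A Z \<partial>lebesgue)"
proof -
  have AD: "A \<subseteq> D" using A by (auto simp: sets_restrict_space)
  have [measurable]: "W \<in> borel_measurable lebesgue" by (rule measurable_completion) simp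
  have [measurable]: "W \<in> borel_measurable (lebesgue_on D)" by (rule measurable_restrict_space1) simp
  have "emeasure (weighted_measure lam c) A = (\<integral>\<^sup>+Z. ennreal (c * W Z) * indicator A Z \<partial>lebesgue_on D)"
    unfolding weighted_measure_def using A by (intro emeasure_density) auto
  also have "\<dots> = (\<integral>\<^sup>+Z. ennreal (c * W Z) * indicator A Z * indicator D Z \<partial>lebesgue)"
    by (rule nn_integral_restrict_space) simp
  also have "\<dots> = (\<integral>\<^sup>+Z. ennreal (c * W Z) * indicator A Z \<partial>lebesgue)"
    using AD by (intro nn_integral_cong) (auto simp: indicator_def)
  finally show ?thesis .
qed

lemma W_total:
  obtains I where "0 < I" "(\<integral>\<^sup>+Z. ennreal (W Z) * indicator D Z \<partial>lborel) = ennreal I"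
proof -
  let ?I = "\<integral>\<^sup>+Z. ennreal (W Z) * indicator D Z \<partial>lborel"
  have fin: "?I < \<infinity>"
    unfolding bergman_weight_eq using lam by (intro nn_integral_wdet_finite) simp
  have "?I \<noteq> 0"
  proof
    assume "?I = 0"
    then have "AE Z in lborel. ennreal (W Z) * indicator D Z = 0"
      by (subst (asm) nn_integral_0_iff_AE) auto
    then have "AE Z in lborel. Z \<notin> D"
      by eventually_elim (use W_pos in \<open>fastforce simp: indicator_def\<close>)
    then have "emeasure lborel D = 0"
      by (subst (asm) AE_iff_measurable[OF _ refl]) (auto)
    obtain r where r: "0 < r" "ball 0 r \<subseteq> D"
      using open_cartan_domain zero_in_cartan_domain unfolding open_contains_ball by blast
    then have "emeasure lborel (ball (0 :: 'n cmat) r) \<le> emeasure lborel D"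
      by (intro emeasure_mono) auto
    with \<open>emeasure lborel D = 0\<close> have "measure lborel (ball (0 :: 'n cmat) r) = 0"
      by (simp add: measure_def)
    then show False using content_ball_gt_0_iff[of "0 :: 'n cmat" r] r by simp
  qed
  then have "0 < enn2real ?I" using fin by (simp add: enn2real_positive_iff zero_less_iff_neq_zero)
  moreover have "?I = ennreal (enn2real ?I)" using fin by simp
  ultimately show ?thesis using that by blast
qed

definition cst :: real where
  "cst = (THE c. 0 < c \<and> emeasure (weighted_measure lam c :: 'n cmat measure) D = 1)"

lemma emeasure_weighted_D:
  assumes "0 \<le> c"
  shows "emeasure (weighted_measure lam c) D = ennreal c * (\<integral>\<^sup>+Z. ennreal (W Z) * indicator D Z \<partial>lborel)"
proof -
  have "emeasure (weighted_measure lam c) D = (\<integral>\<^sup>+Z. ennreal (c * W Z) * indicator D Z \<partial>lebesgue)"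
    using assms by (intro emeasure_weighted) (auto simp: sets_restrict_space)
  also have "\<dots> = (\<integral>\<^sup>+Z. ennreal (c * W Z) * indicator D Z \<partial>lborel)"
    by (rule nn_integral_completion)
  also have "\<dots> = (\<integral>\<^sup>+Z. ennreal c * (ennreal (W Z) * indicator D Z) \<partial>lborel)"
    using assms by (intro nn_integral_cong) (simp add: ennreal_mult W_nonneg mult.assoc)
  also have "\<dots> = ennreal c * (\<integral>\<^sup>+Z. ennreal (W Z) * indicator D Z \<partial>lborel)"
    by (rule nn_integral_cmult) measurable
  finally show ?thesis .
qed

lemma cst: "0 < cst" "emeasure (weighted_measure lam cst :: 'n cmat measure) D = 1"
proof -
  obtain I where I: "0 < I" "(\<integral>\<^sup>+Z. ennreal (W Z) * indicator D Z \<partial>lborel) = ennreal I"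
    by (rule W_total)
  have iff: "emeasure (weighted_measure lam c) D = 1 \<longleftrightarrow> c = 1 / I" if "0 < c" for c
    using I that by (simp add: emeasure_weighted_D ennreal_mult[symmetric] ennreal_eq_1 field_simps)
  have "\<exists>!c. 0 < c \<and> emeasure (weighted_measure lam c) D = 1"
    using I(1) iff by (intro ex1I[of _ "1 / I"]) auto
  from theI'[OF this] show "0 < cst" "emeasure (weighted_measure lam cst :: 'n cmat measure) D = 1"
    unfolding cst_def by auto
qed

lemma \<mu>_eq: "\<mu> = weighted_measure lam cst"
  unfolding bergman_measure_def cst_def ..

lemma sets_\<mu>: "sets \<mu> = sets (lebesgue_on D)"
  by (simp add: \<mu>_eq sets_weighted)

lemma space_\<mu> [simp]: "space \<mu> = D"
  using sets_eq_imp_space_eq[OF sets_\<mu>] by (simp add: space_restrict_space)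

sublocale M: finite_measure \<mu>
  by (rule finite_measureI) (simp add: cst(2)[folded \<mu>_eq])

lemma borel_measurable_\<mu>: "f \<in> borel_measurable borel \<Longrightarrow> f \<in> borel_measurable \<mu>"
  unfolding measurable_cong_sets[OF sets_\<mu> refl]
  by (intro measurable_restrict_space1 measurable_completion) simp

lemma id_measurable_\<mu>: "(\<lambda>Z. Z) \<in> \<mu> \<rightarrow>\<^sub>M borel"
  by (rule borel_measurable_\<mu>) simp

lemma W_lebesgue_on: "W \<in> borel_measurable (lebesgue_on D)"
  by (intro measurable_restrict_space1 measurable_completion) simp

lemma AE_\<mu>: "(AE Z in \<mu>. P Z) \<longleftrightarrow> (AE Z in lebesgue_on D. P Z)"
proof -
  note [measurable] = W_lebesgue_on
  have "(AE Z in \<mu>. P Z) \<longleftrightarrow> (AE Z in lebesgue_on D. 0 < ennreal (cst * W Z) \<longrightarrow> P Z)"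
    unfolding \<mu>_eq weighted_measure_def by (intro AE_density) measurable
  also have "\<dots> \<longleftrightarrow> (AE Z in lebesgue_on D. P Z)"
    using cst(1) W_pos by (intro AE_cong) (auto simp: space_restrict_space)
  finally show ?thesis .
qed

lemma symmetry_measurable:
  assumes "is_symmetry \<phi>" shows "\<phi> \<in> \<mu> \<rightarrow>\<^sub>M \<mu>"
proof -
  have "\<phi> \<in> lebesgue \<rightarrow>\<^sub>M lebesgue"
    using assms by (intro measurable_lebesgue_linear_isometry) (auto simp: is_symmetry_def)
  then have "\<phi> \<in> lebesgue_on D \<rightarrow>\<^sub>M lebesgue_on D"
    using assms by (rule_tac measurable_restrict_space3) (auto simp: is_symmetry_def)
  then show ?thesis
    unfolding measurable_cong_sets[OF sets_\<mu> sets_\<mu>] .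
qed

lemma emeasure_\<mu>:
  "A \<in> sets \<mu> \<Longrightarrow> emeasure \<mu> A = (\<integral>\<^sup>+Z. ennreal (cst * W Z) * indicator A Z \<partial>lebesgue)"
proof -
  assume A: "A \<in> sets \<mu>"
  have "emeasure (weighted_measure lam cst) A = (\<integral>\<^sup>+Z. ennreal (cst * W Z) * indicator A Z \<partial>lebesgue)"
    by (rule emeasure_weighted[OF A[unfolded sets_\<mu>] less_imp_le[OF cst(1)]])
  then show ?thesis unfolding \<mu>_eq .
qed

lemma lebesgue_on_D_sets:
  assumes "A \<in> sets (lebesgue_on D)" shows "A \<in> sets lebesgue" "A \<subseteq> D"
proof -
  show "A \<in> sets lebesgue" using assms sets_restrict_space_iff[of D lebesgue A] D_lebesgue by blast
  show "A \<subseteq> D" using sets.sets_into_space[OF assms] by (simp add: space_restrict_space)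
qed

lemma density_nonneg: "0 \<le> cst * W Z"
  using cst(1) W_nonneg[of Z] by (intro mult_nonneg_nonneg) auto

lemma distr_symmetry:
  assumes \<phi>: "is_symmetry \<phi>" shows "distr \<mu> \<mu> \<phi> = \<mu>"
proof (rule measure_eqI)
  fix A assume "A \<in> sets (distr \<mu> \<mu> \<phi>)"
  then have A: "A \<in> sets \<mu>" by simp
  then have "A \<in> sets (lebesgue_on D)" unfolding sets_\<mu> .
  then have AL: "A \<in> sets lebesgue" and AD: "A \<subseteq> D"
    by (rule lebesgue_on_D_sets)+
  have [measurable]: "W \<in> borel_measurable lebesgue" by (rule measurable_completion) simp
  have m: "\<phi> \<in> lebesgue \<rightarrow>\<^sub>M lebesgue" and d: "distr lebesgue lebesgue \<phi> = lebesgue"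
    using measurable_lebesgue_linear_isometry[of \<phi>] distr_lebesgue_linear_isometry[of \<phi>] \<phi>
    by (simp_all only: is_symmetry_def)
  have Winv: "W (\<phi> Z) = W Z" for Z using \<phi> unfolding is_symmetry_def bergman_weight_eq by simp
  have "emeasure (distr \<mu> \<mu> \<phi>) A = emeasure \<mu> (\<phi> -` A \<inter> D)"
    using A symmetry_measurable[OF \<phi>] by (simp add: emeasure_distr)
  also have "\<dots> = (\<integral>\<^sup>+Z. ennreal (cst * W Z) * indicator (\<phi> -` A \<inter> D) Z \<partial>lebesgue)"
    using measurable_sets[OF symmetry_measurable[OF \<phi>] A] by (intro emeasure_\<mu>) simp
  also have "\<dots> = (\<integral>\<^sup>+Z. ennreal (cst * W (\<phi> Z)) * indicator A (\<phi> Z) \<partial>lebesgue)"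
    using \<phi> AD by (intro nn_integral_cong) (auto simp: Winv indicator_def is_symmetry_def)
  also have "\<dots> = (\<integral>\<^sup>+Z. ennreal (cst * W Z) * indicator A Z \<partial>distr lebesgue lebesgue \<phi>)"
  proof (rule nn_integral_distr[symmetric, OF m])
    have [measurable]: "A \<in> sets lebesgue" by (rule AL)
    show "(\<lambda>Z. ennreal (cst * W Z) * indicator A Z) \<in> borel_measurable (distr lebesgue lebesgue \<phi>)"
      unfolding d by measurable
  qed
  also have "\<dots> = emeasure \<mu> A" unfolding d using A by (simp add: emeasure_\<mu>)
  finally show "emeasure (distr \<mu> \<mu> \<phi>) A = emeasure \<mu> A" .
qed simp

lemma integral_symmetry:
  fixes f :: "'n cmat \<Rightarrow> 'b::{banach,second_countable_topology}"
  assumes \<phi>: "is_symmetry \<phi>" and f: "f \<in> borel_measurable \<mu>"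
  shows "(LINT Z|\<mu>. f (\<phi> Z)) = (LINT Z|\<mu>. f Z)"
    and "integrable \<mu> (\<lambda>Z. f (\<phi> Z)) \<longleftrightarrow> integrable \<mu> f"
  using integral_distr[OF symmetry_measurable[OF \<phi>] f] integrable_distr_eq[OF symmetry_measurable[OF \<phi>] f]
  unfolding distr_symmetry[OF \<phi>] by simp_all

lemma integral_\<mu>_borel:
  fixes f :: "'n cmat \<Rightarrow> 'b::{banach,second_countable_topology}"
  assumes [measurable]: "f \<in> borel_measurable borel"
  shows "(LINT Z|\<mu>. f Z) = (LINT Z|lborel. indicator D Z *\<^sub>R ((cst * W Z) *\<^sub>R f Z))" (is ?A)
    and "integrable \<mu> f \<longleftrightarrow> integrable lborel (\<lambda>Z. indicator D Z *\<^sub>R ((cst * W Z) *\<^sub>R f Z))" (is ?B)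
proof -
  note [measurable] = W_lebesgue_on
  have f [measurable]: "f \<in> borel_measurable (lebesgue_on D)"
    by (rule measurable_restrict_space1, rule measurable_completion) simp
  have 0: "AE Z in lebesgue_on D. 0 \<le> cst * W Z" by (intro AE_I2 density_nonneg)
  have "(LINT Z|\<mu>. f Z) = (LINT Z|lebesgue_on D. (cst * W Z) *\<^sub>R f Z)"
    unfolding \<mu>_eq weighted_measure_def by (intro integral_density 0) measurable
  also have "\<dots> = (LINT Z|lebesgue. indicator D Z *\<^sub>R ((cst * W Z) *\<^sub>R f Z))"
    by (rule integral_restrict_space) simp
  also have "\<dots> = (LINT Z|lborel. indicator D Z *\<^sub>R ((cst * W Z) *\<^sub>R f Z))"
    by (rule integral_completion) measurable
  finally show ?A .
  have "integrable \<mu> f \<longleftrightarrow> integrable (lebesgue_on D) (\<lambda>Z. (cst * W Z) *\<^sub>R f Z)"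
    unfolding \<mu>_eq weighted_measure_def by (intro integrable_density 0) measurable
  also have "\<dots> \<longleftrightarrow> integrable lebesgue (\<lambda>Z. indicator D Z *\<^sub>R ((cst * W Z) *\<^sub>R f Z))"
    by (rule integrable_restrict_space) simp
  also have "\<dots> \<longleftrightarrow> integrable lborel (\<lambda>Z. indicator D Z *\<^sub>R ((cst * W Z) *\<^sub>R f Z))"
    by (rule integrable_completion) measurable
  finally show ?B .
qed

end

section \<open>Cauchy's formula as an average over the circle\<close>

definition circ :: "real \<Rightarrow> complex" where
  "circ t = exp (2 * of_real pi * \<i> * of_real t)"

definition unit_interval :: "real measure" where
  "unit_interval = restrict_space lborel {0..1}"

lemma cmod_circ [simp]: "cmod (circ t) = 1"
  by (simp add: circ_def)

lemma circ_nonzero [simp]: "circ t \<noteq> 0"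
  by (simp add: circ_def)

lemma continuous_on_circ [continuous_intros]: "continuous_on S circ"
  unfolding circ_def[abs_def] by (intro continuous_intros)

lemma space_unit_interval [simp]: "space unit_interval = {0..1}"
  by (simp add: unit_interval_def space_restrict_space)

lemma finite_measure_unit_interval: "finite_measure unit_interval"
  by (rule finite_measureI) (simp add: unit_interval_def emeasure_restrict_space space_restrict_space)

lemma emeasure_unit_interval: "emeasure unit_interval (space unit_interval) = 1"
  by (simp add: unit_interval_def emeasure_restrict_space space_restrict_space)

lemma borel_measurable_unit_interval: "f \<in> measurable borel N \<Longrightarrow> f \<in> measurable unit_interval N"
  unfolding unit_interval_def by (rule measurable_restrict_space1) simp

text \<open>The contour integral is rewritten as a Lebesgue integral over the parameter so that it can be
interchanged with integrals over the domain.\<close>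

lemma Cauchy_circ:
  assumes S: "open S" "cball 0 1 \<subseteq> S" and f: "f holomorphic_on S" and w: "cmod w < 1"
  shows "f w = (LINT t|unit_interval. f (circ t) * (circ t / (circ t - w)))"
proof -
  let ?g = "\<lambda>t. f (circ t) * (circ t / (circ t - w))"
  have ne: "circ t \<noteq> w" for t using w cmod_circ[of t] by fastforce
  have cont: "continuous_on {0..1} ?g"
    using S ne by (intro continuous_intros continuous_on_compose2[OF holomorphic_on_imp_continuous_on[OF f]]) auto
  have "((\<lambda>u. f u / (u - w)) has_contour_integral 2 * of_real pi * \<i> * f w) (circlepath 0 1)"
    using S w by (intro Cauchy_integral_circlepath holomorphic_on_imp_continuous_on holomorphic_on_subset[OF f]) auto
  then have "((\<lambda>x. f (circlepath 0 1 x) / (circlepath 0 1 x - w) *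
      vector_derivative (circlepath 0 1) (at x within {0..1})) has_integral 2 * of_real pi * \<i> * f w) {0..1}"
    by (simp add: has_contour_integral_def)
  then have "((\<lambda>t. (2 * of_real pi * \<i>) * ?g t) has_integral (2 * of_real pi * \<i>) * f w) {0..1}"
  proof (rule has_integral_eq[rotated])
    fix x :: real assume "x \<in> {0..1}"
    then show "f (circlepath 0 1 x) / (circlepath 0 1 x - w) * vector_derivative (circlepath 0 1) (at x within {0..1})
      = (2 * of_real pi * \<i>) * ?g x"
      by (simp add: vector_derivative_circlepath01) (simp add: circlepath circ_def)
  qed
  from has_integral_mult_right[OF this, of "1 / (2 * of_real pi * \<i>)"]
  have "(?g has_integral f w) {0..1}" by simp
  then have "integral {0..1} ?g = f w" by (rule integral_unique)
  moreover have "set_integrable lborel {0..1} ?g"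
    unfolding set_integrable_def using cont by (intro borel_integrable_compact) auto
  from set_borel_integral_eq_integral(2)[OF this]
  have "(LINT t:{0..1}|lborel. ?g t) = integral {0..1} ?g" .
  moreover have "(LINT t|unit_interval. ?g t) = (LINT t:{0..1}|lborel. ?g t)"
    unfolding unit_interval_def set_lebesgue_integral_def by (rule integral_restrict_space) simp
  ultimately show ?thesis by simp
qed

lemma mean_value_circ:
  assumes "open S" "cball 0 1 \<subseteq> S" "f holomorphic_on S"
  shows "(LINT t|unit_interval. f (circ t)) = f 0"
  using Cauchy_circ[OF assms, of 0] by simp

section \<open>Holomorphic functions of a matrix variable\<close>

lemma has_derivative_matrix_curve:
  fixes X :: "complex \<Rightarrow> 'n::finite cmat"
  assumes "\<And>i j. ((\<lambda>t. X t $ i $ j) has_field_derivative X' $ i $ j) (at t)"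
  shows "(X has_derivative (\<lambda>h. cscale h X')) (at t)"
proof -
  have lin: "bounded_linear (\<lambda>h. cscale h X')"
    unfolding linear_conv_bounded_linear[symmetric]
    by (rule linearI) (simp_all add: vec_eq_iff algebra_simps)
  have "((\<lambda>y. ((X y - X t) - cscale (y - t) X') /\<^sub>R norm (y - t)) \<longlongrightarrow> 0) (at t)"
  proof (intro vec_tendstoI)
    fix i j
    have "((\<lambda>t. X t $ i $ j) has_derivative (*) (X' $ i $ j)) (at t)"
      using assms by (simp add: has_field_derivative_def)
    then show "((\<lambda>y. (((X y - X t) - cscale (y - t) X') /\<^sub>R norm (y - t)) $ i $ j) \<longlongrightarrow> 0 $ i $ j) (at t)"
      by (simp add: has_derivative_at_within has_derivative_def mult.commute)
  qed
  then show ?thesis using lin by (simp add: has_derivative_at_within has_derivative_def)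
qed

lemma holomorphic_mat_derivative:
  assumes "holomorphic_mat f D" "open D" "Z \<in> D"
  obtains L where "(f has_derivative L) (at Z)" "\<And>c X. L (cscale c X) = c * L X"
  using assms unfolding holomorphic_mat_def cscale_def by (metis at_within_open)

lemma holomorphic_mat_curve:
  fixes X :: "complex \<Rightarrow> 'n::finite cmat"
  assumes f: "holomorphic_mat f D" "open D" and S: "open S"
    and X: "\<And>i j. (\<lambda>t. X t $ i $ j) holomorphic_on S" and XD: "\<And>t. t \<in> S \<Longrightarrow> X t \<in> D"
  shows "(\<lambda>t. f (X t)) holomorphic_on S"
proof (unfold holomorphic_on_open[OF S], intro ballI)
  fix t assume t: "t \<in> S"
  define X' where "X' = (\<chi> i j. deriv (\<lambda>t. X t $ i $ j) t)"
  have "(X has_derivative (\<lambda>h. cscale h X')) (at t)"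
  proof (rule has_derivative_matrix_curve)
    show "((\<lambda>t. X t $ i $ j) has_field_derivative X' $ i $ j) (at t)" for i j
      using holomorphic_derivI[OF X S t, of i j] by (simp add: X'_def)
  qed
  moreover obtain L where L: "(f has_derivative L) (at (X t))" "\<And>c X. L (cscale c X) = c * L X"
    using holomorphic_mat_derivative[OF f XD[OF t]] by blast
  ultimately have "((\<lambda>t. f (X t)) has_derivative (\<lambda>h. L (cscale h X'))) (at t)"
    using diff_chain_at by (fastforce simp: comp_def)
  then have "((\<lambda>t. f (X t)) has_field_derivative L X') (at t)"
  proof -
    have "(\<lambda>h. L (cscale h X')) = (*) (L X')" by (auto simp: L(2))
    with \<open>((\<lambda>t. f (X t)) has_derivative (\<lambda>h. L (cscale h X'))) (at t)\<close> show ?thesis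
      by (simp add: has_field_derivative_def)
  qed
  then show "\<exists>f'. ((\<lambda>t. f (X t)) has_field_derivative f') (at t)" by blast
qed

lemma holomorphic_mat_imp_continuous_on:
  "holomorphic_mat f D \<Longrightarrow> continuous_on D f"
  unfolding holomorphic_mat_def continuous_on_eq_continuous_within
  using has_derivative_continuous by blast

lemma holomorphic_mat_linear_compose:
  fixes \<phi> :: "'n::finite cmat \<Rightarrow> 'n cmat"
  assumes f: "holomorphic_mat f D" "open D" and \<phi>: "linear \<phi>" "\<And>c X. \<phi> (cscale c X) = cscale c (\<phi> X)"
    and D': "\<And>Z. Z \<in> D' \<Longrightarrow> \<phi> Z \<in> D"
  shows "holomorphic_mat (\<lambda>Z. f (\<phi> Z)) D'"
  unfolding holomorphic_mat_def
proof
  fix Z assume "Z \<in> D'"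
  then obtain L where L: "(f has_derivative L) (at (\<phi> Z))" "\<And>c X. L (cscale c X) = c * L X"
    using holomorphic_mat_derivative[OF f D'] by blast
  have "(\<phi> has_derivative \<phi>) (at Z within D')"
    using \<phi>(1) by (simp add: linear_conv_bounded_linear bounded_linear_imp_has_derivative)
  then have "((\<lambda>Z. f (\<phi> Z)) has_derivative (\<lambda>h. L (\<phi> h))) (at Z within D')"
    using L(1) by (rule has_derivative_compose[unfolded comp_def])
  then show "\<exists>L. ((\<lambda>Z. f (\<phi> Z)) has_derivative L) (at Z within D') \<and> (\<forall>c X. L (\<chi> i j. c * X $ i $ j) = c * L X)"
    using L(2) \<phi>(2) unfolding cscale_def by (intro exI conjI) auto
qed

lemma holomorphic_mat_add:
  assumes "holomorphic_mat f D" "holomorphic_mat g D" "open D"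
  shows "holomorphic_mat (\<lambda>Z. f Z + g Z) D"
  unfolding holomorphic_mat_def
proof
  fix Z assume Z: "Z \<in> D"
  obtain L1 where L1: "(f has_derivative L1) (at Z)" "\<And>c X. L1 (cscale c X) = c * L1 X"
    using holomorphic_mat_derivative[OF assms(1,3) Z] by blast
  obtain L2 where L2: "(g has_derivative L2) (at Z)" "\<And>c X. L2 (cscale c X) = c * L2 X"
    using holomorphic_mat_derivative[OF assms(2,3) Z] by blast
  have "((\<lambda>Z. f Z + g Z) has_derivative (\<lambda>h. L1 h + L2 h)) (at Z within D)"
    using L1(1) L2(1) by (intro has_derivative_add) (auto intro: has_derivative_at_withinI)
  then show "\<exists>L. ((\<lambda>Z. f Z + g Z) has_derivative L) (at Z within D) \<and> (\<forall>c X. L (\<chi> i j. c * X $ i $ j) = c * L X)"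
    using L1(2) L2(2) unfolding cscale_def by (intro exI conjI) (auto simp: algebra_simps)
qed

lemma holomorphic_mat_cmult:
  assumes "holomorphic_mat f D" "open D"
  shows "holomorphic_mat (\<lambda>Z. k * f Z) D"
  unfolding holomorphic_mat_def
proof
  fix Z assume Z: "Z \<in> D"
  obtain L1 where L1: "(f has_derivative L1) (at Z)" "\<And>c X. L1 (cscale c X) = c * L1 X"
    using holomorphic_mat_derivative[OF assms(1,2) Z] by blast
  have "((\<lambda>Z. k * f Z) has_derivative (\<lambda>h. k * L1 h)) (at Z within D)"
    using L1(1) by (intro has_derivative_mult_right) (auto intro: has_derivative_at_withinI)
  then show "\<exists>L. ((\<lambda>Z. k * f Z) has_derivative L) (at Z within D) \<and> (\<forall>c X. L (\<chi> i j. c * X $ i $ j) = c * L X)"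
    using L1(2) unfolding cscale_def by (intro exI conjI) (auto simp: algebra_simps)
qed

text \<open>This is Cauchy's inequality on the complex line through \<open>Z\<close> in the direction \<open>H\<close>.\<close>

lemma holomorphic_mat_derivative_bound:
  fixes f :: "'n::finite cmat \<Rightarrow> complex"
  assumes f: "holomorphic_mat f D" "open D" and L: "(f has_derivative L) (at Z)" "\<And>c X. L (cscale c X) = c * L X"
    and r: "0 < r" "cball Z r \<subseteq> D" and B: "\<And>Y. Y \<in> cball Z r \<Longrightarrow> cmod (f Y) \<le> B"
  shows "cmod (L H) \<le> B / r * norm H"
proof (cases "H = 0")
  case True
  then have "L H = 0" using L(2)[of 0 H] by simp
  then show ?thesis using True by simp
next
  case False
  define s where "s = r / norm H"
  have s: "0 < s" using False r by (simp add: s_def)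
  let ?h = "\<lambda>t. f (Z + cscale t H)"
  have inb: "Z + cscale t H \<in> cball Z r" if "cmod t \<le> s" for t
    using that False r by (simp add: dist_norm norm_cscale s_def field_simps)
  have "((\<lambda>t. Z + cscale t H) has_derivative (\<lambda>h. cscale h H)) (at 0)"
    by (intro has_derivative_matrix_curve) (auto intro!: derivative_eq_intros)
  then have "(?h has_derivative (\<lambda>h. L (cscale h H))) (at 0)"
    using L(1) diff_chain_at[of "\<lambda>t. Z + cscale t H" _ 0 f L] by (simp add: comp_def)
  then have "(?h has_field_derivative L H) (at 0)"
  proof -
    have "(\<lambda>h. L (cscale h H)) = (*) (L H)" by (auto simp: L(2))
    with \<open>(?h has_derivative (\<lambda>h. L (cscale h H))) (at 0)\<close> show ?thesis
      by (simp add: has_field_derivative_def)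
  qed
  then have der: "deriv ?h 0 = L H" by (rule DERIV_imp_deriv)
  have hol: "?h holomorphic_on ball 0 s"
  proof (rule holomorphic_mat_curve[OF f])
    show "Z + cscale t H \<in> D" if "t \<in> ball 0 s" for t using that inb[of t] r by auto
  qed (auto intro!: holomorphic_intros)
  have cont: "continuous_on (cball 0 s) ?h"
  proof (rule continuous_on_compose2[OF holomorphic_mat_imp_continuous_on[OF f(1)]])
    show "continuous_on (cball 0 s) (\<lambda>t. Z + cscale t H)"
      unfolding cscale_def by (intro continuous_intros)
    show "(\<lambda>t. Z + cscale t H) ` cball 0 s \<subseteq> D" using inb r by fastforce
  qed
  have "cmod ((deriv ^^ 1) ?h 0) \<le> fact 1 * B / s ^ 1"
    using inb B by (intro Cauchy_inequality hol cont s) auto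
  then have "cmod (L H) \<le> B / s" by (simp add: der)
  also have "\<dots> = B / r * norm H" using False by (simp add: s_def)
  finally show ?thesis .
qed

text \<open>By Cauchy's inequality on complex lines the derivatives form a uniform Cauchy sequence on a smaller
ball, so the sequence may be differentiated term by term; complex linearity passes to the limit.\<close>

lemma holomorphic_mat_uniform_limit:
  fixes f :: "nat \<Rightarrow> 'n::finite cmat \<Rightarrow> complex"
  assumes D: "open D" and f: "\<And>n. holomorphic_mat (f n) D"
    and lim: "\<And>Z. Z \<in> D \<Longrightarrow> (\<lambda>n. f n Z) \<longlonglongrightarrow> g Z"
    and cauchy: "\<And>Z. Z \<in> D \<Longrightarrow> \<exists>r>0. cball Z r \<subseteq> D \<and>
      (\<forall>e>0. \<exists>N. \<forall>m\<ge>N. \<forall>n\<ge>N. \<forall>Y\<in>cball Z r. cmod (f m Y - f n Y) \<le> e)"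
  shows "holomorphic_mat g D"
  unfolding holomorphic_mat_def
proof
  fix Z assume Z: "Z \<in> D"
  obtain r where r: "0 < r" "cball Z r \<subseteq> D"
    and uc: "\<And>e. 0 < e \<Longrightarrow> \<exists>N. \<forall>m\<ge>N. \<forall>n\<ge>N. \<forall>Y\<in>cball Z r. cmod (f m Y - f n Y) \<le> e"
    using cauchy[OF Z] by blast
  have "\<forall>n. \<forall>Y. \<exists>L. Y \<in> D \<longrightarrow> (f n has_derivative L) (at Y) \<and> (\<forall>c X. L (cscale c X) = c * L X)"
    using holomorphic_mat_derivative[OF f D] by metis
  then obtain L where "\<forall>n. \<forall>Y. Y \<in> D \<longrightarrow> (f n has_derivative L n Y) (at Y) \<and> (\<forall>c X. L n Y (cscale c X) = c * L n Y X)"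
    by metis
  then have L: "(f n has_derivative L n Y) (at Y)" "L n Y (cscale c X) = c * L n Y X" if "Y \<in> D" for n Y c X
    using that by blast+
  have sub: "cball Y (r/2) \<subseteq> cball Z r" if "Y \<in> ball Z (r/2)" for Y
    using that by (intro cball_subset_cball_iff[THEN iffD2]) (auto simp: dist_commute)
  have YD: "Y \<in> D" if "Y \<in> ball Z (r/2)" for Y using that r by auto
  have diff: "cmod (L m Y H - L n Y H) \<le> e / (r/2) * norm H"
    if Y: "Y \<in> ball Z (r/2)" and le: "\<forall>Y\<in>cball Z r. cmod (f m Y - f n Y) \<le> e" for m n Y H e
  proof (rule holomorphic_mat_derivative_bound[where f = "\<lambda>Y. f m Y - f n Y" and Z = Y and L = "\<lambda>H. L m Y H - L n Y H"])
    have "holomorphic_mat (\<lambda>Y. f m Y + (-1) * f n Y) D"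
      by (intro holomorphic_mat_add holomorphic_mat_cmult f D)
    then show "holomorphic_mat (\<lambda>Y. f m Y - f n Y) D" by simp
    show "((\<lambda>Y. f m Y - f n Y) has_derivative (\<lambda>H. L m Y H - L n Y H)) (at Y)"
      using L(1)[OF YD[OF Y]] by (intro has_derivative_diff)
    show "L m Y (cscale c X) - L n Y (cscale c X) = c * (L m Y X - L n Y X)" for c X
      using L(2)[OF YD[OF Y]] by (simp add: algebra_simps)
    show "cball Y (r/2) \<subseteq> D" using sub[OF Y] r by blast
    show "\<And>Ya. Ya \<in> cball Y (r/2) \<Longrightarrow> cmod (f m Ya - f n Ya) \<le> e" using sub[OF Y] le by blast
  qed (use r D in auto)
  have conv: "\<exists>l. (\<lambda>n. L n Y H) \<longlonglongrightarrow> l" if Y: "Y \<in> ball Z (r/2)" for Y H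
    unfolding convergent_def[symmetric]
  proof (intro Cauchy_convergent CauchyI)
    fix e :: real assume e: "0 < e"
    define e' where "e' = e * (r/2) / (2 * (norm H + 1))"
    have "0 < norm H + 1" by (simp add: add_nonneg_pos)
    then have e': "0 < e'" using e r by (simp add: e'_def)
    obtain N where N: "\<forall>m\<ge>N. \<forall>n\<ge>N. \<forall>Y\<in>cball Z r. cmod (f m Y - f n Y) \<le> e'" using uc[OF e'] by blast
    have "e' / (r/2) * norm H < e"
    proof -
      have "e' / (r/2) * norm H = e / 2 * (norm H / (norm H + 1))"
        using r \<open>0 < norm H + 1\<close> unfolding e'_def by (simp add: divide_simps)
      also have "\<dots> \<le> e / 2 * 1" using e \<open>0 < norm H + 1\<close> by (intro mult_left_mono) auto
      finally show ?thesis using e by simp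
    qed
    then have "\<forall>m\<ge>N. \<forall>n\<ge>N. norm (L m Y H - L n Y H) < e"
      using diff[OF Y] N by (blast intro: le_less_trans)
    then show "\<exists>M. \<forall>m\<ge>M. \<forall>n\<ge>M. norm (L m Y H - L n Y H) < e" by blast
  qed
  then have "\<forall>Y H. \<exists>l. Y \<in> ball Z (r/2) \<longrightarrow> (\<lambda>n. L n Y H) \<longlonglongrightarrow> l" by blast
  then obtain L' where "\<forall>Y H. Y \<in> ball Z (r/2) \<longrightarrow> (\<lambda>n. L n Y H) \<longlonglongrightarrow> L' Y H" by metis
  then have L': "(\<lambda>n. L n Y H) \<longlonglongrightarrow> L' Y H" if "Y \<in> ball Z (r/2)" for Y H using that by blast
  have "\<exists>G. \<forall>Y\<in>ball Z (r/2). (\<lambda>n. f n Y) \<longlonglongrightarrow> G Y \<and> (G has_derivative L' Y) (at Y within ball Z (r/2))"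
  proof (rule has_derivative_sequence[where f' = L and ?x0.0 = Z and l = "g Z"])
    show "(f n has_derivative L n Y) (at Y within ball Z (r/2))" if "Y \<in> ball Z (r/2)" for n Y
      using L(1)[OF YD[OF that]] by (rule has_derivative_at_withinI)
    fix e :: real assume e: "0 < e"
    then have "0 < e * (r/2)" using r by simp
    from uc[OF this] obtain N where N: "\<forall>m\<ge>N. \<forall>n\<ge>N. \<forall>Y\<in>cball Z r. cmod (f m Y - f n Y) \<le> e * (r/2)" by blast
    have "norm (L n Y H - L' Y H) \<le> e * norm H" if n: "n \<ge> N" and Y: "Y \<in> ball Z (r/2)" for n Y H
    proof (rule tendsto_upperbound[where F = sequentially and f = "\<lambda>m. norm (L n Y H - L m Y H)"])
      show "(\<lambda>m. norm (L n Y H - L m Y H)) \<longlonglongrightarrow> norm (L n Y H - L' Y H)"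
        by (intro tendsto_intros L'[OF Y])
      have "norm (L n Y H - L m Y H) \<le> e * norm H" if "m \<ge> N" for m
        using diff[OF Y, of n m "e * (r/2)" H] N n that r by auto
      then show "\<forall>\<^sub>F m in sequentially. norm (L n Y H - L m Y H) \<le> e * norm H"
        unfolding eventually_sequentially by blast
    qed simp
    then show "\<forall>\<^sub>F n in sequentially. \<forall>Y\<in>ball Z (r/2). \<forall>H. norm (L n Y H - L' Y H) \<le> e * norm H"
      unfolding eventually_sequentially by blast
  qed (use r Z lim in auto)
  then obtain G where G: "\<And>Y. Y \<in> ball Z (r/2) \<Longrightarrow> (\<lambda>n. f n Y) \<longlonglongrightarrow> G Y"
    "\<And>Y. Y \<in> ball Z (r/2) \<Longrightarrow> (G has_derivative L' Y) (at Y within ball Z (r/2))" by blast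
  have Zb: "Z \<in> ball Z (r/2)" using r by simp
  have Gg: "G Y = g Y" if "Y \<in> ball Z (r/2)" for Y
    using LIMSEQ_unique[OF G(1)[OF that] lim[OF YD[OF that]]] .
  have "(g has_derivative L' Z) (at Z within ball Z (r/2))"
    by (rule has_derivative_transform[OF Zb _ G(2)[OF Zb]]) (simp add: Gg)
  then have der: "(g has_derivative L' Z) (at Z within D)"
    unfolding at_within_open[OF Zb open_ball] by (rule has_derivative_at_withinI)
  have "L' Z (cscale c X) = c * L' Z X" for c X
  proof (rule LIMSEQ_unique)
    show "(\<lambda>n. L n Z (cscale c X)) \<longlonglongrightarrow> L' Z (cscale c X)" by (rule L'[OF Zb])
    show "(\<lambda>n. L n Z (cscale c X)) \<longlonglongrightarrow> c * L' Z X"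
      unfolding L(2)[OF Z] by (intro tendsto_intros L'[OF Zb])
  qed
  with der show "\<exists>L. (g has_derivative L) (at Z within D) \<and> (\<forall>c X. L (\<chi> i j. c * X $ i $ j) = c * L X)"
    unfolding cscale_def by blast
qed

section \<open>The Bergman space\<close>

context bergman_setting
begin

abbreviation L2 :: "('n cmat \<Rightarrow> complex) set" where "L2 \<equiv> L2_space lam"
abbreviation A2 :: "('n cmat \<Rightarrow> complex) set" where "A2 \<equiv> bergman_space lam"
abbreviation ip :: "('n cmat \<Rightarrow> complex) \<Rightarrow> ('n cmat \<Rightarrow> complex) \<Rightarrow> complex" where
  "ip \<equiv> L2_inner lam"

definition sqn :: "('n cmat \<Rightarrow> complex) \<Rightarrow> real" where
  "sqn f = (LINT Z|\<mu>. (cmod (f Z))\<^sup>2)"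

lemma L2_norm_sqn: "L2_norm lam f = sqrt (sqn f)"
  by (simp add: L2_norm_def sqn_def)

lemma sqn_nonneg: "0 \<le> sqn f"
  by (simp add: sqn_def)

lemma L2_iff: "f \<in> L2 \<longleftrightarrow> f \<in> borel_measurable \<mu> \<and> integrable \<mu> (\<lambda>Z. (cmod (f Z))\<^sup>2)"
  by (simp add: L2_space_def)

lemma L2D: assumes "f \<in> L2" shows "f \<in> borel_measurable \<mu>" "integrable \<mu> (\<lambda>Z. (cmod (f Z))\<^sup>2)"
  using assms by (auto simp: L2_iff)

lemma L2_dominated:
  assumes f: "f \<in> borel_measurable \<mu>" and g: "integrable \<mu> g" and le: "AE Z in \<mu>. (cmod (f Z))\<^sup>2 \<le> g Z"
  shows "f \<in> L2"
proof -
  have "integrable \<mu> (\<lambda>Z. (cmod (f Z))\<^sup>2)"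
  proof (rule Bochner_Integration.integrable_bound[OF g])
    show "(\<lambda>Z. (cmod (f Z))\<^sup>2) \<in> borel_measurable \<mu>" using f by measurable
    show "AE Z in \<mu>. norm ((cmod (f Z))\<^sup>2) \<le> norm (g Z)" using le by eventually_elim simp
  qed
  with f show ?thesis by (simp add: L2_iff)
qed

lemma cmod_mult_le_squares: "cmod (a * b) \<le> (cmod a)\<^sup>2 + (cmod b)\<^sup>2"
proof -
  have "0 \<le> (cmod a - cmod b)\<^sup>2" by simp
  then have "2 * (cmod a * cmod b) \<le> (cmod a)\<^sup>2 + (cmod b)\<^sup>2" by (simp add: power2_diff)
  moreover have "0 \<le> cmod a * cmod b" by simp
  ultimately show ?thesis unfolding norm_mult by linarith
qed

lemma cmod_add_square_le: "(cmod (a + b))\<^sup>2 \<le> 2 * (cmod a)\<^sup>2 + 2 * (cmod b)\<^sup>2"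
proof -
  have "(cmod (a + b))\<^sup>2 \<le> (cmod a + cmod b)\<^sup>2" by (intro power_mono norm_triangle_ineq) simp
  also have "\<dots> \<le> 2 * (cmod a)\<^sup>2 + 2 * (cmod b)\<^sup>2"
    using zero_le_power2[of "cmod a - cmod b"] by (simp add: power2_sum power2_diff)
  finally show ?thesis .
qed

lemma integrable_mult_L2:
  assumes f: "f \<in> L2" and g: "g \<in> L2"
  shows "integrable \<mu> (\<lambda>Z. f Z * g Z)"
proof (rule Bochner_Integration.integrable_bound)
  show "integrable \<mu> (\<lambda>Z. (cmod (f Z))\<^sup>2 + (cmod (g Z))\<^sup>2)"
    by (intro Bochner_Integration.integrable_add L2D assms)
  show "(\<lambda>Z. f Z * g Z) \<in> borel_measurable \<mu>"
    by (intro borel_measurable_times L2D assms)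
  show "AE Z in \<mu>. norm (f Z * g Z) \<le> norm ((cmod (f Z))\<^sup>2 + (cmod (g Z))\<^sup>2)"
    using cmod_mult_le_squares by (intro AE_I2) (simp add: order_trans)
qed

lemma borel_measurable_cnj: "f \<in> borel_measurable M \<Longrightarrow> (\<lambda>Z. cnj (f Z)) \<in> borel_measurable M"
  by (rule measurable_compose) (auto intro!: borel_measurable_continuous_onI continuous_intros)

lemma cnj_L2: "f \<in> L2 \<Longrightarrow> (\<lambda>Z. cnj (f Z)) \<in> L2"
  unfolding L2_iff by (simp add: borel_measurable_cnj)

lemma integrable_ip: "f \<in> L2 \<Longrightarrow> g \<in> L2 \<Longrightarrow> integrable \<mu> (\<lambda>Z. f Z * cnj (g Z))"
  by (intro integrable_mult_L2 cnj_L2)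

lemma L2_add: assumes f: "f \<in> L2" and g: "g \<in> L2" shows "(\<lambda>Z. f Z + g Z) \<in> L2"
proof (rule L2_dominated)
  show "integrable \<mu> (\<lambda>Z. 2 * (cmod (f Z))\<^sup>2 + 2 * (cmod (g Z))\<^sup>2)"
    by (intro Bochner_Integration.integrable_add integrable_mult_right L2D assms)
  show "(\<lambda>Z. f Z + g Z) \<in> borel_measurable \<mu>" by (intro borel_measurable_add L2D assms)
qed (intro AE_I2 cmod_add_square_le)

lemma L2_cmult: assumes f: "f \<in> L2" shows "(\<lambda>Z. c * f Z) \<in> L2"
proof (rule L2_dominated)
  show "integrable \<mu> (\<lambda>Z. (cmod c)\<^sup>2 * (cmod (f Z))\<^sup>2)"
    by (intro integrable_mult_right L2D assms)
  show "(\<lambda>Z. c * f Z) \<in> borel_measurable \<mu>" by (intro borel_measurable_times borel_measurable_const L2D assms)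
qed (simp add: norm_mult power_mult_distrib)

lemma L2_diff: assumes "f \<in> L2" and "g \<in> L2" shows "(\<lambda>Z. f Z - g Z) \<in> L2"
  using L2_add[OF assms(1) L2_cmult[OF assms(2), of "-1"]] by simp

lemma L2_imp_integrable: assumes f: "f \<in> L2" shows "integrable \<mu> f"
proof -
  have "(\<lambda>Z. 1) \<in> L2" by (simp add: L2_iff)
  from integrable_mult_L2[OF f this] show ?thesis by simp
qed

lemma bounded_L2:
  assumes f: "f \<in> borel_measurable \<mu>" and B: "AE Z in \<mu>. cmod (f Z) \<le> B"
  shows "f \<in> L2"
proof (rule L2_dominated[OF f])
  show "integrable \<mu> (\<lambda>Z. B\<^sup>2)" by simp
  show "AE Z in \<mu>. (cmod (f Z))\<^sup>2 \<le> B\<^sup>2" using B by eventually_elim (simp add: power_mono)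
qed

lemma ip_self: "ip f f = of_real (sqn f)"
  unfolding L2_inner_def sqn_def complex_norm_square[symmetric] of_real_power[symmetric]
  by (rule integral_complex_of_real)

lemma ip_add_left: "f \<in> L2 \<Longrightarrow> g \<in> L2 \<Longrightarrow> h \<in> L2 \<Longrightarrow> ip (\<lambda>Z. f Z + g Z) h = ip f h + ip g h"
  unfolding L2_inner_def by (simp add: distrib_right integrable_ip)

lemma ip_diff_left: "f \<in> L2 \<Longrightarrow> g \<in> L2 \<Longrightarrow> h \<in> L2 \<Longrightarrow> ip (\<lambda>Z. f Z - g Z) h = ip f h - ip g h"
  unfolding L2_inner_def by (simp add: left_diff_distrib integrable_ip)

lemma ip_cmult_left: "ip (\<lambda>Z. c * f Z) h = c * ip f h"
  unfolding L2_inner_def by (simp add: mult.assoc)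

lemma ip_cnj: "cnj (ip f g) = ip g f"
  unfolding L2_inner_def by (simp add: mult.commute flip: Bochner_Integration.integral_cnj)

lemma sqn_diff_cmult:
  assumes f: "f \<in> L2" and h: "h \<in> L2"
  shows "sqn (\<lambda>Z. f Z - c * h Z) = sqn f - 2 * Re (cnj c * ip f h) + (cmod c)\<^sup>2 * sqn h"
proof -
  have ch: "(\<lambda>Z. c * h Z) \<in> L2" by (rule L2_cmult[OF h])
  have k: "(\<lambda>Z. f Z - c * h Z) \<in> L2" by (rule L2_diff[OF f ch])
  have cr: "ip g (\<lambda>Z. f Z - c * h Z) = ip g f - cnj c * ip g h" if g: "g \<in> L2" for g
    using ip_diff_left[OF f ch g] ip_cnj[of "\<lambda>Z. f Z - c * h Z" g] ip_cnj[of f g] ip_cnj[of h g]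
    by (simp add: ip_cmult_left flip: ip_cnj[of g])
  have "of_real (sqn (\<lambda>Z. f Z - c * h Z)) = ip (\<lambda>Z. f Z - c * h Z) (\<lambda>Z. f Z - c * h Z)"
    by (rule ip_self[symmetric])
  also have "\<dots> = ip f f - cnj c * ip f h - c * (ip h f - cnj c * ip h h)"
    unfolding ip_diff_left[OF f ch k] ip_cmult_left cr[OF f] cr[OF h] ..
  also have "\<dots> = of_real (sqn f) - (cnj c * ip f h + cnj (cnj c * ip f h)) + of_real ((cmod c)\<^sup>2 * sqn h)"
    unfolding ip_self using ip_cnj[of f h]
    by (simp add: algebra_simps complex_norm_square del: of_real_power)
  also have "cnj c * ip f h + cnj (cnj c * ip f h) = of_real (2 * Re (cnj c * ip f h))"
    by (rule complex_add_cnj)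
  finally have "complex_of_real (sqn (\<lambda>Z. f Z - c * h Z)) = of_real (sqn f - 2 * Re (cnj c * ip f h) + (cmod c)\<^sup>2 * sqn h)"
    by (simp only: of_real_add of_real_diff)
  then show ?thesis unfolding of_real_eq_iff .
qed

text \<open>Otherwise subtracting a small positive multiple of \<open>\<langle>f,h\<rangle> h\<close> from \<open>f\<close> would decrease the norm.\<close>

lemma ip_zero_of_minimal:
  assumes f: "f \<in> L2" and h: "h \<in> L2" and min: "\<And>c. sqn f \<le> sqn (\<lambda>Z. f Z - c * h Z)"
  shows "ip f h = 0"
proof (rule ccontr)
  assume ne: "ip f h \<noteq> 0"
  define n where "n = sqn h"
  define p where "p = (cmod (ip f h))\<^sup>2"
  have p: "0 < p" using ne by (simp add: p_def)
  have n: "0 \<le> n" by (simp add: n_def sqn_nonneg)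
  \<comment> \<open>With this step the quadratic term \<open>s\<^sup>2 p n\<close> stays below the linear gain \<open>2 s p\<close>.\<close>
  define s where "s = 1 / (n + 1)"
  have s: "0 < s" using n by (simp add: s_def)
  have "sqn f \<le> sqn f - 2 * Re (cnj (of_real s * ip f h) * ip f h) + (cmod (of_real s * ip f h))\<^sup>2 * n"
    using min[of "of_real s * ip f h"] unfolding sqn_diff_cmult[OF f h] n_def .
  moreover have "Re (cnj (of_real s * ip f h) * ip f h) = s * p"
    unfolding p_def cmod_power2 by (simp add: power2_eq_square algebra_simps)
  moreover have "(cmod (of_real s * ip f h))\<^sup>2 * n = s\<^sup>2 * p * n"
    using s by (simp add: p_def norm_mult power_mult_distrib)
  ultimately have "2 * (s * p) \<le> s\<^sup>2 * p * n" by linarith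
  then have "2 \<le> s * n" using s p by (simp add: power2_eq_square mult.assoc mult_le_cancel_left mult.left_commute[of _ p])
  moreover have "s * n < 1" using n by (simp add: s_def)
  ultimately show False by linarith
qed

lemma Cauchy_Schwarz:
  assumes f: "f \<in> L2" and h: "h \<in> L2"
  shows "(cmod (ip f h))\<^sup>2 \<le> sqn f * sqn h"
proof (cases "sqn h = 0")
  case True
  have "ip h f = 0"
  proof (rule ip_zero_of_minimal[OF h f])
    show "sqn h \<le> sqn (\<lambda>Z. h Z - c * f Z)" for c unfolding True by (rule sqn_nonneg)
  qed
  then show ?thesis using ip_cnj[of h f] True by simp
next
  case False
  then have n: "0 < sqn h" using sqn_nonneg[of h] by linarith
  let ?c = "ip f h / of_real (sqn h)"
  have "0 \<le> sqn (\<lambda>Z. f Z - ?c * h Z)" by (rule sqn_nonneg)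
  also have "\<dots> = sqn f - 2 * Re (cnj ?c * ip f h) + (cmod ?c)\<^sup>2 * sqn h" by (rule sqn_diff_cmult[OF f h])
  also have "Re (cnj ?c * ip f h) = (cmod (ip f h))\<^sup>2 / sqn h"
    unfolding cmod_power2 by (simp add: power2_eq_square add_divide_distrib)
  also have "(cmod ?c)\<^sup>2 * sqn h = (cmod (ip f h))\<^sup>2 / sqn h"
    using n by (simp add: norm_divide power_divide power2_eq_square)
  finally have "(cmod (ip f h))\<^sup>2 / sqn h \<le> sqn f" by simp
  then show ?thesis using n by (simp add: divide_le_eq)
qed

lemma A2_iff: "f \<in> A2 \<longleftrightarrow> f \<in> L2 \<and> holomorphic_mat f D \<and> (\<forall>Z. Z \<notin> D \<longrightarrow> f Z = 0)"
  by (simp add: bergman_space_def)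

lemma A2D:
  assumes "f \<in> A2"
  shows "f \<in> L2" "holomorphic_mat f D" "Z \<notin> D \<Longrightarrow> f Z = 0" "continuous_on D f"
  using assms by (auto simp: A2_iff intro: holomorphic_mat_imp_continuous_on)

lemma borel_of_continuous_D:
  assumes "continuous_on D f" "\<And>Z. Z \<notin> D \<Longrightarrow> f Z = 0"
  shows "(f :: 'n cmat \<Rightarrow> complex) \<in> borel_measurable borel"
proof -
  have "(\<lambda>Z. indicator D Z *\<^sub>R f Z) \<in> borel_measurable borel"
    by (rule borel_measurable_continuous_on_indicator[OF cartan_domain_borel assms(1)])
  moreover have "(\<lambda>Z. indicator D Z *\<^sub>R f Z) = f" using assms(2) by (auto simp: indicator_def)
  ultimately show ?thesis by simp
qed

lemma A2_borel: "f \<in> A2 \<Longrightarrow> f \<in> borel_measurable borel"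
  by (intro borel_of_continuous_D A2D)

lemma A2_add: "f \<in> A2 \<Longrightarrow> g \<in> A2 \<Longrightarrow> (\<lambda>Z. f Z + g Z) \<in> A2"
  unfolding A2_iff by (auto intro: L2_add holomorphic_mat_add open_cartan_domain)

lemma A2_cmult: "f \<in> A2 \<Longrightarrow> (\<lambda>Z. c * f Z) \<in> A2"
  unfolding A2_iff by (auto intro: L2_cmult holomorphic_mat_cmult open_cartan_domain)

lemma A2_diff: "f \<in> A2 \<Longrightarrow> g \<in> A2 \<Longrightarrow> (\<lambda>Z. f Z - g Z) \<in> A2"
  using A2_add[OF _ A2_cmult[of g "-1"], of f] by simp

lemma A2_zero: "(\<lambda>Z. 0) \<in> A2"
  unfolding A2_iff L2_iff by (auto simp: holomorphic_mat_def intro!: exI[of _ "\<lambda>_. 0"])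

lemma A2_bounded:
  assumes "continuous_on D f" "holomorphic_mat f D" "\<And>Z. Z \<notin> D \<Longrightarrow> f Z = 0" "\<And>Z. Z \<in> D \<Longrightarrow> cmod (f Z) \<le> B"
  shows "f \<in> A2"
  unfolding A2_iff using assms
  by (auto intro!: bounded_L2 AE_I2 borel_measurable_\<mu> borel_of_continuous_D)

lemma A2_symmetry:
  assumes f: "f \<in> A2" and \<phi>: "is_symmetry \<phi>" "\<And>c X. \<phi> (cscale c X) = cscale c (\<phi> X)"
  shows "(\<lambda>Z. f (\<phi> Z)) \<in> A2"
proof -
  have [measurable]: "\<phi> \<in> \<mu> \<rightarrow>\<^sub>M \<mu>" by (rule symmetry_measurable[OF \<phi>(1)])
  have lin: "linear \<phi>" and D: "\<phi> Z \<in> D \<longleftrightarrow> Z \<in> D" for Z using \<phi>(1) by (auto simp: is_symmetry_def)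
  have "(\<lambda>Z. f (\<phi> Z)) \<in> L2"
    using L2D[OF A2D(1)[OF f]] integral_symmetry(2)[OF \<phi>(1), of "\<lambda>Z. (cmod (f Z))\<^sup>2"]
    unfolding L2_iff by (auto intro: measurable_compose[OF symmetry_measurable[OF \<phi>(1)]])
  moreover have "holomorphic_mat (\<lambda>Z. f (\<phi> Z)) D"
    using A2D(2)[OF f] open_cartan_domain lin \<phi>(2) by (rule holomorphic_mat_linear_compose) (simp add: D)
  ultimately show ?thesis using A2D(3)[OF f] D by (auto simp: A2_iff)
qed

lemma ip_symmetry:
  assumes f: "f \<in> L2" and g: "g \<in> L2" and \<phi>: "is_symmetry \<phi>"
  shows "ip (\<lambda>Z. f (\<phi> Z)) (\<lambda>Z. g (\<phi> Z)) = ip f g"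
  unfolding L2_inner_def
  by (rule integral_symmetry(1)[OF \<phi>]) (intro borel_measurable_times borel_measurable_cnj L2D f g)

section \<open>Point evaluations and the orthogonal projection\<close>

text \<open>Rotating the ball by a scalar of modulus one does not change the integral.  Averaging over all
rotations first, the mean value property on the complex line through \<open>Z\<close> and \<open>Z + Y\<close> replaces
\<open>f (Z + Y)\<close> by \<open>f Z\<close>.\<close>

lemma mean_value_ball:
  assumes f: "f \<in> A2" and r: "0 < r" "cball Z r \<subseteq> D"
  shows "(LINT Y|lborel. indicator (ball Z r) Y *\<^sub>R f Y) = measure lborel (ball Z r) *\<^sub>R f Z"
proof -
  let ?B = "ball (0 :: 'n cmat) r"
  have [measurable]: "f \<in> borel_measurable borel" by (rule A2_borel[OF f])
  have inD: "Z + cscale c Y \<in> cball Z r" if "Y \<in> ?B" "cmod c \<le> 1" for c Y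
    using that mult_mono[of "cmod c" 1 "norm Y" r] by (simp add: dist_norm norm_cscale)
  have "compact (f ` cball Z r)"
    using continuous_on_subset[OF A2D(4)[OF f] r(2)] by (rule compact_continuous_image) simp
  then have "bounded (f ` cball Z r)" by (rule compact_imp_bounded)
  then obtain B where "\<forall>y\<in>f ` cball Z r. norm y \<le> B" unfolding bounded_iff by blast
  then have B: "\<And>Y. Y \<in> cball Z r \<Longrightarrow> cmod (f Y) \<le> B" by simp
  have cont: "continuous_on UNIV (\<lambda>p::'n cmat \<times> real. Z + cscale (circ (snd p)) (fst p))"
    unfolding cscale_def by (intro continuous_intros continuous_on_compose2[OF continuous_on_circ[of UNIV]]) auto
  have mp [measurable]: "(\<lambda>p::'n cmat \<times> real. Z + cscale (circ (snd p)) (fst p)) \<in> borel_measurable borel"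
    by (rule borel_measurable_continuous_onI[OF cont])
  interpret U: finite_measure unit_interval by (rule finite_measure_unit_interval)
  interpret P: pair_sigma_finite lborel unit_interval
    by (simp add: pair_sigma_finite_def sigma_finite_lborel U.sigma_finite_measure_axioms)
  let ?F = "\<lambda>Y t. indicator ?B Y *\<^sub>R f (Z + cscale (circ t) Y)"
  have idm: "(\<lambda>p. p) \<in> (lborel \<Otimes>\<^sub>M unit_interval) \<rightarrow>\<^sub>M (borel :: ('n cmat \<times> real) measure)"
  proof -
    have "(\<lambda>p. (fst p, snd p)) \<in> (lborel \<Otimes>\<^sub>M unit_interval) \<rightarrow>\<^sub>M (borel \<Otimes>\<^sub>M borel :: ('n cmat \<times> real) measure)"
      by (intro measurable_Pair measurable_compose[OF measurable_fst] measurable_compose[OF measurable_snd])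
        (auto intro!: borel_measurable_unit_interval)
    then show ?thesis by (simp add: borel_prod)
  qed
  have meas: "(\<lambda>p. ?F (fst p) (snd p)) \<in> borel_measurable (lborel \<Otimes>\<^sub>M unit_interval)"
  proof (rule measurable_compose[OF idm])
    show "(\<lambda>p::'n cmat \<times> real. ?F (fst p) (snd p)) \<in> borel_measurable borel"
      by (intro borel_measurable_scaleR borel_measurable_indicator' measurable_compose[OF mp]) 
         (auto simp flip: borel_prod)
  qed
  have int: "integrable (lborel \<Otimes>\<^sub>M unit_interval) (case_prod ?F)"
  proof (rule integrableI_bounded_set[where A = "?B \<times> {0..1}" and B = B])
    show "?B \<times> {0..1} \<in> sets (lborel \<Otimes>\<^sub>M unit_interval)"
      by (intro pair_measureI) (auto simp: unit_interval_def sets_restrict_space)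
    show "case_prod ?F \<in> borel_measurable (lborel \<Otimes>\<^sub>M unit_interval)"
      using meas by (simp add: case_prod_beta')
    have "emeasure (lborel \<Otimes>\<^sub>M unit_interval) (?B \<times> {0..1}) = emeasure lborel ?B * emeasure unit_interval {0..1}"
      by (intro U.emeasure_pair_measure_Times) (auto simp: unit_interval_def sets_restrict_space)
    also have "\<dots> < \<infinity>"
      using emeasure_unit_interval emeasure_lborel_ball_finite[of "0 :: 'n cmat" r] by simp
    finally show "emeasure (lborel \<Otimes>\<^sub>M unit_interval) (?B \<times> {0..1}) < \<infinity>" .
    show "AE p in lborel \<Otimes>\<^sub>M unit_interval. p \<in> ?B \<times> {0..1} \<longrightarrow> norm (case p of (Y, t) \<Rightarrow> ?F Y t) \<le> B"
      using B inD by (intro AE_I2) auto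
    show "AE p in lborel \<Otimes>\<^sub>M unit_interval. p \<notin> ?B \<times> {0..1} \<longrightarrow> (case p of (Y, t) \<Rightarrow> ?F Y t) = 0"
      by (intro AE_I2) (auto simp: space_pair_measure indicator_def split: if_splits)
  qed
  have rot: "(LINT Y|lborel. ?F Y t) = (LINT Y|lborel. indicator (ball Z r) Y *\<^sub>R f Y)" for t
  proof -
    have iso: "distr lborel borel (cscale (circ t)) = (lborel :: 'n cmat measure)"
      by (rule distr_lborel_linear_isometry[OF linear_cscale]) (simp add: norm_cscale)
    have [measurable]: "cscale (circ t) \<in> borel_measurable (borel :: 'n cmat measure)"
      unfolding cscale_def[abs_def] by (intro borel_measurable_continuous_onI continuous_intros)
    define G where "G Y = indicator (ball Z r) Y *\<^sub>R f Y" for Y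
    have Gb: "G \<in> borel_measurable borel"
      unfolding G_def[abs_def] by (intro borel_measurable_scaleR borel_measurable_indicator) auto
    have Gt: "(\<lambda>Y. G (Z + Y)) \<in> borel_measurable borel"
      by (rule measurable_compose[OF _ Gb]) simp
    have "?F Y t = G (Z + cscale (circ t) Y)" for Y
      by (auto simp: G_def indicator_def dist_norm norm_cscale)
    then have "(LINT Y|lborel. ?F Y t) = (LINT Y|lborel. G (Z + cscale (circ t) Y))" by (simp only:)
    also have "\<dots> = (LINT Y|distr lborel borel (cscale (circ t)). G (Z + Y))"
      by (rule integral_distr[symmetric, OF _ Gt]) simp
    also have "\<dots> = (LINT Y|lborel. G (Z + Y))" unfolding iso ..
    also have "\<dots> = (LINT Y|distr lborel borel ((+) Z). G Y)"
      by (rule integral_distr[symmetric, OF _ Gb]) simp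
    finally show ?thesis unfolding lborel_distr_plus G_def .
  qed
  have mean: "(LINT t|unit_interval. ?F Y t) = indicator ?B Y *\<^sub>R f Z" for Y
  proof (cases "Y \<in> ?B")
    case True
    define S where "S = (\<lambda>c. Z + cscale c Y) -` D"
    have "open S" unfolding S_def
      unfolding cscale_def by (intro open_vimage open_cartan_domain continuous_intros)
    moreover have "cball 0 1 \<subseteq> S"
    proof
      fix c :: complex assume "c \<in> cball 0 1"
      then have "Z + cscale c Y \<in> cball Z r" by (intro inD[OF True]) simp
      then show "c \<in> S" using r(2) unfolding S_def by blast
    qed
    moreover have "(\<lambda>c. f (Z + cscale c Y)) holomorphic_on S"
    proof (rule holomorphic_mat_curve[OF A2D(2)[OF f] open_cartan_domain \<open>open S\<close>])
      show "(\<lambda>c. (Z + cscale c Y) $ i $ j) holomorphic_on S" for i j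
        unfolding vector_add_component cscale_nth by (intro holomorphic_intros)
    qed (simp add: S_def)
    ultimately have "(LINT t|unit_interval. f (Z + cscale (circ t) Y)) = f (Z + cscale 0 Y)"
      by (rule mean_value_circ)
    then show ?thesis using True by simp
  qed simp
  have "(LINT Y|lborel. indicator (ball Z r) Y *\<^sub>R f Y) = (LINT t|unit_interval. (LINT Y|lborel. ?F Y t))"
    unfolding rot using emeasure_unit_interval by (simp add: measure_def)
  also have "\<dots> = (LINT Y|lborel. (LINT t|unit_interval. ?F Y t))"
    by (rule P.Fubini_integral[OF int])
  also have "\<dots> = measure lborel ?B *\<^sub>R f Z"
    unfolding mean
  proof (subst integral_scaleR_left)
    show "integrable lborel (indicat_real ?B)"
      using emeasure_lborel_ball_finite[of "0 :: 'n cmat" r] by (intro integrable_real_indicator) simp_all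
  qed simp
  also have "measure lborel ?B = measure lborel (ball Z r)" using r by (simp add: content_ball)
  finally show ?thesis .
qed

text \<open>By the mean value property, \<open>f Y\<close> is the pairing of \<open>f\<close> with the normalised indicator of a ball
about \<open>Y\<close>, divided by the density of the measure.  The weight is bounded below on compact sets, hence
the common bound \<open>C\<close> for all points near \<open>Z\<close>.\<close>

lemma point_evaluation:
  assumes Z: "Z \<in> D"
  obtains r C where "0 < r" "0 \<le> C" "cball Z r \<subseteq> D"
    "\<And>Y. Y \<in> cball Z r \<Longrightarrow> \<exists>u\<in>L2. sqn u \<le> C \<and> (\<forall>f\<in>A2. f Y = ip f u)"
proof -
  obtain R where R: "0 < R" "cball Z R \<subseteq> D"
    using open_cartan_domain Z unfolding open_contains_cball by blast
  let ?r = "R / 2"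
  have r: "0 < ?r" using R by simp
  have cW: "continuous_on (cball Z R) W"
    unfolding bergman_weight_eq[abs_def]
  proof (intro continuous_on_powr continuous_on_wdet continuous_on_const ballI)
    fix X assume "X \<in> cball Z R"
    then have "X \<in> D" using R(2) by blast
    then show "wdet X \<noteq> 0" using wdet_pos[of X] by simp
  qed
  have ne: "cball Z R \<noteq> {}" using R by simp
  obtain X0 where X0: "X0 \<in> cball Z R" "\<And>X. X \<in> cball Z R \<Longrightarrow> W X0 \<le> W X"
    using continuous_attains_inf[OF compact_cball ne cW] by blast
  define m where "m = W X0"
  have "X0 \<in> D" using X0(1) R(2) by blast
  then have m: "0 < m" "\<And>X. X \<in> cball Z R \<Longrightarrow> m \<le> W X"
    using W_pos X0(2) by (simp_all add: m_def)
  define V where "V = measure lborel (ball Z ?r)"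
  have V: "0 < V" using r by (simp add: V_def)
  define B where "B = 1 / (V * (cst * m))"
  have B: "0 < B" using V m cst by (simp add: B_def)
  show ?thesis
  proof (rule that[of ?r "B\<^sup>2"])
    have "cball Z ?r \<subseteq> cball Z R" using R by (intro subset_cball) simp
    then show "cball Z ?r \<subseteq> D" using R(2) by blast
    fix Y assume Y: "Y \<in> cball Z ?r"
    have sub: "cball Y ?r \<subseteq> cball Z R"
    proof
      fix X assume "X \<in> cball Y ?r"
      then show "X \<in> cball Z R" using Y dist_triangle[of Z X Y] by (simp add: dist_commute)
    qed
    \<comment> \<open>Dividing by the density turns the integral of \<open>f\<close> over the ball into one against \<open>\<mu>\<close>.\<close>
    define u where "u X = indicator (ball Y ?r) X / (V * (cst * W X))" for X
    have u: "0 \<le> u X" "u X \<le> B" for X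
    proof -
      show "0 \<le> u X" using V density_nonneg[of X] by (simp add: u_def)
      show "u X \<le> B"
      proof (cases "X \<in> ball Y ?r")
        case True
        then have "X \<in> cball Y ?r" by auto
        then have "m \<le> W X" using m(2) sub by blast
        then have "1 / (V * (cst * W X)) \<le> 1 / (V * (cst * m))"
          using V m(1) cst(1) by (intro divide_left_mono mult_left_mono mult_pos_pos) auto
        then show ?thesis using True by (simp add: u_def B_def)
      qed (use B in \<open>simp add: u_def\<close>)
    qed
    let ?u = "\<lambda>X. complex_of_real (u X)"
    have uR: "u \<in> borel_measurable borel"
      unfolding u_def[abs_def]
      by (intro borel_measurable_divide borel_measurable_indicator borel_measurable_times
          borel_measurable_const W_borel) simp
    have ub: "?u \<in> borel_measurable borel"
      by (rule measurable_compose[OF uR borel_measurable_of_real])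
    have uL: "?u \<in> L2"
      by (rule bounded_L2[OF borel_measurable_\<mu>[OF ub], of B]) (use u in simp)
    have "sqn ?u \<le> B\<^sup>2"
    proof -
      have "sqn ?u \<le> (LINT X|\<mu>. B\<^sup>2)"
        unfolding sqn_def
      proof (rule integral_mono[OF L2D(2)[OF uL]])
        show "integrable \<mu> (\<lambda>X. B\<^sup>2)" by simp
        show "(cmod (?u X))\<^sup>2 \<le> B\<^sup>2" for X using u[of X] by (intro power_mono) simp_all
      qed
      also have "\<dots> = measure \<mu> D *\<^sub>R B\<^sup>2" unfolding lebesgue_integral_const space_\<mu> ..
      also have "measure \<mu> D = 1" unfolding measure_def cst(2)[folded \<mu>_eq] by simp
      finally show ?thesis by simp
    qed
    moreover have "f Y = ip f ?u" if f: "f \<in> A2" for f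
    proof -
      have fb: "f \<in> borel_measurable borel" by (rule A2_borel[OF f])
      have VY: "measure lborel (ball Y ?r) = V" unfolding V_def using r by (simp add: content_ball)
      have "ip f ?u = (LINT X|\<mu>. f X * ?u X)" unfolding L2_inner_def by simp
      also have "\<dots> = (LINT X|lborel. indicator D X *\<^sub>R ((cst * W X) *\<^sub>R (f X * ?u X)))"
        by (rule integral_\<mu>_borel(1)) (intro borel_measurable_times fb ub)
      also have "\<dots> = (LINT X|lborel. (1 / V) *\<^sub>R (indicator (ball Y ?r) X *\<^sub>R f X))"
      proof (intro Bochner_Integration.integral_cong refl)
        fix X
        show "indicator D X *\<^sub>R ((cst * W X) *\<^sub>R (f X * ?u X)) = (1 / V) *\<^sub>R (indicator (ball Y ?r) X *\<^sub>R f X)"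
        proof (cases "X \<in> ball Y ?r")
          case True
          then have "X \<in> cball Y ?r" by simp
          then have XD: "X \<in> D" using sub R(2) by blast
          then have "0 < cst * W X" using cst(1) W_pos by simp
          moreover have "w * (1 / (V * w)) = 1 / V" if "0 < w" for w
            using that V by (simp add: field_simps)
          moreover have "u X = 1 / (V * (cst * W X))" using True by (simp add: u_def)
          ultimately have wu: "(cst * W X) * u X = 1 / V" by (simp only:)
          have "(cst * W X) *\<^sub>R (f X * ?u X) = ((cst * W X) * u X) *\<^sub>R f X"
            by (simp only: scaleR_conv_of_real of_real_mult mult_ac)
          then have "(cst * W X) *\<^sub>R (f X * ?u X) = (1 / V) *\<^sub>R f X" unfolding wu .
          then show ?thesis using XD True by simp
        next
          case False then show ?thesis by (simp add: u_def)
        qed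
      qed
      also have "\<dots> = (1 / V) *\<^sub>R (LINT X|lborel. indicator (ball Y ?r) X *\<^sub>R f X)"
        by (rule integral_scaleR_right)
      also have "(LINT X|lborel. indicator (ball Y ?r) X *\<^sub>R f X) = V *\<^sub>R f Y"
        using mean_value_ball[OF f r order_trans[OF sub R(2)]] unfolding VY .
      finally have "ip f ?u = (1 / V) *\<^sub>R (V *\<^sub>R f Y)" .
      then show ?thesis using V by simp
    qed
    ultimately show "\<exists>u\<in>L2. sqn u \<le> B\<^sup>2 \<and> (\<forall>f\<in>A2. f Y = ip f u)" using uL by blast
  qed (use r in auto)
qed

lemma point_evaluation_bound:
  assumes Z: "Z \<in> D"
  obtains r C where "0 < r" "0 \<le> C" "cball Z r \<subseteq> D"
    "\<And>f Y. f \<in> A2 \<Longrightarrow> Y \<in> cball Z r \<Longrightarrow> (cmod (f Y))\<^sup>2 \<le> C * sqn f"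
proof -
  obtain r C where rC: "0 < r" "0 \<le> C" "cball Z r \<subseteq> D"
    and ev: "\<And>Y. Y \<in> cball Z r \<Longrightarrow> \<exists>u\<in>L2. sqn u \<le> C \<and> (\<forall>f\<in>A2. f Y = ip f u)"
    using point_evaluation[OF Z] by blast
  have "(cmod (f Y))\<^sup>2 \<le> C * sqn f" if f: "f \<in> A2" and Y: "Y \<in> cball Z r" for f Y
  proof -
    obtain u where u: "u \<in> L2" "sqn u \<le> C" "f Y = ip f u" using ev[OF Y] f by blast
    have "(cmod (f Y))\<^sup>2 \<le> sqn f * sqn u" unfolding u(3) by (intro Cauchy_Schwarz A2D(1) f u(1))
    also have "\<dots> \<le> sqn f * C" by (intro mult_left_mono u(2) sqn_nonneg)
    finally show ?thesis by (simp add: mult.commute)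
  qed
  with rC that show ?thesis by blast
qed

lemma A2_eq_zero: assumes f: "f \<in> A2" and 0: "sqn f = 0" shows "f = (\<lambda>Z. 0)"
proof
  fix Z show "f Z = 0"
  proof (cases "Z \<in> D")
    case True
    obtain r C where r: "0 < r" and "0 \<le> C" "cball Z r \<subseteq> D"
      and ev: "\<And>f Y. f \<in> A2 \<Longrightarrow> Y \<in> cball Z r \<Longrightarrow> (cmod (f Y))\<^sup>2 \<le> C * sqn f"
      using point_evaluation_bound[OF True] by blast
    have "(cmod (f Z))\<^sup>2 \<le> C * sqn f" using r by (intro ev f) simp
    then show ?thesis unfolding 0 by simp
  qed (use A2D(3)[OF f] in simp)
qed

lemma parallelogram:
  assumes f: "f \<in> L2" and g: "g \<in> L2"
  shows "sqn (\<lambda>Z. f Z + g Z) + sqn (\<lambda>Z. f Z - g Z) = 2 * sqn f + 2 * sqn g"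
  using sqn_diff_cmult[OF f g, of 1] sqn_diff_cmult[OF f g, of "-1"] by simp

lemma sqn_cmult: "sqn (\<lambda>Z. c * f Z) = (cmod c)\<^sup>2 * sqn f"
  by (simp add: sqn_def norm_mult power_mult_distrib)

text \<open>A minimising sequence is a Cauchy sequence by the parallelogram law.  Since point evaluations are
locally uniformly bounded it converges locally uniformly, to a holomorphic function, and Fatou's
lemma shows that this limit attains the infimum.\<close>

lemma ex_minimizer:
  assumes f: "f \<in> L2"
  shows "\<exists>g\<in>A2. \<forall>h\<in>A2. sqn (\<lambda>Z. f Z - g Z) \<le> sqn (\<lambda>Z. f Z - h Z)"
proof -
  let ?S = "(\<lambda>h. sqn (\<lambda>Z. f Z - h Z)) ` A2"
  define d where "d = Inf ?S"
  have ne: "?S \<noteq> {}" using A2_zero by blast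
  have bdd: "bdd_below ?S" by (rule bdd_belowI[of _ 0]) (auto simp: sqn_nonneg)
  have d_le: "d \<le> sqn (\<lambda>Z. f Z - h Z)" if "h \<in> A2" for h
    unfolding d_def by (rule cInf_lower[OF _ bdd]) (use that in blast)
  have "\<exists>h\<in>A2. sqn (\<lambda>Z. f Z - h Z) < d + 1 / real (Suc n)" for n
    using cInf_lessD[OF ne, of "d + 1 / real (Suc n)"] unfolding d_def by auto
  then obtain h where hA: "\<And>n. h n \<in> A2" and h: "\<And>n. sqn (\<lambda>Z. f Z - h n Z) < d + 1 / real (Suc n)"
    by metis
  have dist: "sqn (\<lambda>Z. h m Z - h n Z) \<le> 2 / real (Suc m) + 2 / real (Suc n)" for m n
  proof -
    have L: "(\<lambda>Z. f Z - h k Z) \<in> L2" for k by (intro L2_diff f A2D(1) hA)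
    have "sqn (\<lambda>Z. (f Z - h n Z) + (f Z - h m Z)) = 4 * sqn (\<lambda>Z. f Z - (1/2) * (h n Z + h m Z))"
      using sqn_cmult[of 2 "\<lambda>Z. f Z - (1/2) * (h n Z + h m Z)"] by (simp add: algebra_simps)
    moreover have "d \<le> sqn (\<lambda>Z. f Z - (1/2) * (h n Z + h m Z))"
      by (intro d_le A2_cmult A2_add hA)
    ultimately show ?thesis
      using parallelogram[OF L[of n] L[of m]] h[of m] h[of n] by (simp add: algebra_simps)
  qed
  have uc: "\<exists>r>0. cball Z r \<subseteq> D \<and> (\<forall>e>0. \<exists>N. \<forall>m\<ge>N. \<forall>n\<ge>N. \<forall>Y\<in>cball Z r. cmod (h m Y - h n Y) \<le> e)"
    if Z: "Z \<in> D" for Z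
  proof -
    obtain r C where rC: "0 < r" "0 \<le> C" "cball Z r \<subseteq> D"
      and ev: "\<And>f Y. f \<in> A2 \<Longrightarrow> Y \<in> cball Z r \<Longrightarrow> (cmod (f Y))\<^sup>2 \<le> C * sqn f"
      using point_evaluation_bound[OF Z] by blast
    have "\<exists>N. \<forall>m\<ge>N. \<forall>n\<ge>N. \<forall>Y\<in>cball Z r. cmod (h m Y - h n Y) \<le> e" if e: "0 < e" for e
    proof -
      obtain N where N: "4 * C / e\<^sup>2 < real N" using reals_Archimedean2 by blast
      have "cmod (h m Y - h n Y) \<le> e" if mn: "m \<ge> N" "n \<ge> N" and Y: "Y \<in> cball Z r" for m n Y
      proof -
        have inv: "1 / real (Suc k) \<le> 1 / real (Suc N)" if "k \<ge> N" for k using that by (simp add: frac_le)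
        have "(cmod (h m Y - h n Y))\<^sup>2 \<le> C * sqn (\<lambda>Z. h m Z - h n Z)"
          by (rule ev[OF A2_diff[OF hA hA] Y])
        also have "\<dots> \<le> C * (4 / real (Suc N))"
          using dist[of m n] inv[OF mn(1)] inv[OF mn(2)] rC(2) by (intro mult_left_mono) auto
        also have "\<dots> \<le> e\<^sup>2"
        proof -
          have "4 * C / e\<^sup>2 \<le> real (Suc N)" using N by simp
          then have "4 * C \<le> real (Suc N) * e\<^sup>2" using e by (simp add: pos_divide_le_eq)
          then show ?thesis by (simp add: pos_divide_le_eq mult.commute)
        qed
        finally show ?thesis using e by (simp add: power2_le_iff_abs_le)
      qed
      then show ?thesis by blast
    qed
    with rC show ?thesis by blast
  qed
  have "\<exists>l. (\<lambda>n. h n Z) \<longlonglongrightarrow> l" for Z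
  proof (cases "Z \<in> D")
    case True
    then obtain r where r: "0 < r" and e: "\<And>e. 0 < e \<Longrightarrow> \<exists>N. \<forall>m\<ge>N. \<forall>n\<ge>N. \<forall>Y\<in>cball Z r. cmod (h m Y - h n Y) \<le> e"
      using uc by blast
    show ?thesis unfolding convergent_def[symmetric]
    proof (intro Cauchy_convergent CauchyI)
      fix e :: real assume "0 < e"
      then obtain N where "\<forall>m\<ge>N. \<forall>n\<ge>N. \<forall>Y\<in>cball Z r. cmod (h m Y - h n Y) \<le> e/2" using e[of "e/2"] by auto
      then have "\<forall>m\<ge>N. \<forall>n\<ge>N. norm (h m Z - h n Z) \<le> e / 2" using r by auto
      moreover have "e / 2 < e" using \<open>0 < e\<close> by simp
      ultimately have "\<forall>m\<ge>N. \<forall>n\<ge>N. norm (h m Z - h n Z) < e" by (blast intro: le_less_trans)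
      then show "\<exists>M. \<forall>m\<ge>M. \<forall>n\<ge>M. norm (h m Z - h n Z) < e" by blast
    qed
  next
    case False
    then have "(\<lambda>n. h n Z) \<longlonglongrightarrow> 0" using A2D(3)[OF hA] by simp
    then show ?thesis by blast
  qed
  then obtain g where g: "\<And>Z. (\<lambda>n. h n Z) \<longlonglongrightarrow> g Z" by metis
  have g0: "g Z = 0" if "Z \<notin> D" for Z
  proof (rule LIMSEQ_unique[OF g])
    show "(\<lambda>n. h n Z) \<longlonglongrightarrow> 0" using A2D(3)[OF hA that] by simp
  qed
  have hol: "holomorphic_mat g D"
    by (rule holomorphic_mat_uniform_limit[OF open_cartan_domain A2D(2)[OF hA] g uc])
  have gb: "g \<in> borel_measurable \<mu>"
    using hol g0 by (intro borel_measurable_\<mu> borel_of_continuous_D holomorphic_mat_imp_continuous_on)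
  have fm: "f \<in> borel_measurable \<mu>" by (rule L2D[OF f])
  note [measurable] = gb fm
  have hm [measurable]: "h n \<in> borel_measurable \<mu>" for n by (rule L2D[OF A2D(1)[OF hA]])
  have "(\<integral>\<^sup>+Z. ennreal ((cmod (f Z - g Z))\<^sup>2) \<partial>\<mu>) = (\<integral>\<^sup>+Z. liminf (\<lambda>n. ennreal ((cmod (f Z - h n Z))\<^sup>2)) \<partial>\<mu>)"
  proof (intro nn_integral_cong)
    fix Z
    have "(\<lambda>n. ennreal ((cmod (f Z - h n Z))\<^sup>2)) \<longlonglongrightarrow> ennreal ((cmod (f Z - g Z))\<^sup>2)"
      by (intro tendsto_ennrealI tendsto_intros g)
    then show "ennreal ((cmod (f Z - g Z))\<^sup>2) = liminf (\<lambda>n. ennreal ((cmod (f Z - h n Z))\<^sup>2))"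
      by (rule lim_imp_Liminf[OF sequentially_bot, symmetric])
  qed
  also have "\<dots> \<le> liminf (\<lambda>n. \<integral>\<^sup>+Z. ennreal ((cmod (f Z - h n Z))\<^sup>2) \<partial>\<mu>)"
    by (rule nn_integral_liminf) measurable
  also have "\<dots> = liminf (\<lambda>n. ennreal (sqn (\<lambda>Z. f Z - h n Z)))"
    unfolding sqn_def
    by (intro arg_cong[where f = liminf] ext nn_integral_eq_integral L2D(2)[OF L2_diff[OF f A2D(1)[OF hA]]]) simp
  also have "\<dots> \<le> liminf (\<lambda>n. ennreal (d + 1 / real (Suc n)))"
    using h by (intro Liminf_mono always_eventually allI ennreal_leI less_imp_le)
  also have "\<dots> = ennreal d"
  proof -
    have "(\<lambda>n. d + 1 / real (Suc n)) \<longlonglongrightarrow> d + 0"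
      by (intro tendsto_add tendsto_const LIMSEQ_Suc[OF lim_1_over_n])
    then have "(\<lambda>n. ennreal (d + 1 / real (Suc n))) \<longlonglongrightarrow> ennreal d" by (intro tendsto_ennrealI) simp
    then show ?thesis by (rule lim_imp_Liminf[OF sequentially_bot])
  qed
  finally have le: "(\<integral>\<^sup>+Z. ennreal ((cmod (f Z - g Z))\<^sup>2) \<partial>\<mu>) \<le> ennreal d" .
  have fg: "integrable \<mu> (\<lambda>Z. (cmod (f Z - g Z))\<^sup>2)"
    by (rule integrableI_nonneg) (use le in \<open>auto intro: le_less_trans\<close>)
  then have fgL: "(\<lambda>Z. f Z - g Z) \<in> L2" by (simp add: L2_iff)
  have "g \<in> L2" using L2_diff[OF f fgL] by simp
  then have gA: "g \<in> A2" using hol g0 by (simp add: A2_iff)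
  have d0: "0 \<le> d" unfolding d_def by (rule cInf_greatest[OF ne]) (auto simp: sqn_nonneg)
  have "(\<integral>\<^sup>+Z. ennreal ((cmod (f Z - g Z))\<^sup>2) \<partial>\<mu>) = ennreal (sqn (\<lambda>Z. f Z - g Z))"
    unfolding sqn_def by (rule nn_integral_eq_integral[OF fg]) simp
  with le have "ennreal (sqn (\<lambda>Z. f Z - g Z)) \<le> ennreal d" by (simp only:)
  then have "sqn (\<lambda>Z. f Z - g Z) \<le> d" unfolding ennreal_le_iff[OF d0] .
  then show ?thesis using gA d_le order_trans by blast
qed

text \<open>This gives the definite description that defines the projection its meaning.\<close>

lemma proj_ex1:
  assumes f: "f \<in> L2"
  shows "\<exists>!g. g \<in> A2 \<and> (\<forall>h\<in>A2. ip (\<lambda>Z. f Z - g Z) h = 0)"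
proof (rule ex_ex1I)
  obtain g where g: "g \<in> A2" "\<And>h. h \<in> A2 \<Longrightarrow> sqn (\<lambda>Z. f Z - g Z) \<le> sqn (\<lambda>Z. f Z - h Z)"
    using ex_minimizer[OF f] by blast
  have "ip (\<lambda>Z. f Z - g Z) h = 0" if h: "h \<in> A2" for h
  proof (rule ip_zero_of_minimal)
    show "(\<lambda>Z. f Z - g Z) \<in> L2" "h \<in> L2" by (intro L2_diff f A2D(1) g h)+
    show "sqn (\<lambda>Z. f Z - g Z) \<le> sqn (\<lambda>Z. f Z - g Z - c * h Z)" for c
      using g(2)[OF A2_add[OF g(1) A2_cmult[OF h, of c]]] by (simp add: algebra_simps)
  qed
  with g show "\<exists>g. g \<in> A2 \<and> (\<forall>h\<in>A2. ip (\<lambda>Z. f Z - g Z) h = 0)" by blast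
next
  fix g g' assume g: "g \<in> A2 \<and> (\<forall>h\<in>A2. ip (\<lambda>Z. f Z - g Z) h = 0)"
    and g': "g' \<in> A2 \<and> (\<forall>h\<in>A2. ip (\<lambda>Z. f Z - g' Z) h = 0)"
  let ?k = "\<lambda>Z. g Z - g' Z"
  have k: "?k \<in> A2" using g g' by (intro A2_diff) auto
  have "ip ?k ?k = ip (\<lambda>Z. (f Z - g' Z) - (f Z - g Z)) ?k" by simp
  also have "\<dots> = ip (\<lambda>Z. f Z - g' Z) ?k - ip (\<lambda>Z. f Z - g Z) ?k"
    using g g' k by (intro ip_diff_left L2_diff f A2D(1)) auto
  also have "\<dots> = 0" using g g' k by simp
  finally have "sqn ?k = 0" unfolding ip_self by simp
  from A2_eq_zero[OF k this] show "g = g'" by (auto simp: fun_eq_iff)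
qed

abbreviation proj :: "('n cmat \<Rightarrow> complex) \<Rightarrow> ('n cmat \<Rightarrow> complex)" where
  "proj \<equiv> bergman_proj lam"

lemma proj:
  assumes f: "f \<in> L2"
  shows "proj f \<in> A2" "h \<in> A2 \<Longrightarrow> ip (proj f) h = ip f h"
proof -
  have *: "proj f \<in> A2 \<and> (\<forall>h\<in>A2. ip (\<lambda>Z. f Z - proj f Z) h = 0)"
    unfolding bergman_proj_def by (rule theI'[OF proj_ex1[OF f]])
  then show A: "proj f \<in> A2" by blast
  show "ip (proj f) h = ip f h" if h: "h \<in> A2"
  proof -
    have "ip f h - ip (proj f) h = ip (\<lambda>Z. f Z - proj f Z) h"
      by (rule ip_diff_left[OF f A2D(1)[OF A] A2D(1)[OF h], symmetric])
    also have "\<dots> = 0" using * h by blast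
    finally show ?thesis by simp
  qed
qed

lemma A2_eqI:
  assumes "f \<in> A2" "g \<in> A2" "\<And>h. h \<in> A2 \<Longrightarrow> ip f h = ip g h"
  shows "f = g"
proof -
  have k: "(\<lambda>Z. f Z - g Z) \<in> A2" by (rule A2_diff[OF assms(1,2)])
  have "ip (\<lambda>Z. f Z - g Z) (\<lambda>Z. f Z - g Z) = 0"
    using assms(3)[OF k] ip_diff_left[OF A2D(1)[OF assms(1)] A2D(1)[OF assms(2)] A2D(1)[OF k]] by simp
  then have "sqn (\<lambda>Z. f Z - g Z) = 0" unfolding ip_self by simp
  from A2_eq_zero[OF k this] show ?thesis by (auto simp: fun_eq_iff)
qed

lemma sqn_proj_le:
  assumes f: "f \<in> L2" shows "sqn (proj f) \<le> sqn f"
proof -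
  have P: "proj f \<in> L2" by (rule A2D(1)[OF proj(1)[OF f]])
  have "0 \<le> sqn (\<lambda>Z. f Z - 1 * proj f Z)" by (rule sqn_nonneg)
  also have "\<dots> = sqn f - 2 * Re (ip f (proj f)) + sqn (proj f)"
    by (subst sqn_diff_cmult[OF f P]) simp
  also have "ip f (proj f) = of_real (sqn (proj f))"
    using proj(2)[OF f proj(1)[OF f]] by (simp add: ip_self)
  finally show ?thesis by simp
qed

end

section \<open>Toeplitz operators\<close>

lemma holomorphic_mat_cong:
  assumes "\<And>Z. Z \<in> D \<Longrightarrow> f Z = g Z" "holomorphic_mat f D"
  shows "holomorphic_mat g D"
  unfolding holomorphic_mat_def
proof
  fix Z assume Z: "Z \<in> D"
  then obtain L where L: "(f has_derivative L) (at Z within D)" "\<forall>c X. L (\<chi> i j. c * X $ i $ j) = c * L X"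
    using assms(2) unfolding holomorphic_mat_def by blast
  have "(g has_derivative L) (at Z within D)"
    by (rule has_derivative_transform[OF Z _ L(1)]) (simp add: assms(1))
  with L(2) show "\<exists>L. (g has_derivative L) (at Z within D) \<and> (\<forall>c X. L (\<chi> i j. c * X $ i $ j) = c * L X)" by blast
qed

definition invariant_symbol :: "bool \<Rightarrow> ('n::finite cmat \<Rightarrow> complex) \<Rightarrow> bool" where
  "invariant_symbol l a \<longleftrightarrow> a \<in> Linfty \<and>
     (\<forall>U\<in>unitary_group. AE Z in lebesgue_on cartan_domain. a (act l U Z) = a Z)"

lemma cscale_mat1_unitary: "cmod c = 1 \<Longrightarrow> cscale c (mat 1) \<in> unitary_group"
proof -
  assume "cmod c = 1"
  then have "c * cnj c = 1" by (metis complex_norm_square of_real_1 one_power2)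
  then show ?thesis
    by (simp add: unitary_group_def ctranspose_cscale cscale_mult_left cscale_mult_right mult.commute)
qed

context bergman_setting
begin

abbreviation toep :: "('n cmat \<Rightarrow> complex) \<Rightarrow> 'n bop" where "toep \<equiv> toeplitz lam"

lemma Linfty_bound:
  assumes a: "a \<in> Linfty"
  obtains C where "0 \<le> C" "AE Z in \<mu>. cmod (a Z) \<le> C" "a \<in> borel_measurable \<mu>"
proof -
  obtain C where C: "AE Z in lebesgue_on D. cmod (a Z) \<le> C" using a unfolding Linfty_def by blast
  have "AE Z in \<mu>. cmod (a Z) \<le> max C 0" unfolding AE_\<mu> using C by eventually_elim simp
  moreover have "a \<in> borel_measurable \<mu>"
    using a unfolding Linfty_def measurable_cong_sets[OF sets_\<mu> refl] by blast
  ultimately show ?thesis using that[of "max C 0"] by simp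
qed

lemma Linfty_mult_L2:
  assumes a: "a \<in> Linfty"
  obtains C where "0 \<le> C" "\<And>f. f \<in> L2 \<Longrightarrow> (\<lambda>Z. a Z * f Z) \<in> L2"
    "\<And>f. f \<in> L2 \<Longrightarrow> sqn (\<lambda>Z. a Z * f Z) \<le> C\<^sup>2 * sqn f"
proof -
  obtain C where C: "0 \<le> C" "AE Z in \<mu>. cmod (a Z) \<le> C" "a \<in> borel_measurable \<mu>"
    using Linfty_bound[OF a] by blast
  have le: "AE Z in \<mu>. (cmod (a Z * f Z))\<^sup>2 \<le> C\<^sup>2 * (cmod (f Z))\<^sup>2" for f
    using C(2)
  proof eventually_elim
    fix Z assume "cmod (a Z) \<le> C"
    then have "(cmod (a Z))\<^sup>2 * (cmod (f Z))\<^sup>2 \<le> C\<^sup>2 * (cmod (f Z))\<^sup>2"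
      by (intro mult_right_mono power_mono) auto
    then show "(cmod (a Z * f Z))\<^sup>2 \<le> C\<^sup>2 * (cmod (f Z))\<^sup>2"
      by (simp add: norm_mult power_mult_distrib)
  qed
  have L: "(\<lambda>Z. a Z * f Z) \<in> L2" if f: "f \<in> L2" for f
    by (rule L2_dominated[OF _ _ le]) (intro borel_measurable_times C(3) L2D[OF f] integrable_mult_right)+
  have "sqn (\<lambda>Z. a Z * f Z) \<le> C\<^sup>2 * sqn f" if f: "f \<in> L2" for f
  proof -
    have "sqn (\<lambda>Z. a Z * f Z) \<le> (LINT Z|\<mu>. C\<^sup>2 * (cmod (f Z))\<^sup>2)"
      unfolding sqn_def by (intro integral_mono_AE L2D(2)[OF L[OF f]] integrable_mult_right L2D(2)[OF f] le)
    then show ?thesis unfolding sqn_def by simp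
  qed
  with C(1) L that show ?thesis by blast
qed

lemma symbol_mult_L2: "a \<in> Linfty \<Longrightarrow> f \<in> A2 \<Longrightarrow> (\<lambda>Z. a Z * f Z) \<in> L2"
  using Linfty_mult_L2[of a] A2D(1)[of f] by blast

lemma toep_apply: "f \<in> A2 \<Longrightarrow> toep a f = proj (\<lambda>Z. a Z * f Z)"
  by (simp add: toeplitz_def)

lemma toep_A2: "a \<in> Linfty \<Longrightarrow> f \<in> A2 \<Longrightarrow> toep a f \<in> A2"
  by (simp add: toep_apply proj(1) symbol_mult_L2)

lemma ip_toep: "a \<in> Linfty \<Longrightarrow> f \<in> A2 \<Longrightarrow> h \<in> A2 \<Longrightarrow> ip (toep a f) h = ip (\<lambda>Z. a Z * f Z) h"
  by (simp add: toep_apply proj(2) symbol_mult_L2)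

lemma toep_bounded_ops: assumes a: "a \<in> Linfty" shows "toep a \<in> bounded_ops lam"
proof -
  have ext: "toep a \<in> A2 \<rightarrow>\<^sub>E A2"
    using toep_A2[OF a] by (auto simp: toeplitz_def PiE_def extensional_def)
  have add: "toep a (\<lambda>Z. f Z + g Z) = (\<lambda>Z. toep a f Z + toep a g Z)" if f: "f \<in> A2" and g: "g \<in> A2" for f g
  proof (rule A2_eqI)
    fix h assume h: "h \<in> A2"
    have "ip (toep a (\<lambda>Z. f Z + g Z)) h = ip (\<lambda>Z. a Z * f Z + a Z * g Z) h"
      by (simp add: ip_toep[OF a A2_add[OF f g] h] distrib_left)
    also have "\<dots> = ip (\<lambda>Z. a Z * f Z) h + ip (\<lambda>Z. a Z * g Z) h"
      by (intro ip_add_left symbol_mult_L2 a f g A2D(1)[OF h])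
    also have "\<dots> = ip (toep a f) h + ip (toep a g) h" by (simp add: ip_toep a f g h)
    also have "\<dots> = ip (\<lambda>Z. toep a f Z + toep a g Z) h"
      by (intro ip_add_left[symmetric] A2D(1) toep_A2 a f g h)
    finally show "ip (toep a (\<lambda>Z. f Z + g Z)) h = ip (\<lambda>Z. toep a f Z + toep a g Z) h" .
  qed (intro toep_A2 A2_add a f g)+
  have scale: "toep a (\<lambda>Z. c * f Z) = (\<lambda>Z. c * toep a f Z)" if f: "f \<in> A2" for f c
  proof (rule A2_eqI)
    fix h assume h: "h \<in> A2"
    have "ip (toep a (\<lambda>Z. c * f Z)) h = ip (\<lambda>Z. c * (a Z * f Z)) h"
      by (simp add: ip_toep[OF a A2_cmult[OF f] h] mult.left_commute)
    also have "\<dots> = ip (\<lambda>Z. c * toep a f Z) h" by (simp add: ip_cmult_left ip_toep a f h)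
    finally show "ip (toep a (\<lambda>Z. c * f Z)) h = ip (\<lambda>Z. c * toep a f Z) h" .
  qed (intro toep_A2 A2_cmult a f)+
  obtain C where C: "0 \<le> C" "\<And>f. f \<in> L2 \<Longrightarrow> (\<lambda>Z. a Z * f Z) \<in> L2"
    "\<And>f. f \<in> L2 \<Longrightarrow> sqn (\<lambda>Z. a Z * f Z) \<le> C\<^sup>2 * sqn f"
    using Linfty_mult_L2[OF a] by blast
  have bound: "L2_norm lam (toep a f) \<le> C * L2_norm lam f" if f: "f \<in> A2" for f
  proof -
    have "sqn (toep a f) \<le> C\<^sup>2 * sqn f"
      using sqn_proj_le[OF C(2)[OF A2D(1)[OF f]]] C(3)[OF A2D(1)[OF f]] by (simp add: toep_apply[OF f])
    then have "sqrt (sqn (toep a f)) \<le> sqrt (C\<^sup>2 * sqn f)" by (rule real_sqrt_le_mono)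
    then show ?thesis using C(1) by (simp add: L2_norm_sqn real_sqrt_mult)
  qed
  show ?thesis unfolding bounded_ops_def using ext add scale bound by blast
qed

text \<open>In the inner product with \<open>h\<close>, the map \<open>\<phi>\<close> can be moved from the first factor to the second, as
\<open>\<psi>\<close>, because it preserves the measure, and it commutes with multiplication by \<open>a\<close>.\<close>

lemma toep_symmetry:
  assumes a: "a \<in> Linfty" and inv: "AE Z in lebesgue_on D. a (\<phi> Z) = a Z"
    and \<phi>: "is_symmetry \<phi>" "\<And>c X. \<phi> (cscale c X) = cscale c (\<phi> X)"
    and \<psi>: "is_symmetry \<psi>" "\<And>c X. \<psi> (cscale c X) = cscale c (\<psi> X)" and \<psi>\<phi>: "\<And>Z. \<psi> (\<phi> Z) = Z"
    and f: "f \<in> A2"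
  shows "toep a (\<lambda>Z. f (\<phi> Z)) = (\<lambda>Z. toep a f (\<phi> Z))"
proof (rule A2_eqI)
  have f\<phi>: "(\<lambda>Z. f (\<phi> Z)) \<in> A2" by (rule A2_symmetry[OF f \<phi>])
  show "toep a (\<lambda>Z. f (\<phi> Z)) \<in> A2" by (rule toep_A2[OF a f\<phi>])
  show "(\<lambda>Z. toep a f (\<phi> Z)) \<in> A2" by (rule A2_symmetry[OF toep_A2[OF a f] \<phi>])
  fix h assume h: "h \<in> A2"
  let ?k = "\<lambda>Z. h (\<psi> Z)"
  have k: "?k \<in> A2" by (rule A2_symmetry[OF h \<psi>])
  have af: "(\<lambda>Z. a Z * f Z) \<in> L2" by (rule symbol_mult_L2[OF a f])
  have m1: "(\<lambda>Z. a Z * f (\<phi> Z)) \<in> borel_measurable \<mu>" by (rule L2D(1)[OF symbol_mult_L2[OF a f\<phi>]])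
  have m2: "(\<lambda>Z. a (\<phi> Z) * f (\<phi> Z)) \<in> borel_measurable \<mu>"
    by (rule measurable_compose[OF symmetry_measurable[OF \<phi>(1)] L2D(1)[OF af]])
  have mh: "(\<lambda>Z. cnj (h Z)) \<in> borel_measurable \<mu>" by (rule borel_measurable_cnj[OF L2D(1)[OF A2D(1)[OF h]]])
  have "ip (toep a (\<lambda>Z. f (\<phi> Z))) h = ip (\<lambda>Z. a Z * f (\<phi> Z)) h" by (rule ip_toep[OF a f\<phi> h])
  also have "\<dots> = ip (\<lambda>Z. a (\<phi> Z) * f (\<phi> Z)) h"
    unfolding L2_inner_def
  proof (rule integral_cong_AE)
    have "AE Z in \<mu>. a (\<phi> Z) = a Z" using inv unfolding AE_\<mu> .
    then show "AE Z in \<mu>. a Z * f (\<phi> Z) * cnj (h Z) = a (\<phi> Z) * f (\<phi> Z) * cnj (h Z)"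
      by eventually_elim simp
  qed (intro borel_measurable_times m1 m2 mh)+
  also have "\<dots> = ip (\<lambda>Z. (\<lambda>Z. a Z * f Z) (\<phi> Z)) (\<lambda>Z. ?k (\<phi> Z))" by (simp add: \<psi>\<phi>)
  also have "\<dots> = ip (\<lambda>Z. a Z * f Z) ?k" by (rule ip_symmetry[OF af A2D(1)[OF k] \<phi>(1)])
  also have "\<dots> = ip (toep a f) ?k" by (rule ip_toep[OF a f k, symmetric])
  also have "\<dots> = ip (\<lambda>Z. toep a f (\<phi> Z)) (\<lambda>Z. ?k (\<phi> Z))"
    by (rule ip_symmetry[OF A2D(1)[OF toep_A2[OF a f]] A2D(1)[OF k] \<phi>(1), symmetric])
  also have "\<dots> = ip (\<lambda>Z. toep a f (\<phi> Z)) h" by (simp add: \<psi>\<phi>)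
  finally show "ip (toep a (\<lambda>Z. f (\<phi> Z))) h = ip (\<lambda>Z. toep a f (\<phi> Z)) h" .
qed

lemma toep_act:
  assumes a: "invariant_symbol l a" and U: "U \<in> unitary_group" and f: "f \<in> A2"
  shows "toep a (\<lambda>Z. f (act l U Z)) = (\<lambda>Z. toep a f (act l U Z))"
  using a U
  by (intro toep_symmetry[where \<psi> = "act l (ctranspose U)"] f is_symmetry_act unitary_ctranspose act_cscale act_ctranspose_unitary)
     (auto simp: invariant_symbol_def)

lemma toep_rotate:
  assumes a: "invariant_symbol l a" and c: "cmod c = 1" and f: "f \<in> A2"
  shows "toep a (\<lambda>Z. f (cscale c Z)) = (\<lambda>Z. toep a f (cscale c Z))"
  using toep_act[OF a cscale_mat1_unitary[OF c] f] by (simp add: act_cscale_left)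

text \<open>If \<open>u\<close> represents the evaluation at \<open>Z0\<close>, then moving the projection and the symbol to the other
side of the inner product gives \<open>\<kappa> = a \<cdot> cnj (P u)\<close>.\<close>

lemma toep_kernel:
  assumes a: "a \<in> Linfty" and Z0: "Z0 \<in> D"
  shows "\<exists>\<kappa>\<in>L2. \<forall>g\<in>A2. toep a g Z0 = (LINT Z|\<mu>. g Z * \<kappa> Z)"
proof -
  obtain r C where "0 < r" "0 \<le> C" "cball Z0 r \<subseteq> D"
    and ev: "\<And>Y. Y \<in> cball Z0 r \<Longrightarrow> \<exists>u\<in>L2. sqn u \<le> C \<and> (\<forall>f\<in>A2. f Y = ip f u)"
    using point_evaluation[OF Z0] by blast
  then have "Z0 \<in> cball Z0 r" by simp
  then obtain u where u: "u \<in> L2" "\<And>f. f \<in> A2 \<Longrightarrow> f Z0 = ip f u" using ev by blast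
  let ?\<kappa> = "\<lambda>Z. a Z * cnj (proj u Z)"
  obtain C' where "0 \<le> C'" and aL: "\<And>f. f \<in> L2 \<Longrightarrow> (\<lambda>Z. a Z * f Z) \<in> L2"
    and "\<And>f. f \<in> L2 \<Longrightarrow> sqn (\<lambda>Z. a Z * f Z) \<le> C'\<^sup>2 * sqn f"
    using Linfty_mult_L2[OF a] by blast
  have \<kappa>: "?\<kappa> \<in> L2" by (intro aL cnj_L2 A2D(1) proj(1) u(1))
  have "toep a g Z0 = (LINT Z|\<mu>. g Z * ?\<kappa> Z)" if g: "g \<in> A2" for g
  proof -
    have T: "toep a g \<in> A2" by (rule toep_A2[OF a g])
    have "toep a g Z0 = ip (toep a g) u" by (rule u(2)[OF T])
    also have "\<dots> = cnj (ip u (toep a g))" by (rule ip_cnj[symmetric])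
    also have "ip u (toep a g) = ip (proj u) (toep a g)" by (rule proj(2)[OF u(1) T, symmetric])
    also have "cnj \<dots> = ip (toep a g) (proj u)" by (rule ip_cnj)
    also have "\<dots> = ip (\<lambda>Z. a Z * g Z) (proj u)" by (rule ip_toep[OF a g proj(1)[OF u(1)]])
    also have "\<dots> = (LINT Z|\<mu>. g Z * ?\<kappa> Z)" unfolding L2_inner_def by (simp add: mult_ac)
    finally show ?thesis .
  qed
  with \<kappa> show ?thesis by (intro bexI[of _ ?\<kappa>]) auto
qed

section \<open>Dilations\<close>

text \<open>The value 0 outside the domain matches the convention for elements of the Bergman space.\<close>

definition dil :: "real \<Rightarrow> ('n cmat \<Rightarrow> complex) \<Rightarrow> ('n cmat \<Rightarrow> complex)" where
  "dil \<rho> f Z = (if Z \<in> D then f (cscale (of_real \<rho>) Z) else 0)"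

lemma bounded_on_opn_le:
  assumes f: "f \<in> A2" and q: "q < 1"
  obtains B where "0 \<le> B" "\<And>Z. opn Z \<le> q \<Longrightarrow> cmod (f Z) \<le> B"
proof -
  have "{Z :: 'n cmat. opn Z \<le> q} \<subseteq> D" using q by (auto simp: cartan_domain_iff)
  then have "compact (f ` {Z. opn Z \<le> q})"
    by (intro compact_continuous_image compact_opn_le continuous_on_subset[OF A2D(4)[OF f]])
  then have "bounded (f ` {Z. opn Z \<le> q})" by (rule compact_imp_bounded)
  then obtain B where B: "\<forall>y\<in>f ` {Z. opn Z \<le> q}. norm y \<le> B" unfolding bounded_iff by blast
  then have "cmod (f Z) \<le> max B 0" if "opn Z \<le> q" for Z using that by (simp add: le_max_iff_disj)
  then show ?thesis using that[of "max B 0"] by simp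
qed

lemma opn_scale_less:
  assumes "0 < \<rho>" "\<rho> < 1" "Z \<in> D" shows "opn (cscale (of_real \<rho>) Z) \<le> \<rho>"
proof -
  have "opn (cscale (of_real \<rho>) Z) \<le> \<rho> * opn Z" using opn_cscale_le[of "of_real \<rho>" Z] assms by simp
  also have "\<dots> \<le> \<rho> * 1" using assms by (intro mult_left_mono) (auto simp: cartan_domain_iff)
  finally show ?thesis by simp
qed

lemma dil_A2:
  assumes f: "f \<in> A2" and \<rho>: "0 < \<rho>" "\<rho> < 1"
  shows "dil \<rho> f \<in> A2"
proof -
  obtain B where B: "0 \<le> B" "\<And>Z. opn Z \<le> \<rho> \<Longrightarrow> cmod (f Z) \<le> B" using bounded_on_opn_le[OF f \<rho>(2)] by blast
  have "holomorphic_mat (\<lambda>Z. f (cscale (of_real \<rho>) Z)) D"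
    using \<rho> by (intro holomorphic_mat_linear_compose[OF A2D(2)[OF f] open_cartan_domain linear_cscale] cartan_domain_cscale)
      (auto simp: mult.commute)
  then have hol: "holomorphic_mat (dil \<rho> f) D" by (rule holomorphic_mat_cong[rotated]) (simp add: dil_def)
  show ?thesis
  proof (rule A2_bounded)
    show "cmod (dil \<rho> f Z) \<le> B" if "Z \<in> D" for Z
      using B(2)[OF opn_scale_less[OF \<rho> that]] that by (simp add: dil_def)
    show "continuous_on D (dil \<rho> f)" by (rule holomorphic_mat_imp_continuous_on[OF hol])
  qed (use hol in \<open>auto simp: dil_def\<close>)
qed

lemma Cauchy_dil:
  assumes f: "f \<in> A2" and Z: "Z \<in> D" and \<rho>: "0 < \<rho>" "\<rho> < 1"
  shows "f (cscale (of_real \<rho>) Z) = (LINT t|unit_interval. f (cscale (circ t) Z) * (circ t / (circ t - of_real \<rho>)))"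
proof -
  define S where "S = (\<lambda>c. cscale c Z) -` D"
  have S: "open S"
    unfolding S_def cscale_def by (intro open_vimage open_cartan_domain continuous_intros)
  have "cball 0 1 \<subseteq> S" unfolding S_def using cartan_domain_cscale[OF _ Z] by auto
  moreover have "(\<lambda>c. f (cscale c Z)) holomorphic_on S"
  proof (rule holomorphic_mat_curve[OF A2D(2)[OF f] open_cartan_domain S])
    show "(\<lambda>c. cscale c Z $ i $ j) holomorphic_on S" for i j
      unfolding cscale_nth by (intro holomorphic_intros)
  qed (simp add: S_def)
  ultimately show ?thesis using Cauchy_circ[OF S, of "\<lambda>c. f (cscale c Z)" "of_real \<rho>"] \<rho> by simp
qed

end

section \<open>The unitary group is a set of uniqueness\<close>

text \<open>Cramer's formula exhibits the inverse as a rational function of the entries.\<close>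

definition minv :: "'n::finite cmat \<Rightarrow> 'n cmat" where
  "minv A = (\<chi> k l. det (\<chi> i j. if j = k then mat 1 $ i $ l else A $ i $ j) / det A)"

lemma minv_right: "det A \<noteq> 0 \<Longrightarrow> A ** minv A = mat 1"
proof -
  assume A: "det A \<noteq> 0"
  have "A *v (\<chi> k. minv A $ k $ l) = (\<chi> i. mat 1 $ i $ l)" for l
    unfolding cramer[OF A] minv_def vec_lambda_beta ..
  then have "(A *v (\<chi> k. minv A $ k $ l)) $ i = mat 1 $ i $ l" for i l by simp
  then show ?thesis by (simp add: vec_eq_iff matrix_matrix_mult_def matrix_vector_mult_def)
qed

lemma minv_left: "det A \<noteq> 0 \<Longrightarrow> minv A ** A = mat 1"
  using minv_right matrix_left_right_inverse by blast

lemma holomorphic_det: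
  fixes X :: "complex \<Rightarrow> 'n::finite cmat"
  assumes "\<And>i j. (\<lambda>t. X t $ i $ j) holomorphic_on S"
  shows "(\<lambda>t. det (X t)) holomorphic_on S"
  unfolding det_def by (intro holomorphic_intros assms)

lemma holomorphic_minv:
  fixes X :: "complex \<Rightarrow> 'n::finite cmat"
  assumes X: "\<And>i j. (\<lambda>t. X t $ i $ j) holomorphic_on S" and "\<And>t. t \<in> S \<Longrightarrow> det (X t) \<noteq> 0"
  shows "(\<lambda>t. minv (X t) $ k $ l) holomorphic_on S"
proof -
  have "(\<lambda>t. det (\<chi> i j. if j = k then mat 1 $ i $ l else X t $ i $ j)) holomorphic_on S"
  proof (rule holomorphic_det)
    show "(\<lambda>t. (\<chi> i j. if j = k then mat 1 $ i $ l else X t $ i $ j) $ i' $ j') holomorphic_on S" for i' j'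
      using X[of i' j'] by (cases "j' = k") auto
  qed
  then show ?thesis unfolding minv_def using assms by (simp add: holomorphic_on_divide holomorphic_det)
qed

lemma isCont_minv:
  assumes A: "det (A :: 'n::finite cmat) \<noteq> 0" shows "isCont minv A"
proof -
  have c: "isCont (\<lambda>A. det (\<chi> i j. if j = k then mat 1 $ i $ l else A $ i $ j)) A" for k l
  proof -
    have "continuous_on UNIV (\<lambda>A :: 'n cmat. det (\<chi> i j. if j = k then mat 1 $ i $ l else A $ i $ j))"
    proof (rule continuous_on_det)
      show "continuous_on UNIV (\<lambda>A :: 'n cmat. (\<chi> i j. if j = k then mat 1 $ i $ l else A $ i $ j) $ i' $ j')" for i' j'
        by (cases "j' = k") (auto intro!: continuous_intros)
    qed
    then show ?thesis by (simp add: continuous_on_eq_continuous_at)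
  qed
  have d: "isCont (\<lambda>A :: 'n cmat. det A) A"
  proof -
    have "continuous_on UNIV (\<lambda>A :: 'n cmat. det A)" by (rule continuous_on_det) (intro continuous_intros)
    then show ?thesis by (simp add: continuous_on_eq_continuous_at)
  qed
  show ?thesis unfolding isCont_def minv_def
    by (intro tendsto_vec_lambda tendsto_divide A c[unfolded isCont_def] d[unfolded isCont_def])
qed

text \<open>This transform takes Hermitian matrices to unitary ones and 0 to the identity.\<close>

definition cayley :: "'n::finite cmat \<Rightarrow> 'n cmat" where
  "cayley H = (mat 1 + cscale \<i> H) ** minv (mat 1 - cscale \<i> H)"

lemma isCont_cscale: "isCont (cscale c) (A :: 'n::finite cmat)"
  unfolding isCont_def cscale_def
  by (intro tendsto_vec_lambda tendsto_mult tendsto_const tendsto_vec_nth tendsto_ident_at)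

lemma isCont_mult:
  fixes f g :: "'a::t2_space \<Rightarrow> 'n::finite cmat"
  shows "isCont f x \<Longrightarrow> isCont g x \<Longrightarrow> isCont (\<lambda>x. f x ** g x) x"
  unfolding isCont_def matrix_matrix_mult_def
  by (intro tendsto_vec_lambda tendsto_sum tendsto_mult tendsto_vec_nth)

lemma cayley_unitary:
  assumes H: "ctranspose H = (H :: 'n::finite cmat)" and d: "det (mat 1 - cscale \<i> H) \<noteq> 0"
  shows "cayley H \<in> unitary_group"
proof -
  let ?P = "mat 1 + cscale \<i> H" and ?M = "mat 1 - cscale \<i> H"
  let ?I = "minv ?M"
  have PM: "?P ** ?M = ?M ** ?P"
    by (simp add: matrix_mult_add_diff cscale_mult_left cscale_mult_right) (simp add: vec_eq_iff algebra_simps)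
  have cP: "ctranspose ?P = ?M"
    using H by (simp add: ctranspose_add ctranspose_cscale) (simp add: vec_eq_iff)
  have cM: "ctranspose ?M = ?P"
    using H by (simp add: ctranspose_diff ctranspose_cscale) (simp add: vec_eq_iff)
  have MI: "?M ** ?I = mat 1" by (rule minv_right[OF d])
  have IP: "ctranspose ?I ** ?P = mat 1"
    using arg_cong[OF MI, of ctranspose] by (simp add: ctranspose_mult cM)
  have "ctranspose (cayley H) ** cayley H = ctranspose ?I ** (?M ** ?P) ** ?I"
    unfolding cayley_def ctranspose_mult cP by (simp only: matrix_mul_assoc)
  also have "\<dots> = ctranspose ?I ** (?P ** ?M) ** ?I" unfolding PM ..
  also have "\<dots> = (ctranspose ?I ** ?P) ** (?M ** ?I)" by (simp only: matrix_mul_assoc)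
  also have "\<dots> = mat 1" unfolding IP MI by simp
  finally have 1: "ctranspose (cayley H) ** cayley H = mat 1" .
  then have "cayley H ** ctranspose (cayley H) = mat 1" using matrix_left_right_inverse by blast
  with 1 show ?thesis by (simp add: unitary_group_def)
qed

lemma cayley_surj:
  fixes X :: "'n::finite cmat"
  assumes d: "det (X + mat 1) \<noteq> 0"
  shows "cayley (cscale (-\<i>) ((X - mat 1) ** minv (X + mat 1))) = X"
    "det (mat 1 - cscale \<i> (cscale (-\<i>) ((X - mat 1) ** minv (X + mat 1)))) \<noteq> 0"
proof -
  let ?S = "X + mat 1" let ?I = "minv ?S"
  have SI: "?S ** ?I = mat 1" by (rule minv_right[OF d])
  have "mat 1 + cscale \<i> (cscale (-\<i>) ((X - mat 1) ** ?I)) = ?S ** ?I + (X - mat 1) ** ?I" by (simp add: SI)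
  also have "\<dots> = cscale 2 (X ** ?I)"
    by (simp add: matrix_mult_add_diff) (simp add: vec_eq_iff)
  finally have P: "mat 1 + cscale \<i> (cscale (-\<i>) ((X - mat 1) ** ?I)) = cscale 2 (X ** ?I)" .
  have "mat 1 - cscale \<i> (cscale (-\<i>) ((X - mat 1) ** ?I)) = ?S ** ?I - (X - mat 1) ** ?I" by (simp add: SI)
  also have "\<dots> = cscale 2 ?I"
    by (simp add: matrix_mult_add_diff) (simp add: vec_eq_iff)
  finally have M: "mat 1 - cscale \<i> (cscale (-\<i>) ((X - mat 1) ** ?I)) = cscale 2 ?I" .
  have inv: "cscale 2 ?I ** cscale (1/2) ?S = mat 1"
    using minv_left[OF d] by (simp add: cscale_mult_left cscale_mult_right)
  then have "det (cscale 2 ?I) * det (cscale (1/2) ?S) = 1"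
    using det_mul[of "cscale 2 ?I" "cscale (1/2) ?S"] by simp
  then have dI: "det (cscale 2 ?I) \<noteq> 0" by auto
  then show "det (mat 1 - cscale \<i> (cscale (-\<i>) ((X - mat 1) ** ?I))) \<noteq> 0" unfolding M .
  have "minv (cscale 2 ?I) = minv (cscale 2 ?I) ** (cscale 2 ?I ** cscale (1/2) ?S)" unfolding inv by simp
  also have "\<dots> = cscale (1/2) ?S" unfolding matrix_mul_assoc minv_left[OF dI] by simp
  finally have "cayley (cscale (-\<i>) ((X - mat 1) ** ?I)) = cscale 2 (X ** ?I) ** cscale (1/2) ?S"
    unfolding cayley_def P M by simp
  also have "\<dots> = X ** (?I ** ?S)" by (simp add: cscale_mult_left cscale_mult_right matrix_mul_assoc)
  also have "\<dots> = X" unfolding minv_left[OF d] by simp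
  finally show "cayley (cscale (-\<i>) ((X - mat 1) ** ?I)) = X" .
qed

text \<open>Pulled back along the Cayley transform, \<open>G\<close> vanishes on small Hermitian matrices.  A small matrix \<open>H\<close>
is \<open>A + \<i> B\<close> with \<open>A\<close> and \<open>B\<close> Hermitian, and \<open>t \<mapsto> G (cayley (A + t B))\<close> vanishes for real \<open>t\<close>,
hence also for \<open>t = \<i>\<close>.  So \<open>G\<close> vanishes near the identity and, continued along complex lines through
the identity, on all of \<open>\<Omega>\<close>.  Holomorphy is required along curves only, the form in which
it is available for functions given by integrals.\<close>

lemma unitary_uniqueness:
  fixes G :: "'n::finite cmat \<Rightarrow> complex"
  assumes \<Omega>: "open \<Omega>" "convex \<Omega>" "mat 1 \<in> \<Omega>" and X: "X \<in> \<Omega>"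
    and hol: "\<And>S (C :: complex \<Rightarrow> 'n cmat). open S \<Longrightarrow> (\<And>i j. (\<lambda>t. C t $ i $ j) holomorphic_on S) \<Longrightarrow> (\<And>t. t \<in> S \<Longrightarrow> C t \<in> \<Omega>) \<Longrightarrow>
        (\<lambda>t. G (C t)) holomorphic_on S"
    and zero: "\<And>U. U \<in> unitary_group \<Longrightarrow> U \<in> \<Omega> \<Longrightarrow> G U = 0"
  shows "G X = 0"
proof -
  have det1: "det (mat 1 - cscale \<i> 0 :: 'n cmat) \<noteq> 0"
    by (simp add: cscale_def zero_vec_def[symmetric])
  have det_cont: "isCont (\<lambda>A :: 'n cmat. det A) A" for A
  proof -
    have "continuous_on UNIV (\<lambda>A :: 'n cmat. det A)" by (rule continuous_on_det) (intro continuous_intros)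
    then show ?thesis by (simp add: continuous_on_eq_continuous_at)
  qed
  have c0: "cscale \<i> (0 :: 'n cmat) = 0" by (simp add: vec_eq_iff)
  have M_cont: "isCont (\<lambda>H. mat 1 - cscale \<i> H) (0 :: 'n cmat)"
    by (intro continuous_intros isCont_cscale)
  have cay_cont: "isCont cayley (0 :: 'n cmat)"
    unfolding cayley_def[abs_def]
    by (intro isCont_mult continuous_intros isCont_cscale isCont_o2[OF M_cont isCont_minv] det1)
  have cay0: "cayley 0 = (mat 1 :: 'n cmat)"
    using minv_right[of "mat 1 :: 'n cmat"] by (simp add: cayley_def c0)
  have cont_open: "\<exists>T. open T \<and> x \<in> T \<and> (\<forall>y\<in>T. f y \<in> V)" if "isCont f x" "open V" "f x \<in> V"
    for f :: "'n cmat \<Rightarrow> 'c::topological_space" and x V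
    using that unfolding continuous_at_open by blast
  have detM_cont: "isCont (\<lambda>H. det (mat 1 - cscale \<i> H)) (0 :: 'n cmat)"
    by (rule isCont_o2[OF M_cont det_cont])
  obtain T1 where T1: "open T1" "0 \<in> T1" "\<And>H. H \<in> T1 \<Longrightarrow> cayley H \<in> \<Omega>"
    using cont_open[OF cay_cont \<Omega>(1)] \<Omega>(3) unfolding cay0 by blast
  obtain T2 :: "'n cmat set" where T2: "open T2" "0 \<in> T2" "\<And>H. H \<in> T2 \<Longrightarrow> det (mat 1 - cscale \<i> H) \<in> - {0}"
    using cont_open[OF detM_cont, of "- {0}"] det1 by auto
  obtain \<delta> where \<delta>: "0 < \<delta>" "ball 0 \<delta> \<subseteq> T1 \<inter> T2"
    using open_Int[OF T1(1) T2(1)] T1(2) T2(2) unfolding open_contains_ball by blast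
  have cay: "cayley H \<in> \<Omega>" "det (mat 1 - cscale \<i> H) \<noteq> 0" if "norm H < \<delta>" for H
  proof -
    have "H \<in> T1 \<inter> T2" using that \<delta>(2) by auto
    then show "cayley H \<in> \<Omega>" "det (mat 1 - cscale \<i> H) \<noteq> 0" using T1(3) T2(3) by auto
  qed
  have step1: "G (cayley H) = 0" if H: "3 * norm H < \<delta>" for H
  proof -
    define A where "A = cscale (1/2) (H + ctranspose H)"
    define B where "B = cscale (-\<i>/2) (H - ctranspose H)"
    have Ah: "ctranspose A = A" by (simp add: A_def ctranspose_cscale ctranspose_add add.commute)
    have Bh: "ctranspose B = B"
      by (simp add: B_def ctranspose_cscale ctranspose_diff) (simp add: vec_eq_iff algebra_simps)
    have nA: "norm A \<le> norm H" using norm_triangle_ineq[of H "ctranspose H"] by (simp add: A_def norm_cscale)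
    have nB: "norm B \<le> norm H" using norm_triangle_ineq4[of H "ctranspose H"] by (simp add: B_def norm_cscale norm_divide)
    let ?L = "\<lambda>t. A + cscale t B"
    have small: "norm (?L t) < \<delta>" if "t \<in> ball 0 2" for t
    proof -
      have "norm (?L t) \<le> norm A + cmod t * norm B" by (rule order_trans[OF norm_triangle_ineq]) (simp add: norm_cscale)
      also have "\<dots> \<le> norm H + 2 * norm H" using that nA nB by (intro add_mono mult_mono) auto
      finally show ?thesis using H by simp
    qed
    have hL: "(\<lambda>t. ?L t $ i $ j) holomorphic_on S" for i j S
      unfolding vector_add_component cscale_nth by (intro holomorphic_intros)
    have gh: "(\<lambda>t. G (cayley (?L t))) holomorphic_on ball 0 2"
    proof (rule hol[OF open_ball])
      fix i j
      have "(\<lambda>t. (mat 1 - cscale \<i> (?L t)) $ i $ j) holomorphic_on ball 0 2" for i j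
        unfolding vector_minus_component vector_add_component cscale_nth by (intro holomorphic_intros)
      then have inv: "(\<lambda>t. minv (mat 1 - cscale \<i> (?L t)) $ k $ l) holomorphic_on ball 0 2" for k l
        by (rule holomorphic_minv) (rule cay(2)[OF small])
      have "(\<lambda>t. \<Sum>k\<in>UNIV. (mat 1 $ i $ k + \<i> * ?L t $ i $ k) * minv (mat 1 - cscale \<i> (?L t)) $ k $ j) holomorphic_on ball 0 2"
        by (intro holomorphic_intros hL inv)
      then show "(\<lambda>t. cayley (?L t) $ i $ j) holomorphic_on ball 0 2"
        by (simp add: cayley_def matrix_matrix_mult_def)
    qed (rule cay(1)[OF small])
    have "G (cayley (?L \<i>)) = 0"
    proof (rule analytic_continuation[OF gh open_ball connected_ball, where \<xi> = 0 and U = "of_real ` {-1..1}"])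
      show "0 islimpt complex_of_real ` {-1..1}"
        unfolding islimpt_approachable
      proof (intro allI impI)
        fix e :: real assume "0 < e"
        then show "\<exists>x'\<in>complex_of_real ` {-1..1}. x' \<noteq> 0 \<and> dist x' 0 < e"
          by (intro bexI[of _ "complex_of_real (min (e/2) 1)"]) auto
      qed
      fix z assume "z \<in> complex_of_real ` {-1..1}"
      then obtain r where r: "z = of_real r" "\<bar>r\<bar> \<le> 1" by auto
      then have z: "z \<in> ball 0 2" by simp
      have "ctranspose (?L z) = ?L z" by (simp add: ctranspose_add ctranspose_cscale Ah Bh r(1))
      then show "G (cayley (?L z)) = 0"
        by (intro zero cayley_unitary cay[OF small[OF z]])
    qed auto
    moreover have "?L \<i> = H"
      by (simp add: A_def B_def) (simp add: vec_eq_iff algebra_simps)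
    ultimately show ?thesis by simp
  qed
  let ?K = "\<lambda>X::'n cmat. cscale (-\<i>) ((X - mat 1) ** minv (X + mat 1))"
  have det2: "det (mat 1 + mat 1 :: 'n cmat) \<noteq> 0"
  proof -
    have "(mat 1 + mat 1 :: 'n cmat) ** cscale (1/2) (mat 1) = mat 1"
      by (simp add: cscale_mult_right) (simp add: vec_eq_iff)
    from arg_cong[OF this, of det] have "det (mat 1 + mat 1 :: 'n cmat) * det (cscale (1/2) (mat 1) :: 'n cmat) = 1"
      by (simp add: det_mul)
    then show ?thesis by auto
  qed
  have P_cont: "isCont (\<lambda>X. X + mat 1) (mat 1 :: 'n cmat)" by (intro continuous_intros)
  have K_cont: "isCont ?K (mat 1)"
    by (intro isCont_o2[OF _ isCont_cscale] isCont_mult continuous_intros isCont_o2[OF P_cont isCont_minv] det2)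
  have detP_cont: "isCont (\<lambda>X. det (X + mat 1)) (mat 1 :: 'n cmat)"
    by (rule isCont_o2[OF P_cont det_cont])
  have K1: "?K (mat 1) = 0" by (simp add: cscale_def vec_eq_iff)
  obtain T3 where T3: "open T3" "mat 1 \<in> T3" "\<And>X. X \<in> T3 \<Longrightarrow> ?K X \<in> ball 0 (\<delta> / 3)"
    using cont_open[OF K_cont open_ball, of 0 "\<delta> / 3"] \<delta>(1) unfolding K1 by auto
  obtain T4 :: "'n cmat set" where T4: "open T4" "mat 1 \<in> T4" "\<And>X. X \<in> T4 \<Longrightarrow> det (X + mat 1) \<in> - {0}"
    using cont_open[OF detP_cont, of "- {0}"] det2 by auto
  have step2: "G X = 0" if "X \<in> T3" "X \<in> T4" for X
  proof -
    have "3 * norm (?K X) < \<delta>" using T3(3)[OF that(1)] by simp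
    then have "G (cayley (?K X)) = 0" by (rule step1)
    then show ?thesis using cayley_surj(1)[of X] T4(3)[OF that(2)] by simp
  qed
  let ?C = "\<lambda>t. mat 1 + cscale t (X - mat 1)"
  have C_cont: "continuous_on UNIV ?C" unfolding cscale_def by (intro continuous_intros)
  define S where "S = ?C -` \<Omega>"
  have S: "open S" unfolding S_def by (rule open_vimage[OF \<Omega>(1) C_cont])
  have "convex S"
  proof (rule convexI)
    fix a b :: complex and u v :: real
    assume ab: "a \<in> S" "b \<in> S" and uv: "0 \<le> u" "0 \<le> v" "u + v = 1"
    have "?C (u *\<^sub>R a + v *\<^sub>R b) = (u + v) *\<^sub>R mat 1 + cscale (u *\<^sub>R a + v *\<^sub>R b) (X - mat 1)"
      unfolding uv(3) by simp
    also have "\<dots> = u *\<^sub>R ?C a + v *\<^sub>R ?C b"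
      by (simp add: vec_eq_iff scaleR_conv_of_real[where 'a = complex] algebra_simps)
    also have "\<dots> \<in> \<Omega>" using ab uv \<Omega>(2) unfolding S_def by (intro convexD) auto
    finally show "u *\<^sub>R a + v *\<^sub>R b \<in> S" by (simp add: S_def)
  qed
  then have Sc: "connected S" by (rule convex_connected)
  have gS: "(\<lambda>t. G (?C t)) holomorphic_on S"
  proof (rule hol[OF S])
    show "(\<lambda>t. ?C t $ i $ j) holomorphic_on S" for i j
      unfolding vector_add_component cscale_nth by (intro holomorphic_intros)
  qed (simp add: S_def)
  define U where "U = S \<inter> ?C -` (T3 \<inter> T4)"
  have "open U" unfolding U_def by (intro open_Int S open_vimage[OF _ C_cont] T3(1) T4(1))
  moreover have C0: "?C 0 = mat 1" "?C 1 = X" by simp_all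
  have "0 \<in> U" using \<Omega>(3) T3(2) T4(2) by (simp add: U_def S_def)
  ultimately have lim: "0 islimpt U" by (metis interior_open interior_limit_point)
  have "G (?C 1) = 0"
  proof (rule analytic_continuation[OF gS S Sc, where \<xi> = 0 and U = U])
    show "U \<subseteq> S" by (simp add: U_def)
    show "0 \<in> S" using \<open>0 \<in> U\<close> by (simp add: U_def)
    show "1 \<in> S" using X by (simp add: S_def)
    show "G (?C z) = 0" if "z \<in> U" for z using that step2 by (simp add: U_def)
  qed (rule lim)
  then show ?thesis by simp
qed

section \<open>Integrals depending holomorphically on a parameter\<close>

text \<open>On the disc of half the radius, Cauchy's inequality bounds the difference quotients by \<open>2 B / R\<close>, so
differentiation under the integral is a case of dominated convergence.\<close>

lemma holomorphic_param_integral: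
  fixes h :: "complex \<Rightarrow> 'a \<Rightarrow> complex"
  assumes S: "open S" and hol: "\<And>z. z \<in> space M \<Longrightarrow> (\<lambda>t. h t z) holomorphic_on S"
    and meas: "\<And>t. t \<in> S \<Longrightarrow> h t \<in> borel_measurable M"
    and dom: "\<And>t0. t0 \<in> S \<Longrightarrow> \<exists>R>0. \<exists>B. cball t0 R \<subseteq> S \<and> integrable M B \<and>
        (\<forall>t\<in>cball t0 R. \<forall>z\<in>space M. cmod (h t z) \<le> B z)"
  shows "(\<lambda>t. LINT z|M. h t z) holomorphic_on S"
proof (unfold holomorphic_on_open[OF S], intro ballI)
  fix t0 assume t0: "t0 \<in> S"
  obtain R B where R: "0 < R" "cball t0 R \<subseteq> S" and B: "integrable M B"
    and le: "\<And>t z. t \<in> cball t0 R \<Longrightarrow> z \<in> space M \<Longrightarrow> cmod (h t z) \<le> B z"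
    using dom[OF t0] by blast
  let ?F = "\<lambda>t. LINT z|M. h t z"
  let ?h' = "\<lambda>z. deriv (\<lambda>t. h t z) t0"
  let ?q = "\<lambda>t z. (h t z - h t0 z) / (t - t0)"
  have int: "integrable M (h t)" if "t \<in> cball t0 R" for t
  proof (rule Bochner_Integration.integrable_bound[OF B])
    show "h t \<in> borel_measurable M" using that R(2) by (intro meas) blast
    show "AE z in M. norm (h t z) \<le> norm (B z)"
      using le[OF that] by (intro AE_I2) (metis abs_ge_self order_trans real_norm_def)
  qed
  have der_bound: "cmod (deriv (\<lambda>t. h t z) w) \<le> 2 * B z / R" if z: "z \<in> space M" and w: "w \<in> ball t0 (R/2)" for z w
  proof -
    have sub: "cball w (R/2) \<subseteq> cball t0 R"
    proof
      fix x assume "x \<in> cball w (R/2)"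
      then show "x \<in> cball t0 R" using w dist_triangle[of t0 x w] by simp
    qed
    have hw: "(\<lambda>t. h t z) holomorphic_on cball w (R/2)"
      using hol[OF z] sub R(2) by (rule_tac holomorphic_on_subset) auto
    have "cmod ((deriv ^^ 1) (\<lambda>t. h t z) w) \<le> fact 1 * B z / (R/2) ^ 1"
    proof (rule Cauchy_inequality)
      show "(\<lambda>t. h t z) holomorphic_on ball w (R/2)" using hw by (rule holomorphic_on_subset) auto
      show "continuous_on (cball w (R/2)) (\<lambda>t. h t z)" using hw by (rule holomorphic_on_imp_continuous_on)
      show "cmod (h x z) \<le> B z" if "cmod (w - x) = R/2" for x
        using sub that by (intro le z) (auto simp: dist_norm)
    qed (use R in simp)
    then show ?thesis by (simp add: field_simps)
  qed
  have q_bound: "cmod (?q t z) \<le> 2 * B z / R" if z: "z \<in> space M" and t: "t \<in> ball t0 (R/2)" for t z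
  proof (cases "t = t0")
    case True
    have "0 \<le> cmod (h t0 z)" by simp
    also have "\<dots> \<le> B z" using R(1) by (intro le z) simp
    finally show ?thesis using R(1) True by simp
  next
    case False
    have "cmod (h t z - h t0 z) \<le> 2 * B z / R * cmod (t - t0)"
    proof (rule field_differentiable_bound[where S = "ball t0 (R/2)" and f = "\<lambda>t. h t z" and f' = "deriv (\<lambda>t. h t z)"])
      fix w assume w: "w \<in> ball t0 (R/2)"
      then have "w \<in> cball t0 R" using R(1) by simp
      then have "w \<in> S" using R(2) by blast
      then show "((\<lambda>t. h t z) has_field_derivative deriv (\<lambda>t. h t z) w) (at w within ball t0 (R/2))"
        by (rule has_field_derivative_at_within[OF holomorphic_derivI[OF hol[OF z] S]])
      show "cmod (deriv (\<lambda>t. h t z) w) \<le> 2 * B z / R" by (rule der_bound[OF z w])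
    qed (use t R in auto)
    then show ?thesis using False by (simp add: norm_divide divide_le_eq)
  qed
  have lim: "((\<lambda>t. ?q t z) \<longlongrightarrow> ?h' z) (at t0)" if z: "z \<in> space M" for z
    using holomorphic_derivI[OF hol[OF z] S t0] by (simp add: has_field_derivative_iff)
  have qm: "?q t \<in> borel_measurable M" if "t \<in> ball t0 (R/2)" for t
  proof -
    have "t \<in> S" using that R by (auto intro!: subsetD[OF R(2)])
    then show ?thesis by (intro borel_measurable_divide borel_measurable_diff borel_measurable_const meas t0)
  qed
  have "((\<lambda>t. LINT z|M. ?q t z) \<longlongrightarrow> (LINT z|M. ?h' z)) (at t0)"
    unfolding tendsto_at_iff_sequentially
  proof (intro allI impI)
    fix X assume X: "\<forall>i. X i \<in> UNIV - {t0}" "X \<longlonglongrightarrow> t0"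
    have "\<forall>\<^sub>F n in sequentially. X n \<in> ball t0 (R/2)"
      using R(1) by (intro topological_tendstoD[OF X(2)]) auto
    then obtain N where N: "\<And>n. n \<ge> N \<Longrightarrow> X n \<in> ball t0 (R/2)" unfolding eventually_sequentially by blast
    let ?Y = "\<lambda>n. X (n + N)"
    have Y: "?Y n \<in> ball t0 (R/2)" for n by (rule N) simp
    have Ylim: "(\<lambda>n. ?q (?Y n) z) \<longlonglongrightarrow> ?h' z" if z: "z \<in> space M" for z
    proof -
      have "(\<lambda>n. ?q (X n) z) \<longlonglongrightarrow> ?h' z"
        using lim[OF z] X unfolding tendsto_at_iff_sequentially comp_def by blast
      then show ?thesis by (rule LIMSEQ_ignore_initial_segment)
    qed
    have "(\<lambda>n. LINT z|M. ?q (?Y n) z) \<longlonglongrightarrow> (LINT z|M. ?h' z)"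
    proof (rule integral_dominated_convergence[where w = "\<lambda>z. 2 * B z / R"])
      show "?h' \<in> borel_measurable M"
        by (rule borel_measurable_LIMSEQ_metric[OF qm[OF Y] Ylim])
      show "?q (?Y n) \<in> borel_measurable M" for n by (rule qm[OF Y])
      show "integrable M (\<lambda>z. 2 * B z / R)" using B by simp
      show "AE z in M. (\<lambda>n. ?q (?Y n) z) \<longlonglongrightarrow> ?h' z" by (rule AE_I2) (rule Ylim)
      show "AE z in M. norm (?q (?Y n) z) \<le> 2 * B z / R" for n by (rule AE_I2) (rule q_bound[OF _ Y])
    qed
    then show "((\<lambda>t. LINT z|M. ?q t z) \<circ> X) \<longlonglongrightarrow> (LINT z|M. ?h' z)"
      unfolding comp_def by (rule LIMSEQ_offset)
  qed
  moreover have "\<forall>\<^sub>F t in at t0. (LINT z|M. ?q t z) = (?F t - ?F t0) / (t - t0)"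
  proof -
    have "(LINT z|M. ?q t z) = (?F t - ?F t0) / (t - t0)" if "t \<in> ball t0 R" for t
      using int[of t] int[of t0] that R by simp
    then show ?thesis using R(1) by (intro eventually_at_ball'[THEN eventually_mono]) auto
  qed
  ultimately have "((\<lambda>t. (?F t - ?F t0) / (t - t0)) \<longlongrightarrow> (LINT z|M. ?h' z)) (at t0)"
    by (rule Lim_transform_eventually)
  then show "\<exists>f'. (?F has_field_derivative f') (at t0)"
    unfolding has_field_derivative_iff by blast
qed

section \<open>Left-invariant and right-invariant Toeplitz operators commute\<close>

context bergman_setting
begin

text \<open>By Cauchy's formula the dilation is an average, with a bounded kernel, of the rotations by \<open>circ t\<close>.
The operator commutes with each rotation, because scalar matrices of modulus one are unitary, and
Fubini's theorem moves it inside the average.\<close>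

lemma toep_dil:
  assumes a: "invariant_symbol l a" and f: "f \<in> A2" and \<rho>: "0 < \<rho>" "\<rho> < 1" and Z0: "Z0 \<in> D"
  shows "toep a (dil \<rho> f) Z0 = toep a f (cscale (of_real \<rho>) Z0)"
proof -
  have aL: "a \<in> Linfty" using a by (simp add: invariant_symbol_def)
  obtain \<kappa> where \<kappa>: "\<kappa> \<in> L2" "\<And>g. g \<in> A2 \<Longrightarrow> toep a g Z0 = (LINT Z|\<mu>. g Z * \<kappa> Z)"
    using toep_kernel[OF aL Z0] by blast
  define k where "k t = circ t / (circ t - of_real \<rho>)" for t
  let ?K = "1 / (1 - \<rho>)"
  have kb: "cmod (k t) \<le> ?K" for t
  proof -
    have "1 - \<rho> \<le> cmod (circ t - of_real \<rho>)"
      using norm_triangle_ineq2[of "circ t" "of_real \<rho>"] \<rho> by simp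
    then show ?thesis using \<rho> by (simp add: k_def norm_divide frac_le)
  qed
  have ne: "circ t - of_real \<rho> \<noteq> 0" for t
  proof
    assume "circ t - of_real \<rho> = 0"
    then have "cmod (circ t) = cmod (of_real \<rho>)" by simp
    then show False using \<rho> by simp
  qed
  have km: "k \<in> borel_measurable borel"
    unfolding k_def by (intro borel_measurable_continuous_onI continuous_intros) (use ne in simp)
  let ?f = "\<lambda>t Z. f (cscale (circ t) Z)"
  have rot: "is_symmetry (cscale (circ t) :: 'n cmat \<Rightarrow> 'n cmat)" for t
    using is_symmetry_act[OF cscale_mat1_unitary[OF cmod_circ[of t]], of l]
    by (simp add: act_cscale_left[abs_def])
  have fA: "?f t \<in> A2" for t by (rule A2_symmetry[OF f rot]) (simp add: mult.commute)
  interpret U: finite_measure unit_interval by (rule finite_measure_unit_interval)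
  interpret P: pair_sigma_finite unit_interval \<mu>
    by (simp add: pair_sigma_finite_def U.sigma_finite_measure_axioms M.sigma_finite_measure_axioms)
  let ?F = "\<lambda>t Z. k t * (?f t Z * \<kappa> Z)"
  have idm: "(\<lambda>p. (fst p, snd p)) \<in> (unit_interval \<Otimes>\<^sub>M \<mu>) \<rightarrow>\<^sub>M (borel :: (real \<times> 'n cmat) measure)"
    unfolding borel_prod[symmetric]
    by (intro measurable_Pair measurable_compose[OF measurable_fst borel_measurable_unit_interval]
        measurable_compose[OF measurable_snd id_measurable_\<mu>]) simp
  have cont: "continuous_on UNIV (\<lambda>p::real \<times> 'n cmat. cscale (circ (fst p)) (snd p))"
    unfolding cscale_def by (intro continuous_intros continuous_on_compose2[OF continuous_on_circ[of UNIV]]) auto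
  have m1: "(\<lambda>p. ?f (fst p) (snd p)) \<in> borel_measurable (unit_interval \<Otimes>\<^sub>M \<mu>)"
    using measurable_compose[OF idm measurable_compose[OF borel_measurable_continuous_onI[OF cont] A2_borel[OF f]]]
    by simp
  have m2: "(\<lambda>p. \<kappa> (snd p)) \<in> borel_measurable (unit_interval \<Otimes>\<^sub>M \<mu>)"
    by (rule measurable_compose[OF measurable_snd L2D(1)[OF \<kappa>(1)]])
  have m3: "(\<lambda>p. k (fst p)) \<in> borel_measurable (unit_interval \<Otimes>\<^sub>M \<mu>)"
    by (rule measurable_compose[OF measurable_fst borel_measurable_unit_interval[OF km]])
  have meas: "(\<lambda>p. ?F (fst p) (snd p)) \<in> borel_measurable (unit_interval \<Otimes>\<^sub>M \<mu>)"
    by (intro borel_measurable_times m1 m2 m3)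
  define C where "C = ?K * (sqn f + sqn \<kappa>)"
  have int: "integrable (unit_interval \<Otimes>\<^sub>M \<mu>) (case_prod ?F)"
  proof (rule integrableI_bounded)
    show "case_prod ?F \<in> borel_measurable (unit_interval \<Otimes>\<^sub>M \<mu>)" using meas by (simp add: case_prod_beta')
    have nm: "(\<lambda>p. ennreal (norm (case_prod ?F p))) \<in> borel_measurable (unit_interval \<Otimes>\<^sub>M \<mu>)"
      using meas by (simp add: case_prod_beta')
    have inner: "(\<integral>\<^sup>+Z. ennreal (norm (?F t Z)) \<partial>\<mu>) \<le> ennreal C" for t
    proof -
      have i: "integrable \<mu> (\<lambda>Z. ?K * ((cmod (?f t Z))\<^sup>2 + (cmod (\<kappa> Z))\<^sup>2))"
        by (intro integrable_mult_right Bochner_Integration.integrable_add L2D(2) A2D(1)[OF fA] \<kappa>(1))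
      have "(\<integral>\<^sup>+Z. ennreal (norm (?F t Z)) \<partial>\<mu>) \<le> (\<integral>\<^sup>+Z. ennreal (?K * ((cmod (?f t Z))\<^sup>2 + (cmod (\<kappa> Z))\<^sup>2)) \<partial>\<mu>)"
      proof (intro nn_integral_mono ennreal_leI)
        fix Z
        have "cmod (k t * (?f t Z * \<kappa> Z)) = cmod (k t) * cmod (?f t Z * \<kappa> Z)" by (rule norm_mult)
        also have "\<dots> \<le> ?K * ((cmod (?f t Z))\<^sup>2 + (cmod (\<kappa> Z))\<^sup>2)"
          using \<rho> by (intro mult_mono kb cmod_mult_le_squares) auto
        finally show "norm (?F t Z) \<le> ?K * ((cmod (?f t Z))\<^sup>2 + (cmod (\<kappa> Z))\<^sup>2)" .
      qed
      also have "\<dots> = ennreal (LINT Z|\<mu>. ?K * ((cmod (?f t Z))\<^sup>2 + (cmod (\<kappa> Z))\<^sup>2))"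
        by (rule nn_integral_eq_integral[OF i]) (use \<rho> in simp)
      also have "(LINT Z|\<mu>. ?K * ((cmod (?f t Z))\<^sup>2 + (cmod (\<kappa> Z))\<^sup>2)) = ?K * (sqn (?f t) + sqn \<kappa>)"
        unfolding sqn_def integral_mult_right_zero
        by (subst Bochner_Integration.integral_add) (intro L2D(2) A2D(1)[OF fA] \<kappa>(1) refl)+
      also have "sqn (?f t) = sqn f"
      proof -
        have "(\<lambda>Z. (cmod (f Z))\<^sup>2) \<in> borel_measurable \<mu>"
          using L2D(1)[OF A2D(1)[OF f]] by simp
        from integral_symmetry(1)[OF rot this] show ?thesis unfolding sqn_def .
      qed
      finally show ?thesis unfolding C_def .
    qed
    have "(\<integral>\<^sup>+p. ennreal (norm (case_prod ?F p)) \<partial>(unit_interval \<Otimes>\<^sub>M \<mu>)) = (\<integral>\<^sup>+t. \<integral>\<^sup>+Z. ennreal (norm (?F t Z)) \<partial>\<mu> \<partial>unit_interval)"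
      using M.nn_integral_fst[OF nm] by simp
    also have "\<dots> \<le> (\<integral>\<^sup>+t. ennreal C \<partial>unit_interval)" by (intro nn_integral_mono inner)
    also have "\<dots> < \<infinity>" using emeasure_unit_interval by simp
    finally show "(\<integral>\<^sup>+p. ennreal (norm (case_prod ?F p)) \<partial>(unit_interval \<Otimes>\<^sub>M \<mu>)) < \<infinity>" .
  qed
  have "toep a (dil \<rho> f) Z0 = (LINT Z|\<mu>. dil \<rho> f Z * \<kappa> Z)" by (rule \<kappa>(2)[OF dil_A2[OF f \<rho>]])
  also have "\<dots> = (LINT Z|\<mu>. (LINT t|unit_interval. ?F t Z))"
  proof (intro Bochner_Integration.integral_cong refl)
    fix Z assume "Z \<in> space \<mu>"
    then have Z: "Z \<in> D" by simp
    have "dil \<rho> f Z * \<kappa> Z = (LINT t|unit_interval. ?f t Z * k t) * \<kappa> Z"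
      using Cauchy_dil[OF f Z \<rho>] Z by (simp add: dil_def k_def)
    also have "\<dots> = (LINT t|unit_interval. ?f t Z * k t * \<kappa> Z)" by (rule integral_mult_left_zero[symmetric])
    finally show "dil \<rho> f Z * \<kappa> Z = (LINT t|unit_interval. ?F t Z)" by (simp only: mult_ac)
  qed
  also have "\<dots> = (LINT t|unit_interval. (LINT Z|\<mu>. ?F t Z))"
    by (rule P.Fubini_integral[OF int])
  also have "\<dots> = (LINT t|unit_interval. toep a f (cscale (circ t) Z0) * k t)"
  proof (intro Bochner_Integration.integral_cong refl)
    fix t
    have "(LINT Z|\<mu>. ?F t Z) = k t * (LINT Z|\<mu>. ?f t Z * \<kappa> Z)" by (rule integral_mult_right_zero)
    also have "(LINT Z|\<mu>. ?f t Z * \<kappa> Z) = toep a (?f t) Z0" by (rule \<kappa>(2)[OF fA, symmetric])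
    also have "toep a (?f t) = (\<lambda>Z. toep a f (cscale (circ t) Z))" by (rule toep_rotate[OF a cmod_circ f])
    finally show "(LINT Z|\<mu>. ?F t Z) = toep a f (cscale (circ t) Z0) * k t" by (simp only: mult.commute)
  qed
  also have "\<dots> = toep a f (cscale (of_real \<rho>) Z0)"
    using Cauchy_dil[OF toep_A2[OF aL f] Z0 \<rho>] by (simp only: k_def)
  finally show ?thesis .
qed

lemma act_nth: "act l X Z $ i $ j = (\<Sum>k\<in>UNIV. if l then X $ i $ k * Z $ k $ j else Z $ i $ k * X $ k $ j)"
  by (simp add: act_def matrix_matrix_mult_def)

lemma opn_act_le: "opn (act l X Z) \<le> opn X * opn Z"
  using opn_mult_le[of X Z] opn_mult_le[of Z X] by (simp add: act_def mult.commute)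

text \<open>For \<open>t\<close> near a given point the matrices \<open>act l (C t) Z\<close> stay in a compact part of the domain, where
\<open>f\<close> is bounded; the integrand is then dominated by a multiple of \<open>\<kappa>\<close>.\<close>

lemma kernel_integral_holomorphic:
  fixes C :: "complex \<Rightarrow> 'n cmat"
  assumes f: "f \<in> A2" and \<kappa>: "\<kappa> \<in> L2" and S: "open S"
    and C: "\<And>i j. (\<lambda>t. C t $ i $ j) holomorphic_on S" and CD: "\<And>t. t \<in> S \<Longrightarrow> C t \<in> D"
  shows "(\<lambda>t. LINT Z|\<mu>. f (act l (C t) Z) * \<kappa> Z) holomorphic_on S"
proof (rule holomorphic_param_integral[OF S])
  have actD: "act l (C t) Z \<in> D" if "t \<in> S" "Z \<in> D" for t Z
    using CD[OF that(1)] that(2) by (intro act_in_domain) (auto simp: cartan_domain_iff)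
  fix Z assume "Z \<in> space \<mu>"
  then have Z: "Z \<in> D" by simp
  have "(\<lambda>t. f (act l (C t) Z)) holomorphic_on S"
  proof (rule holomorphic_mat_curve[OF A2D(2)[OF f] open_cartan_domain S])
    show "(\<lambda>t. act l (C t) Z $ i $ j) holomorphic_on S" for i j
      unfolding act_nth by (cases l) (auto intro!: holomorphic_intros C)
  qed (rule actD[OF _ Z])
  then show "(\<lambda>t. f (act l (C t) Z) * \<kappa> Z) holomorphic_on S" by (intro holomorphic_intros)
next
  fix t
  have "(\<lambda>Z. f (act l (C t) Z)) \<in> borel_measurable borel"
  proof (rule measurable_compose[OF _ A2_borel[OF f]])
    have "bounded_linear (act l (C t))" using linear_act linear_conv_bounded_linear by blast
    then show "act l (C t) \<in> borel_measurable borel"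
      by (intro borel_measurable_continuous_onI linear_continuous_on)
  qed
  then show "(\<lambda>Z. f (act l (C t) Z) * \<kappa> Z) \<in> borel_measurable \<mu>"
    by (intro borel_measurable_times borel_measurable_\<mu> L2D(1)[OF \<kappa>])
next
  fix t0 assume t0: "t0 \<in> S"
  define q where "q = (opn (C t0) + 1) / 2"
  have q: "opn (C t0) < q" "q < 1" using CD[OF t0] by (auto simp: q_def cartan_domain_iff)
  obtain B where B: "0 \<le> B" "\<And>Z. opn Z \<le> q \<Longrightarrow> cmod (f Z) \<le> B" using bounded_on_opn_le[OF f q(2)] by blast
  have contC: "continuous_on S C"
  proof -
    have "continuous_on S (\<lambda>t. \<chi> i j. C t $ i $ j)"
      by (intro continuous_on_vec_lambda holomorphic_on_imp_continuous_on C)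
    then show ?thesis by simp
  qed
  have "open {t \<in> S. opn (C t) < q}"
  proof -
    have "continuous_on S (\<lambda>t. opn (C t))"
      by (rule continuous_on_compose2[OF continuous_on_opn[of UNIV] contC]) auto
    then have "open (S \<inter> (\<lambda>t. opn (C t)) -` {..<q})" by (rule continuous_open_preimage[OF _ S]) simp
    moreover have "S \<inter> (\<lambda>t. opn (C t)) -` {..<q} = {t \<in> S. opn (C t) < q}" by auto
    ultimately show ?thesis by simp
  qed
  moreover have "t0 \<in> {t \<in> S. opn (C t) < q}" using t0 q by simp
  ultimately obtain R where R: "0 < R" "cball t0 R \<subseteq> {t \<in> S. opn (C t) < q}"
    unfolding open_contains_cball by blast
  have bnd: "cmod (f (act l (C t) Z) * \<kappa> Z) \<le> B * cmod (\<kappa> Z)" if "t \<in> cball t0 R" "Z \<in> space \<mu>" for t Z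
  proof -
    have t: "opn (C t) < q" using that(1) R(2) by blast
    have Z: "opn Z < 1" using that(2) by (simp add: cartan_domain_iff)
    have "opn (act l (C t) Z) \<le> opn (C t) * opn Z" by (rule opn_act_le)
    also have "\<dots> \<le> q * 1" using t Z opn_nonneg[of Z] opn_nonneg[of "C t"] by (intro mult_mono) auto
    finally have "cmod (f (act l (C t) Z)) \<le> B" by (intro B(2)) simp
    then show ?thesis by (simp add: norm_mult mult_right_mono)
  qed
  show "\<exists>R>0. \<exists>Bd. cball t0 R \<subseteq> S \<and> integrable \<mu> Bd \<and>
      (\<forall>t\<in>cball t0 R. \<forall>Z\<in>space \<mu>. cmod (f (act l (C t) Z) * \<kappa> Z) \<le> Bd Z)"
  proof (intro exI[of _ R] exI[of _ "\<lambda>Z. B * cmod (\<kappa> Z)"] conjI ballI)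
    show "cball t0 R \<subseteq> S" using R(2) by blast
    show "integrable \<mu> (\<lambda>Z. B * cmod (\<kappa> Z))"
      by (intro integrable_mult_right integrable_norm L2_imp_integrable \<kappa>)
  qed (use R(1) bnd in auto)
qed

text \<open>The kernel \<open>\<kappa>\<close> belongs to the evaluation at \<open>\<rho>I\<close>.  For \<open>Y = \<rho>U\<close> with \<open>U\<close> unitary the formula says that
the operator commutes with the dilation and with the action of \<open>U\<close>; it extends to all \<open>Y\<close> because
the unitary group is a set of uniqueness.\<close>

lemma toep_integral_representation:
  assumes a: "invariant_symbol l a" and \<rho>: "0 < \<rho>" "\<rho> < 1"
  obtains \<kappa> where "\<kappa> \<in> L2"
    "\<And>f Y. f \<in> A2 \<Longrightarrow> Y \<in> D \<Longrightarrow> toep a f (cscale (of_real \<rho>) Y) = (LINT Z|\<mu>. f (act l Y Z) * \<kappa> Z)"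
proof -
  have aL: "a \<in> Linfty" using a by (simp add: invariant_symbol_def)
  let ?r = "complex_of_real \<rho>"
  let ?Z0 = "cscale ?r (mat 1) :: 'n cmat"
  have opn1: "opn (mat 1 :: 'n cmat) \<le> 1" by (rule opn_le) simp
  have scD: "cscale ?r X \<in> D" if "opn X \<le> 1" for X :: "'n cmat"
  proof -
    have "opn (cscale ?r X) \<le> \<rho> * opn X" using opn_cscale_le[of ?r X] \<rho> by simp
    also have "\<dots> \<le> \<rho> * 1" using that \<rho> by (intro mult_left_mono) auto
    finally show ?thesis using \<rho> by (simp add: cartan_domain_iff)
  qed
  have Z0: "?Z0 \<in> D" by (rule scD[OF opn1])
  obtain \<kappa> where \<kappa>: "\<kappa> \<in> L2" "\<And>g. g \<in> A2 \<Longrightarrow> toep a g ?Z0 = (LINT Z|\<mu>. g Z * \<kappa> Z)"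
    using toep_kernel[OF aL Z0] by blast
  have "toep a f (cscale ?r Y) = (LINT Z|\<mu>. f (act l Y Z) * \<kappa> Z)" if f: "f \<in> A2" and Y: "Y \<in> D" for f Y
  proof -
    \<comment> \<open>In the variable \<open>X = Y / \<rho>\<close> the points where the formula is known are the unitary matrices.\<close>
    define \<Omega> where "\<Omega> = (cscale ?r :: 'n cmat \<Rightarrow> 'n cmat) -` D"
    define G where "G X = toep a f (cscale ?r (cscale ?r X)) - (LINT Z|\<mu>. f (act l (cscale ?r X) Z) * \<kappa> Z)" for X
    have "G (cscale (1/?r) Y) = 0"
    proof (rule unitary_uniqueness[where \<Omega> = \<Omega>])
      have "continuous_on UNIV (cscale ?r :: 'n cmat \<Rightarrow> 'n cmat)"
        unfolding cscale_def[abs_def] by (intro continuous_intros)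
      then show "open \<Omega>" unfolding \<Omega>_def by (rule open_vimage[OF open_cartan_domain])
      show "convex \<Omega>" unfolding \<Omega>_def by (rule convex_linear_vimage[OF linear_cscale convex_cartan_domain])
      show "mat 1 \<in> \<Omega>" using Z0 by (simp add: \<Omega>_def)
      show "cscale (1/?r) Y \<in> \<Omega>" using Y \<rho> by (simp add: \<Omega>_def)
    next
      fix S and C :: "complex \<Rightarrow> 'n cmat"
      assume S: "open S" and C: "\<And>i j. (\<lambda>t. C t $ i $ j) holomorphic_on S" and CO: "\<And>t. t \<in> S \<Longrightarrow> C t \<in> \<Omega>"
      have CD: "cscale ?r (C t) \<in> D" if "t \<in> S" for t using CO[OF that] by (simp add: \<Omega>_def)
      have hC: "(\<lambda>t. cscale ?r (C t) $ i $ j) holomorphic_on S" for i j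
        unfolding cscale_nth by (intro holomorphic_intros C)
      have "(\<lambda>t. toep a f (cscale ?r (cscale ?r (C t)))) holomorphic_on S"
      proof (rule holomorphic_mat_curve[OF A2D(2)[OF toep_A2[OF aL f]] open_cartan_domain S])
        show "(\<lambda>t. cscale ?r (cscale ?r (C t)) $ i $ j) holomorphic_on S" for i j
          unfolding cscale_nth by (intro holomorphic_intros C)
        show "cscale ?r (cscale ?r (C t)) \<in> D" if "t \<in> S" for t
          using \<rho> by (intro cartan_domain_cscale CD[OF that]) simp
      qed
      then show "(\<lambda>t. G (C t)) holomorphic_on S"
        unfolding G_def by (intro holomorphic_on_diff kernel_integral_holomorphic[OF f \<kappa>(1) S hC CD])
    next
      fix U :: "'n cmat" assume U: "U \<in> unitary_group"
      have UD: "cscale ?r U \<in> D" by (rule scD[OF unitary_opn_le[OF U]])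
      have dA: "dil \<rho> f \<in> A2" by (rule dil_A2[OF f \<rho>])
      have dU: "(\<lambda>Z. dil \<rho> f (act l U Z)) \<in> A2"
        by (rule A2_symmetry[OF dA is_symmetry_act[OF U] act_cscale])
      have "toep a f (cscale ?r (cscale ?r U)) = toep a (dil \<rho> f) (cscale ?r U)"
        by (rule toep_dil[OF a f \<rho> UD, symmetric])
      also have "\<dots> = toep a (dil \<rho> f) (act l U ?Z0)" by (simp add: act_cscale)
      also have "\<dots> = toep a (\<lambda>Z. dil \<rho> f (act l U Z)) ?Z0" by (simp only: toep_act[OF a U dA])
      also have "\<dots> = (LINT Z|\<mu>. dil \<rho> f (act l U Z) * \<kappa> Z)" by (rule \<kappa>(2)[OF dU])
      also have "\<dots> = (LINT Z|\<mu>. f (act l (cscale ?r U) Z) * \<kappa> Z)"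
      proof (intro Bochner_Integration.integral_cong refl)
        fix Z assume "Z \<in> space \<mu>"
        then have "act l U Z \<in> D" using act_in_domain_iff[OF U] by simp
        then show "dil \<rho> f (act l U Z) * \<kappa> Z = f (act l (cscale ?r U) Z) * \<kappa> Z"
          by (simp add: dil_def act_cscale_left)
      qed
      finally show "G U = 0" by (simp add: G_def)
    qed
    moreover have "cscale ?r (cscale (1/?r) Y) = Y" using \<rho> by simp
    ultimately show ?thesis unfolding G_def by (simp only: right_minus_eq)
  qed
  with \<kappa>(1) that show ?thesis by blast
qed

text \<open>The representation by kernels, applied twice, turns both compositions into integrals of
\<open>f (W X Z)\<close> against a product of kernels, where \<open>W\<close> enters from the left and \<open>Z\<close> from the right; they
differ only in the order of integration.\<close>

lemma toep_commute:
  assumes a: "invariant_symbol True a" and b: "invariant_symbol False b" and f: "f \<in> A2"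
  shows "toep a (toep b f) = toep b (toep a f)"
proof
  fix X0 :: "'n cmat"
  have aL: "a \<in> Linfty" and bL: "b \<in> Linfty" using a b by (auto simp: invariant_symbol_def)
  have bf: "toep b f \<in> A2" and af: "toep a f \<in> A2" by (rule toep_A2[OF bL f], rule toep_A2[OF aL f])
  show "toep a (toep b f) X0 = toep b (toep a f) X0"
  proof (cases "X0 \<in> D")
    case False
    then show ?thesis using A2D(3)[OF toep_A2[OF aL bf]] A2D(3)[OF toep_A2[OF bL af]] by simp
  next
    case True
    \<comment> \<open>The number \<open>\<rho>\<^sup>2\<close> lies strictly between \<open>opn X0\<close> and 1, so \<open>X0 = \<rho>\<^sup>2 X\<close> with \<open>X\<close> in the domain.\<close>
    define \<rho> where "\<rho> = sqrt ((opn X0 + 1) / 2)"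
    have o: "0 \<le> opn X0" "opn X0 < 1" using True opn_nonneg[of X0] by (auto simp: cartan_domain_iff)
    have \<rho>2: "\<rho>\<^sup>2 = (opn X0 + 1) / 2" using o by (simp add: \<rho>_def)
    have \<rho>: "0 < \<rho>" "\<rho> < 1" using o by (auto simp: \<rho>_def)
    let ?r = "complex_of_real \<rho>"
    define X where "X = cscale (1 / ?r\<^sup>2) X0"
    have XD: "X \<in> D"
    proof -
      have "opn X \<le> cmod (1 / ?r\<^sup>2) * opn X0" unfolding X_def by (rule opn_cscale_le)
      also have "cmod (1 / ?r\<^sup>2) = 1 / \<rho>\<^sup>2" using \<rho> by (simp add: norm_divide norm_power)
      also have "1 / \<rho>\<^sup>2 * opn X0 < 1" using o unfolding \<rho>2 by (simp add: divide_less_eq)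
      finally show ?thesis by (simp add: cartan_domain_iff)
    qed
    have X0: "X0 = cscale ?r (cscale ?r X)" using \<rho> by (simp add: X_def power2_eq_square)
    have rX: "cscale ?r X \<in> D" using \<rho> by (intro cartan_domain_cscale XD) simp
    obtain \<kappa>a where \<kappa>a: "\<kappa>a \<in> L2"
      and ra: "\<And>f Y. f \<in> A2 \<Longrightarrow> Y \<in> D \<Longrightarrow> toep a f (cscale ?r Y) = (LINT Z|\<mu>. f (act True Y Z) * \<kappa>a Z)"
      using toep_integral_representation[OF a \<rho>] by blast
    obtain \<kappa>b where \<kappa>b: "\<kappa>b \<in> L2"
      and rb: "\<And>f Y. f \<in> A2 \<Longrightarrow> Y \<in> D \<Longrightarrow> toep b f (cscale ?r Y) = (LINT Z|\<mu>. f (act False Y Z) * \<kappa>b Z)"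
      using toep_integral_representation[OF b \<rho>] by blast
    let ?F = "\<lambda>Z W. f (W ** X ** Z) * \<kappa>b W * \<kappa>a Z"
    have XZ: "X ** Z \<in> D" if "Z \<in> D" for Z
      using XD that by (intro cartan_domain_mult_left) (auto simp: cartan_domain_iff)
    have WX: "W ** X \<in> D" if "W \<in> D" for W
      using XD that by (intro cartan_domain_mult_right) (auto simp: cartan_domain_iff)
    have ab: "toep a (toep b f) X0 = (LINT Z|\<mu>. (LINT W|\<mu>. ?F Z W))"
    proof -
      have "toep a (toep b f) X0 = (LINT Z|\<mu>. toep b f (act True (cscale ?r X) Z) * \<kappa>a Z)"
        unfolding X0 by (rule ra[OF bf rX])
      also have "\<dots> = (LINT Z|\<mu>. (LINT W|\<mu>. ?F Z W))"
      proof (intro Bochner_Integration.integral_cong refl)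
        fix Z assume "Z \<in> space \<mu>"
        then have Z: "Z \<in> D" by simp
        have "toep b f (act True (cscale ?r X) Z) = toep b f (cscale ?r (X ** Z))"
          by (simp add: act_def cscale_mult_left)
        also have "\<dots> = (LINT W|\<mu>. f (W ** X ** Z) * \<kappa>b W)"
          using rb[OF f XZ[OF Z]] by (simp add: act_def matrix_mul_assoc)
        finally show "toep b f (act True (cscale ?r X) Z) * \<kappa>a Z = (LINT W|\<mu>. ?F Z W)"
          by (simp only: integral_mult_left_zero)
      qed
      finally show ?thesis .
    qed
    have ba: "toep b (toep a f) X0 = (LINT W|\<mu>. (LINT Z|\<mu>. ?F Z W))"
    proof -
      have "toep b (toep a f) X0 = (LINT W|\<mu>. toep a f (act False (cscale ?r X) W) * \<kappa>b W)"
        unfolding X0 by (rule rb[OF af rX])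
      also have "\<dots> = (LINT W|\<mu>. (LINT Z|\<mu>. ?F Z W))"
      proof (intro Bochner_Integration.integral_cong refl)
        fix W assume "W \<in> space \<mu>"
        then have W: "W \<in> D" by simp
        have "toep a f (act False (cscale ?r X) W) = toep a f (cscale ?r (W ** X))"
          by (simp add: act_def cscale_mult_right)
        also have "\<dots> = (LINT Z|\<mu>. f (W ** X ** Z) * \<kappa>a Z)"
          using ra[OF f WX[OF W]] by (simp add: act_def)
        finally have "toep a f (act False (cscale ?r X) W) * \<kappa>b W = (LINT Z|\<mu>. f (W ** X ** Z) * \<kappa>a Z * \<kappa>b W)"
          by (simp only: integral_mult_left_zero)
        then show "toep a f (act False (cscale ?r X) W) * \<kappa>b W = (LINT Z|\<mu>. ?F Z W)"
          by (simp only: mult_ac)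
      qed
      finally show ?thesis .
    qed
    interpret P: pair_sigma_finite \<mu> \<mu>
      by (simp add: pair_sigma_finite_def M.sigma_finite_measure_axioms)
    have "integrable (\<mu> \<Otimes>\<^sub>M \<mu>) (case_prod ?F)"
    proof -
      have oX: "opn X < 1" using XD by (simp add: cartan_domain_iff)
      obtain B where B: "0 \<le> B" "\<And>Z. opn Z \<le> opn X \<Longrightarrow> cmod (f Z) \<le> B"
        using bounded_on_opn_le[OF f oX] by blast
      have idm: "(\<lambda>p. (fst p, snd p)) \<in> (\<mu> \<Otimes>\<^sub>M \<mu>) \<rightarrow>\<^sub>M (borel :: ('n cmat \<times> 'n cmat) measure)"
        unfolding borel_prod[symmetric]
        by (intro measurable_Pair measurable_compose[OF measurable_fst id_measurable_\<mu>]
            measurable_compose[OF measurable_snd id_measurable_\<mu>])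
      have cont: "continuous_on UNIV (\<lambda>p::'n cmat \<times> 'n cmat. snd p ** X ** fst p)"
        unfolding matrix_matrix_mult_def by (intro continuous_intros)
      have m1: "(\<lambda>p. f (snd p ** X ** fst p)) \<in> borel_measurable (\<mu> \<Otimes>\<^sub>M \<mu>)"
        using measurable_compose[OF idm measurable_compose[OF borel_measurable_continuous_onI[OF cont] A2_borel[OF f]]]
        by simp
      have m2: "(\<lambda>p. \<kappa>b (snd p)) \<in> borel_measurable (\<mu> \<Otimes>\<^sub>M \<mu>)"
        by (rule measurable_compose[OF measurable_snd L2D(1)[OF \<kappa>b]])
      have m3: "(\<lambda>p. \<kappa>a (fst p)) \<in> borel_measurable (\<mu> \<Otimes>\<^sub>M \<mu>)"
        by (rule measurable_compose[OF measurable_fst L2D(1)[OF \<kappa>a]])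
      have meas: "(\<lambda>p. ?F (fst p) (snd p)) \<in> borel_measurable (\<mu> \<Otimes>\<^sub>M \<mu>)"
        by (intro borel_measurable_times m1 m2 m3)
      have norm_borel: "(cmod :: complex \<Rightarrow> real) \<in> borel_measurable borel"
        by (intro borel_measurable_continuous_onI continuous_intros)
      have prod_int: "integrable (\<mu> \<Otimes>\<^sub>M \<mu>) (\<lambda>(Z, V). (B * cmod (\<kappa>a Z)) * cmod (\<kappa>b V))"
      proof (rule P.Fubini_integrable)
        show "(\<lambda>(Z, V). (B * cmod (\<kappa>a Z)) * cmod (\<kappa>b V)) \<in> borel_measurable (\<mu> \<Otimes>\<^sub>M \<mu>)"
          unfolding case_prod_beta'
          by (intro borel_measurable_times borel_measurable_const
              measurable_compose[OF m2 norm_borel] measurable_compose[OF m3 norm_borel])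
        have ia: "integrable \<mu> (\<lambda>Z. cmod (\<kappa>a Z))" and ib: "integrable \<mu> (\<lambda>W. cmod (\<kappa>b W))"
          by (intro integrable_norm L2_imp_integrable \<kappa>a \<kappa>b)+
        show "AE Z in \<mu>. integrable \<mu> (\<lambda>V. (\<lambda>(Z, V). (B * cmod (\<kappa>a Z)) * cmod (\<kappa>b V)) (Z, V))"
          using ib by simp
        show "integrable \<mu> (\<lambda>Z. LINT V|\<mu>. norm ((\<lambda>(Z, V). (B * cmod (\<kappa>a Z)) * cmod (\<kappa>b V)) (Z, V)))"
          using ia B(1) by (simp add: abs_mult)
      qed
      show ?thesis
      proof (rule Bochner_Integration.integrable_bound[OF prod_int])
        show "case_prod ?F \<in> borel_measurable (\<mu> \<Otimes>\<^sub>M \<mu>)" using meas by (simp add: case_prod_beta')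
        show "AE p in \<mu> \<Otimes>\<^sub>M \<mu>. norm (case_prod ?F p) \<le> norm ((\<lambda>(Z, V). (B * cmod (\<kappa>a Z)) * cmod (\<kappa>b V)) p)"
        proof (rule AE_I2)
          fix p assume "p \<in> space (\<mu> \<Otimes>\<^sub>M \<mu>)"
          then obtain Z V where p: "p = (Z, V)" "opn Z < 1" "opn V < 1"
            by (auto simp: space_pair_measure cartan_domain_iff)
          have "opn (V ** X ** Z) \<le> (opn V * opn X) * opn Z"
            by (rule order_trans[OF opn_mult_le mult_right_mono[OF opn_mult_le opn_nonneg]])
          also have "\<dots> \<le> (1 * opn X) * 1"
            using p opn_nonneg[of X] opn_nonneg[of Z] by (intro mult_mono mult_right_mono) auto
          finally have "cmod (f (V ** X ** Z)) \<le> B" by (intro B(2)) simp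
          then have "cmod (f (V ** X ** Z)) * (cmod (\<kappa>b V) * cmod (\<kappa>a Z)) \<le> B * (cmod (\<kappa>b V) * cmod (\<kappa>a Z))"
            by (intro mult_right_mono) auto
          then show "norm (case_prod ?F p) \<le> norm ((\<lambda>(Z, V). (B * cmod (\<kappa>a Z)) * cmod (\<kappa>b V)) p)"
            using B(1) by (simp add: p(1) norm_mult abs_mult mult_ac)
        qed
      qed
    qed
    from P.Fubini_integral[OF this] show ?thesis unfolding ab ba by simp
  qed
qed

end

section \<open>Commutants of sets of bounded operators\<close>

definition commutant :: "real \<Rightarrow> 'n::finite bop set \<Rightarrow> 'n bop set" where
  "commutant lam X = {T \<in> bounded_ops lam. \<forall>S\<in>X. op_mult lam T S = op_mult lam S T}"

context bergman_setting
begin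

abbreviation BO :: "'n bop set" where "BO \<equiv> bounded_ops lam"
abbreviation nrm :: "('n cmat \<Rightarrow> complex) \<Rightarrow> real" where "nrm \<equiv> L2_norm lam"

lemma BO_D:
  assumes "T \<in> BO"
  shows "f \<in> A2 \<Longrightarrow> T f \<in> A2" "f \<notin> A2 \<Longrightarrow> T f = undefined"
    "f \<in> A2 \<Longrightarrow> g \<in> A2 \<Longrightarrow> T (\<lambda>Z. f Z + g Z) = (\<lambda>Z. T f Z + T g Z)"
    "f \<in> A2 \<Longrightarrow> T (\<lambda>Z. c * f Z) = (\<lambda>Z. c * T f Z)"
  using assms by (auto simp: bounded_ops_def PiE_def extensional_def)

lemma BO_bound:
  assumes "T \<in> BO"
  obtains K where "0 \<le> K" "\<And>f. f \<in> A2 \<Longrightarrow> nrm (T f) \<le> K * nrm f"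
proof -
  obtain K where K: "\<And>f. f \<in> A2 \<Longrightarrow> nrm (T f) \<le> K * nrm f"
    using assms unfolding bounded_ops_def by blast
  have n: "0 \<le> nrm f" for f by (simp add: L2_norm_sqn sqn_nonneg)
  have "nrm (T f) \<le> max K 0 * nrm f" if "f \<in> A2" for f
    by (rule order_trans[OF K[OF that] mult_right_mono[OF _ n]]) simp
  then show ?thesis using that[of "max K 0"] by simp
qed

lemma nrm_nonneg: "0 \<le> nrm f"
  by (simp add: L2_norm_sqn sqn_nonneg)

lemma nrm_cmult: "nrm (\<lambda>Z. c * f Z) = cmod c * nrm f"
  by (simp add: L2_norm_sqn sqn_cmult real_sqrt_mult)

lemma nrm_triangle:
  assumes f: "f \<in> L2" and g: "g \<in> L2"
  shows "nrm (\<lambda>Z. f Z + g Z) \<le> nrm f + nrm g"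
proof -
  have cs: "cmod (ip f g) \<le> nrm f * nrm g"
  proof (rule power2_le_imp_le)
    show "(cmod (ip f g))\<^sup>2 \<le> (nrm f * nrm g)\<^sup>2"
      using Cauchy_Schwarz[OF f g] by (simp add: L2_norm_sqn power_mult_distrib sqn_nonneg)
  qed (simp add: nrm_nonneg)
  have "sqn (\<lambda>Z. f Z + g Z) = sqn f + 2 * Re (ip f g) + sqn g"
    using sqn_diff_cmult[OF f g, of "-1"] by simp
  also have "\<dots> \<le> sqn f + 2 * (nrm f * nrm g) + sqn g"
    using cs complex_Re_le_cmod[of "ip f g"] by linarith
  also have "\<dots> = (nrm f + nrm g)\<^sup>2"
    by (simp add: power2_sum L2_norm_sqn sqn_nonneg)
  finally show ?thesis
    unfolding L2_norm_sqn[of "\<lambda>Z. f Z + g Z"] by (rule real_le_lsqrt[OF add_nonneg_nonneg[OF nrm_nonneg nrm_nonneg]])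
qed

lemma nrm_zero: "f \<in> A2 \<Longrightarrow> nrm f = 0 \<Longrightarrow> f = (\<lambda>Z. 0)"
  by (rule A2_eq_zero) (simp_all add: L2_norm_sqn)

text \<open>The supremum that defines the operator norm is taken over a bounded set because the operator is
bounded.\<close>

lemma op_norm_bound:
  assumes T: "T \<in> BO" and f: "f \<in> A2"
  shows "nrm (T f) \<le> op_norm lam T * nrm f"
proof -
  obtain K where K: "0 \<le> K" "\<And>f. f \<in> A2 \<Longrightarrow> nrm (T f) \<le> K * nrm f" using BO_bound[OF T] by blast
  let ?B = "{f \<in> A2. nrm f \<le> 1}"
  have bdd: "bdd_above ((\<lambda>f. nrm (T f)) ` ?B)"
  proof (rule bdd_aboveI2)
    fix f assume "f \<in> ?B"
    then have "nrm (T f) \<le> K * nrm f" "nrm f \<le> 1" using K(2) by auto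
    then show "nrm (T f) \<le> K" using mult_left_mono[of "nrm f" 1 K] K(1) by simp
  qed
  show ?thesis
  proof (cases "nrm f = 0")
    case True
    then show ?thesis using K(2)[OF f] nrm_nonneg[of "T f"] by simp
  next
    case False
    then have n: "0 < nrm f" using nrm_nonneg[of f] by linarith
    let ?c = "complex_of_real (1 / nrm f)"
    have cf: "(\<lambda>Z. ?c * f Z) \<in> A2" by (rule A2_cmult[OF f])
    have "cmod ?c * nrm f = 1" using n by (simp add: norm_divide)
    then have "(\<lambda>Z. ?c * f Z) \<in> ?B" using cf nrm_cmult[of ?c f] by simp
    then have "nrm (T (\<lambda>Z. ?c * f Z)) \<le> op_norm lam T"
      unfolding op_norm_def by (rule cSUP_upper[OF _ bdd])
    also have "nrm (T (\<lambda>Z. ?c * f Z)) = nrm (T f) / nrm f"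
      unfolding BO_D(4)[OF T f] nrm_cmult using n by (simp add: norm_divide)
    finally show ?thesis using n by (simp add: divide_le_eq)
  qed
qed

lemma BO_I:
  assumes "\<And>f. f \<in> A2 \<Longrightarrow> T f \<in> A2" "\<And>f. f \<notin> A2 \<Longrightarrow> T f = undefined"
    "\<And>f g. f \<in> A2 \<Longrightarrow> g \<in> A2 \<Longrightarrow> T (\<lambda>Z. f Z + g Z) = (\<lambda>Z. T f Z + T g Z)"
    "\<And>c f. f \<in> A2 \<Longrightarrow> T (\<lambda>Z. c * f Z) = (\<lambda>Z. c * T f Z)"
    "\<And>f. f \<in> A2 \<Longrightarrow> nrm (T f) \<le> K * nrm f"
  shows "T \<in> BO"
  unfolding bounded_ops_def
proof (intro CollectI conjI)
  show "T \<in> A2 \<rightarrow>\<^sub>E A2" by (intro PiE_I assms(1,2))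
  show "\<exists>K. \<forall>f\<in>A2. nrm (T f) \<le> K * nrm f" using assms(5) by blast
qed (intro ballI allI assms(3,4); assumption)+

lemma BO_id: "op_id lam \<in> BO"
  by (rule BO_I[where K = 1]) (simp_all add: op_id_def A2_add A2_cmult)

lemma BO_add: assumes S: "S \<in> BO" and T: "T \<in> BO" shows "op_add lam S T \<in> BO"
proof -
  obtain K where K: "0 \<le> K" "\<And>f. f \<in> A2 \<Longrightarrow> nrm (S f) \<le> K * nrm f" using BO_bound[OF S] by blast
  obtain K' where K': "0 \<le> K'" "\<And>f. f \<in> A2 \<Longrightarrow> nrm (T f) \<le> K' * nrm f" using BO_bound[OF T] by blast
  have "nrm (op_add lam S T f) \<le> (K + K') * nrm f" if f: "f \<in> A2" for f
  proof -
    have "nrm (\<lambda>Z. S f Z + T f Z) \<le> nrm (S f) + nrm (T f)"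
      by (rule nrm_triangle[OF A2D(1)[OF BO_D(1)[OF S f]] A2D(1)[OF BO_D(1)[OF T f]]])
    also have "\<dots> \<le> (K + K') * nrm f" using K(2)[OF f] K'(2)[OF f] by (simp add: distrib_right)
    finally show ?thesis using f by (simp add: op_add_def)
  qed
  then show ?thesis
  proof (rule BO_I[rotated 4])
    show "op_add lam S T f \<in> A2" if f: "f \<in> A2" for f
      using f by (simp add: op_add_def A2_add A2_cmult BO_D[OF S] BO_D[OF T])
    show "op_add lam S T f = undefined" if "f \<notin> A2" for f
      using that by (simp add: op_add_def)
    show "op_add lam S T (\<lambda>Z. f Z + g Z) = (\<lambda>Z. op_add lam S T f Z + op_add lam S T g Z)" if "f \<in> A2" "g \<in> A2" for f g
      using that by (simp add: op_add_def A2_add A2_cmult BO_D[OF S] BO_D[OF T] algebra_simps)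
    show "op_add lam S T (\<lambda>Z. c * f Z) = (\<lambda>Z. c * op_add lam S T f Z)" if "f \<in> A2" for c f
      using that by (simp add: op_add_def A2_add A2_cmult BO_D[OF S] BO_D[OF T] algebra_simps)
  qed
qed

lemma BO_scale: assumes T: "T \<in> BO" shows "op_scale lam c T \<in> BO"
proof -
  obtain K where K: "0 \<le> K" "\<And>f. f \<in> A2 \<Longrightarrow> nrm (T f) \<le> K * nrm f" using BO_bound[OF T] by blast
  have "nrm (op_scale lam c T f) \<le> (cmod c * K) * nrm f" if f: "f \<in> A2" for f
    using mult_left_mono[OF K(2)[OF f], of "cmod c"] f by (simp add: op_scale_def nrm_cmult mult.assoc)
  then show ?thesis
  proof (rule BO_I[rotated 4])
    show "op_scale lam c T f \<in> A2" if f: "f \<in> A2" for f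
      using f by (simp add: op_scale_def A2_add A2_cmult BO_D[OF T])
    show "op_scale lam c T f = undefined" if "f \<notin> A2" for f
      using that by (simp add: op_scale_def)
    show "op_scale lam c T (\<lambda>Z. f Z + g Z) = (\<lambda>Z. op_scale lam c T f Z + op_scale lam c T g Z)" if "f \<in> A2" "g \<in> A2" for f g
      using that by (simp add: op_scale_def A2_add A2_cmult BO_D[OF T] algebra_simps)
    show "op_scale lam c T (\<lambda>Z. k * f Z) = (\<lambda>Z. k * op_scale lam c T f Z)" if "f \<in> A2" for k f
      using that by (simp add: op_scale_def A2_add A2_cmult BO_D[OF T] algebra_simps)
  qed
qed

lemma BO_mult: assumes S: "S \<in> BO" and T: "T \<in> BO" shows "op_mult lam S T \<in> BO"
proof -
  obtain K where K: "0 \<le> K" "\<And>f. f \<in> A2 \<Longrightarrow> nrm (S f) \<le> K * nrm f" using BO_bound[OF S] by blast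
  obtain K' where K': "0 \<le> K'" "\<And>f. f \<in> A2 \<Longrightarrow> nrm (T f) \<le> K' * nrm f" using BO_bound[OF T] by blast
  have "nrm (op_mult lam S T f) \<le> (K * K') * nrm f" if f: "f \<in> A2" for f
    using order_trans[OF K(2)[OF BO_D(1)[OF T f]] mult_left_mono[OF K'(2)[OF f] K(1)]] f
    by (simp add: op_mult_def compose_def mult.assoc)
  then show ?thesis
  proof (rule BO_I[rotated 4])
    show "op_mult lam S T f \<in> A2" if f: "f \<in> A2" for f
      using f by (simp add: op_mult_def compose_def A2_add A2_cmult BO_D[OF S] BO_D[OF T])
    show "op_mult lam S T f = undefined" if "f \<notin> A2" for f
      using that by (simp add: op_mult_def compose_def)
    show "op_mult lam S T (\<lambda>Z. f Z + g Z) = (\<lambda>Z. op_mult lam S T f Z + op_mult lam S T g Z)" if "f \<in> A2" "g \<in> A2" for f g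
      using that by (simp add: op_mult_def compose_def A2_add A2_cmult BO_D[OF S] BO_D[OF T] algebra_simps)
    show "op_mult lam S T (\<lambda>Z. c * f Z) = (\<lambda>Z. c * op_mult lam S T f Z)" if "f \<in> A2" for c f
      using that by (simp add: op_mult_def compose_def A2_add A2_cmult BO_D[OF S] BO_D[OF T] algebra_simps)
  qed
qed

lemma op_mult_eq_iff:
  "op_mult lam S T = op_mult lam S' T' \<longleftrightarrow> (\<forall>f\<in>A2. S (T f) = S' (T' f))"
  by (auto simp: op_mult_def compose_def fun_eq_iff restrict_def)

lemma mem_commutant:
  "T \<in> commutant lam X \<longleftrightarrow> T \<in> BO \<and> (\<forall>S\<in>X. \<forall>f\<in>A2. T (S f) = S (T f))"
  by (simp add: commutant_def op_mult_eq_iff)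

lemma unital_subalgebra_commutant:
  assumes X: "X \<subseteq> BO" shows "unital_subalgebra lam (commutant lam X)"
proof -
  have id: "op_id lam \<in> commutant lam X"
    unfolding mem_commutant
  proof (intro conjI ballI BO_id)
    fix S f assume "S \<in> X" and f: "f \<in> A2"
    then have "S \<in> BO" using X by blast
    then show "op_id lam (S f) = S (op_id lam f)" using BO_D(1)[of S f] f by (simp add: op_id_def)
  qed
  have add: "op_add lam S T \<in> commutant lam X" and mult: "op_mult lam S T \<in> commutant lam X"
    if S: "S \<in> commutant lam X" and T: "T \<in> commutant lam X" for S T
  proof -
    have SB: "S \<in> BO" and TB: "T \<in> BO" using S T by (auto simp: mem_commutant)
    have "op_add lam S T (R f) = R (op_add lam S T f)" if R: "R \<in> X" and f: "f \<in> A2" for R f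
    proof -
      have RB: "R \<in> BO" using R X by blast
      have "S (R f) = R (S f)" "T (R f) = R (T f)" using S T R f by (auto simp: mem_commutant)
      then show ?thesis
        using BO_D(3)[OF RB BO_D(1)[OF SB f] BO_D(1)[OF TB f]] BO_D(1)[OF RB f] f by (simp add: op_add_def)
    qed
    then show "op_add lam S T \<in> commutant lam X" unfolding mem_commutant using BO_add[OF SB TB] by blast
    have "op_mult lam S T (R f) = R (op_mult lam S T f)" if R: "R \<in> X" and f: "f \<in> A2" for R f
    proof -
      have RB: "R \<in> BO" using R X by blast
      have "T (R f) = R (T f)" "S (R (T f)) = R (S (T f))"
        using S T R f BO_D(1)[OF TB f] by (auto simp: mem_commutant)
      then show ?thesis using BO_D(1)[OF RB f] f by (simp add: op_mult_def compose_def)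
    qed
    then show "op_mult lam S T \<in> commutant lam X" unfolding mem_commutant using BO_mult[OF SB TB] by blast
  qed
  have scale: "op_scale lam c T \<in> commutant lam X" if T: "T \<in> commutant lam X" for T c
  proof -
    have TB: "T \<in> BO" using T by (auto simp: mem_commutant)
    have "op_scale lam c T (R f) = R (op_scale lam c T f)" if R: "R \<in> X" and f: "f \<in> A2" for R f
    proof -
      have RB: "R \<in> BO" using R X by blast
      have "T (R f) = R (T f)" using T R f by (auto simp: mem_commutant)
      then show ?thesis
        using BO_D(4)[OF RB BO_D(1)[OF TB f]] BO_D(1)[OF RB f] f by (simp add: op_scale_def)
    qed
    then show ?thesis unfolding mem_commutant using BO_scale[OF TB] by blast
  qed
  have "commutant lam X \<subseteq> BO" by (auto simp: mem_commutant)
  then show ?thesis unfolding unital_subalgebra_def using id add mult scale by blast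
qed

text \<open>If \<open>S\<close> commutes with \<open>R\<close>, then \<open>T R - R T = (T - S) R + R (S - T)\<close>, which is small when \<open>S\<close> is close
to \<open>T\<close>.\<close>

lemma norm_closed_commutant:
  assumes X: "X \<subseteq> BO" shows "norm_closed lam (commutant lam X)"
  unfolding norm_closed_def
proof (intro ballI impI)
  fix T assume T: "T \<in> BO" and approx: "\<forall>e>0. \<exists>S\<in>commutant lam X. op_dist lam S T < e"
  have "T (R f) = R (T f)" if R: "R \<in> X" and f: "f \<in> A2" for R f
  proof -
    have RB: "R \<in> BO" using R X by blast
    obtain K where K: "0 \<le> K" "\<And>f. f \<in> A2 \<Longrightarrow> nrm (R f) \<le> K * nrm f" using BO_bound[OF RB] by blast
    have Rf: "R f \<in> A2" and Tf: "T f \<in> A2" by (rule BO_D(1)[OF RB f], rule BO_D(1)[OF T f])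
    let ?d = "\<lambda>Z. T (R f) Z - R (T f) Z"
    have dA: "?d \<in> A2" by (rule A2_diff[OF BO_D(1)[OF T Rf] BO_D(1)[OF RB Tf]])
    define c where "c = nrm (R f) + K * nrm f"
    have c: "0 \<le> c" using K(1) nrm_nonneg by (simp add: c_def)
    have "nrm ?d \<le> e" if e: "0 < e" for e
    proof -
      define e' where "e' = e / (c + 1)"
      have e': "0 < e'" "e' * c \<le> e"
      proof -
        have "e' * c = e * (c / (c + 1))" by (simp add: e'_def)
        also have "\<dots> \<le> e * 1" using e c by (intro mult_left_mono) auto
        finally show "e' * c \<le> e" by simp
      qed (use e c in \<open>simp add: e'_def\<close>)
      obtain S where S: "S \<in> commutant lam X" "op_dist lam S T < e'" using approx e'(1) by blast
      have SB: "S \<in> BO" using S by (simp add: mem_commutant)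
      have comm: "S (R f) = R (S f)" using S R f by (auto simp: mem_commutant)
      have Sf: "S f \<in> A2" by (rule BO_D(1)[OF SB f])
      let ?E = "op_add lam S (op_scale lam (-1) T)"
      have EB: "?E \<in> BO" by (rule BO_add[OF SB BO_scale[OF T]])
      have Eg: "?E g = (\<lambda>Z. S g Z - T g Z)" if "g \<in> A2" for g
        using that by (simp add: op_add_def op_scale_def)
      have En: "nrm (\<lambda>Z. S g Z - T g Z) \<le> e' * nrm g" if g: "g \<in> A2" for g
      proof -
        have "nrm (?E g) \<le> op_norm lam ?E * nrm g" by (rule op_norm_bound[OF EB g])
        also have "\<dots> \<le> e' * nrm g"
          using S(2) by (intro mult_right_mono nrm_nonneg) (simp add: op_dist_def)
        finally show ?thesis unfolding Eg[OF g] .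
      qed
      have k1: "(\<lambda>Z. S (R f) Z - T (R f) Z) \<in> A2" by (rule A2_diff[OF BO_D(1)[OF SB Rf] BO_D(1)[OF T Rf]])
      have k2: "(\<lambda>Z. S f Z - T f Z) \<in> A2" by (intro A2_diff Sf Tf)
      have Rk: "R (\<lambda>Z. S f Z - T f Z) = (\<lambda>Z. R (S f) Z - R (T f) Z)"
        using BO_D(3)[OF RB Sf A2_cmult[OF Tf, of "-1"]] BO_D(4)[OF RB Tf, of "-1"] by simp
      have "?d = (\<lambda>Z. (-1) * (S (R f) Z - T (R f) Z) + R (\<lambda>Z. S f Z - T f Z) Z)"
        unfolding Rk comm by (simp add: algebra_simps)
      then have "nrm ?d = nrm (\<lambda>Z. (-1) * (S (R f) Z - T (R f) Z) + R (\<lambda>Z. S f Z - T f Z) Z)" by (rule arg_cong)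
      also have "\<dots> \<le> nrm (\<lambda>Z. (-1) * (S (R f) Z - T (R f) Z)) + nrm (R (\<lambda>Z. S f Z - T f Z))"
        by (rule nrm_triangle[OF A2D(1)[OF A2_cmult[OF k1]] A2D(1)[OF BO_D(1)[OF RB k2]]])
      also have "\<dots> \<le> e' * nrm (R f) + K * (e' * nrm f)"
      proof (rule add_mono)
        show "nrm (\<lambda>Z. (-1) * (S (R f) Z - T (R f) Z)) \<le> e' * nrm (R f)"
          unfolding nrm_cmult using En[OF Rf] by simp
        show "nrm (R (\<lambda>Z. S f Z - T f Z)) \<le> K * (e' * nrm f)"
          by (rule order_trans[OF K(2)[OF k2] mult_left_mono[OF En[OF f] K(1)]])
      qed
      also have "\<dots> = e' * c" by (simp add: c_def algebra_simps)
      finally show ?thesis using e'(2) by linarith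
    qed
    then have "nrm ?d \<le> 0" by (rule field_le_epsilon[of _ 0, simplified])
    then have "nrm ?d = 0" using nrm_nonneg[of ?d] by linarith
    from nrm_zero[OF dA this] show ?thesis by (auto simp: fun_eq_iff)
  qed
  with T show "T \<in> commutant lam X" unfolding mem_commutant by blast
qed

text \<open>The algebra generated by commuting operators lies in their commutant, hence each generator
  commutes with the whole algebra; so the algebra lies in its own commutant.\<close>

lemma generated_algebra_commutative:
  assumes G: "G \<subseteq> BO" and comm: "\<And>S T f. S \<in> G \<Longrightarrow> T \<in> G \<Longrightarrow> f \<in> A2 \<Longrightarrow> S (T f) = T (S f)"
  shows "commutative_ops lam (\<Inter>{A. unital_subalgebra lam A \<and> norm_closed lam A \<and> G \<subseteq> A})"
    (is "commutative_ops lam ?A")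
proof -
  have least: "?A \<subseteq> commutant lam X" if "X \<subseteq> BO" "G \<subseteq> commutant lam X" for X
    using that unital_subalgebra_commutant[OF that(1)] norm_closed_commutant[OF that(1)] by blast
  have "G \<subseteq> commutant lam G" using G comm unfolding mem_commutant subset_iff by blast
  from least[OF G this] have AG: "?A \<subseteq> commutant lam G" .
  then have AB: "?A \<subseteq> BO" unfolding commutant_def by blast
  have "G \<subseteq> commutant lam ?A"
  proof
    fix T assume T: "T \<in> G"
    have "T (S f) = S (T f)" if "S \<in> ?A" "f \<in> A2" for S f
    proof -
      have "S \<in> commutant lam G" using AG that(1) by blast
      then show ?thesis using T that(2) unfolding mem_commutant by simp
    qed
    then show "T \<in> commutant lam ?A" using T G unfolding mem_commutant by blast
  qed
  from least[OF AB this] have "?A \<subseteq> commutant lam ?A" .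
  then show ?thesis unfolding commutative_ops_def commutant_def by blast
qed

end

section \<open>Commutativity of the Toeplitz algebra\<close>

lemma matrix_inv_eqI:
  fixes A B :: "'n::finite cmat"
  assumes "A ** B = mat 1" "B ** A = mat 1"
  shows "matrix_inv A = B"
proof -
  have "A ** matrix_inv A = mat 1 \<and> matrix_inv A ** A = mat 1"
    unfolding matrix_inv_def by (rule someI[of _ B]) (use assms in simp)
  then have "matrix_inv A = matrix_inv A ** (A ** B)" "matrix_inv A ** A = mat 1" using assms by simp_all
  then show ?thesis by (simp add: matrix_mul_assoc)
qed

lemma Linfty_left_iff: "a \<in> Linfty_left \<longleftrightarrow> invariant_symbol True a"
  by (simp add: Linfty_left_def invariant_symbol_def act_def)

lemma Linfty_right_iff: "b \<in> Linfty_right \<longleftrightarrow> invariant_symbol False b"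
  by (simp add: Linfty_right_def invariant_symbol_def act_def)

text \<open>The bi-invariance is applied with \<open>B = I\<close> and \<open>A = U\<^sup>*\<close>, or with \<open>A = I\<close> and \<open>B = U\<close>.\<close>

lemma Linfty_biinv_invariant:
  fixes \<phi> :: "'n::finite cmat \<Rightarrow> complex"
  assumes "\<phi> \<in> Linfty_biinv"
  shows "invariant_symbol l \<phi>"
proof -
  have one: "(mat 1 :: 'n cmat) \<in> unitary_group" by (simp add: unitary_group_def)
  have inv: "AE Z in lebesgue_on cartan_domain. \<phi> (matrix_inv A ** Z ** B) = \<phi> Z"
    if "A \<in> unitary_group" "B \<in> unitary_group" for A B
    using assms that by (simp add: Linfty_biinv_def)
  have "AE Z in lebesgue_on cartan_domain. \<phi> (act l U Z) = \<phi> Z" if U: "U \<in> unitary_group" for U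
  proof (cases l)
    case True
    have "matrix_inv (ctranspose U) = U" using U by (intro matrix_inv_eqI) (simp_all add: unitary_group_def)
    then show ?thesis using inv[OF unitary_ctranspose[OF U] one] True by (simp add: act_def)
  next
    case False
    have "matrix_inv (mat 1 :: 'n cmat) = mat 1" by (rule matrix_inv_eqI) simp_all
    then show ?thesis using inv[OF one U] False by (simp add: act_def)
  qed
  then show ?thesis using assms by (simp add: invariant_symbol_def Linfty_biinv_def)
qed

theorem theorem4p22:
  fixes lam :: real
    and a b :: "complex^'n^'n \<Rightarrow> complex"
    and \<S> :: "(complex^'n^'n \<Rightarrow> complex) set"
  assumes "CARD('n) \<ge> 2"
    and "lam > 2 * real CARD('n) - 1"
    and "a \<in> Linfty_left"
    and "b \<in> Linfty_right"
    and "\<not> normal_op lam (toeplitz lam a)"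
    and "\<not> normal_op lam (toeplitz lam b)"
    and "\<S> = Linfty_biinv \<union> {a, b}"
  shows "commutative_ops lam (toeplitz_banach_algebra lam \<S>)
    \<and> \<not> adj_closed lam (toeplitz_banach_algebra lam \<S>)
    \<and> \<not> commutative_ops lam (toeplitz_cstar_algebra lam \<S>)"
proof -
  interpret bergman_setting lam "TYPE('n)"
    by unfold_locales (rule assms(2))
  have a: "invariant_symbol True a" and b: "invariant_symbol False b"
    using assms(3,4) by (simp_all add: Linfty_left_iff Linfty_right_iff)
  have bi: "invariant_symbol l \<phi>" if "\<phi> \<in> Linfty_biinv" for l and \<phi> :: "'n cmat \<Rightarrow> complex"
    by (rule Linfty_biinv_invariant[OF that])
  have inv: "s = t \<or> invariant_symbol True s \<and> invariant_symbol False t \<or> invariant_symbol True t \<and> invariant_symbol False s"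
    if "s \<in> \<S>" "t \<in> \<S>" for s t
    using that a b bi unfolding assms(7) by blast
  have symbol: "s \<in> Linfty" if "s \<in> \<S>" for s
    using that a b bi[of s True] unfolding assms(7) invariant_symbol_def by blast
  have comm: "toeplitz lam s (toeplitz lam t f) = toeplitz lam t (toeplitz lam s f)"
    if "s \<in> \<S>" "t \<in> \<S>" "f \<in> bergman_space lam" for s t f
    using inv[OF that(1,2)] toep_commute[of s t f] toep_commute[of t s f] that(3) by metis
  have G: "toeplitz lam ` \<S> \<subseteq> bounded_ops lam" using symbol toep_bounded_ops by blast
  have 1: "commutative_ops lam (toeplitz_banach_algebra lam \<S>)"
    unfolding toeplitz_banach_algebra_def
    by (rule generated_algebra_commutative[OF G]) (use comm in blast)
  \<comment> \<open>A commutative adjoint-closed set that contains the operator would make it normal.\<close>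
  have not_both: "\<not> (commutative_ops lam A \<and> adj_closed lam A)" if "toeplitz lam a \<in> A" for A
    using that assms(5) unfolding commutative_ops_def adj_closed_def normal_op_def by blast
  have aS: "a \<in> \<S>" using assms(7) by simp
  then have "toeplitz lam a \<in> toeplitz_banach_algebra lam \<S>"
    unfolding toeplitz_banach_algebra_def by blast
  with 1 not_both have 2: "\<not> adj_closed lam (toeplitz_banach_algebra lam \<S>)" by blast
  have "adj_closed lam (toeplitz_cstar_algebra lam \<S>)"
    unfolding toeplitz_cstar_algebra_def adj_closed_def by blast
  moreover have "toeplitz lam a \<in> toeplitz_cstar_algebra lam \<S>"
    using aS unfolding toeplitz_cstar_algebra_def by blast
  ultimately have 3: "\<not> commutative_ops lam (toeplitz_cstar_algebra lam \<S>)" using not_both by blast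
  show ?thesis using 1 2 3 by blast
qed

end
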